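(* Let $(\Sigma_{A},\sigma)$ be a one-sided topologically exact subshift of finite type over the alphabet $\Sigma=\{1,\dots,l\}$, $l\in\mathbb{N}$, let $\mu_\phi$ be a Gibbs measure for a Hölder continuous potential $\phi\in C(\Sigma_A;\mathbb{R})$, fix a Haar basis for $(\Sigma_A,\mu_\phi)$, and let $D_{\mu_\phi}$ be the operator on $L^2(\Sigma_A,\mathcal{B},\mu_\phi)$ defined in the context. Let $\pi:C(\Sigma_A;\mathbb{C})\to B(L^2(\Sigma_A,\mathcal{B},\mu_\phi))$ be given by $\pi(a)h=a\cdot h$ for each $a\in C(\Sigma_A;\mathbb{C})$ and each $h\in L^2(\Sigma_A,\mathcal{B},\mu_\phi)$. Then $(C(\Sigma_A;\mathbb{C}),L^2(\Sigma_A,\mathcal{B},\mu_\phi),\pi,D_{\mu_\phi})$ is a spectral triple.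
   Context: **Spectral triple.** A spectral triple $(\mathcal{A},H,\pi,D)$ consists of a unital $C^*$-algebra $\mathcal{A}$, a separable Hilbert space $H$, a faithful $*$-representation $\pi:\mathcal{A}\to B(H)$, and an essentially self-adjoint, unbounded linear operator $D$ on $H$ with compact resolvent, such that the set of $a\in\mathcal{A}$ for which $[D,\pi(a)]$ is densely defined and extends to a bounded operator on $H$ is norm dense in $\mathcal{A}$. **Subshift.** Fix $l\in\mathbb{N}$ and an irreducible, aperiodic $l\times l$ matrix $A=[a_{j,k}]$ with entries in $\{0,1\}$. Put $\Sigma=\{1,\dots,l\}$, $\Sigma_A=\{\omega=(\omega_1,\omega_2,\dots)\in\Sigma^{\mathbb{N}} : a_{\omega_k,\omega_{k+1}}=1\ \forall k\in\mathbb{N}\}$, $\Sigma_A^k=\{(x_1,\dots,x_k)\in\Sigma^k : a_{x_i,x_{i+1}}=1 \text{ for } 1\le i<k\}$ for $k\ge 1$ (so $\Sigma_A^1=\Sigma$), and $\Sigma_A^*=\bigcup_{k\ge1}\Sigma_A^k$. For $x\in\Sigma_A^k$ the cylinder set is $[x]=\{\omega\in\Sigma_A : (\omega_1,\dots,\omega_k)=x\}$. $\Sigma_A$ carries the compact topology generated by the cylinder sets, metrized by $d(\omega,\upsilon)=2^{-\omega\wedge\upsilon}$, where $\omega\wedge\upsilon$ is the length of the longest common initial word; $\mathcal{B}$ is its Borel $\sigma$-algebra; Hölder continuity is with respect to this metric. The shift is $\sigma(\omega_1,\omega_2,\dots)=(\omega_2,\omega_3,\dots)$. The system $(\Sigma_A,\sigma)$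 is called a one-sided topologically exact subshift of finite type. For $x=(x_1,\dots,x_k)\in\Sigma_A^k$ put $\alpha(x)=\sum_{i=1}^{l}a_{x_k,i}$. **Gibbs measure.** For $\phi\in C(\Sigma_A;\mathbb{R})$ put $S_k\phi=\sum_{m=0}^{k-1}\phi\circ\sigma^m$. For a $\sigma$-invariant Borel probability measure $\mu$ the entropy is $h_\mu(\sigma)=\lim_{k\to\infty}\frac1k\sum_{x\in\Sigma_A^k}-\mu([x])\ln\mu([x])$. The topological pressure is $P(\phi,\sigma)=\sup\{h_\mu(\sigma)+\int\phi\,d\mu : \mu \text{ a } \sigma\text{-invariant Borel probability measure}\}$. A Gibbs measure for a Hölder continuous $\phi$ is a Borel probability measure $\mu_\phi$ on $\Sigma_A$ for which there is $c>1$ with $c^{-1}\le \mu_\phi([(\omega_1,\dots,\omega_k)])\,/\,e^{S_k\phi(\omega)-kP(\phi,\sigma)}\le c$ for all $k\in\mathbb{N}$, $\omega\in\Sigma_A$. **Haar basis.** For each $x\in\Sigma_A^k$, $k\ge1$, fix a bijection $\theta_x:\{y\in\Sigma : a_{x_k,y}=1\}\to\{1,\dots,\alpha(x)\}$, and write $x\theta_x^{-1}(j)$ for the word $(x_1,\dots,x_k,\theta_x^{-1}(j))$. On $\mathbb{R}^{\alpha(x)}$ use the inner product $\langle r,s\rangle_x=\sum_{j=1}^{\alpha(x)}\mu_\phi([x\theta_x^{-1}(j)])\,r_js_j$, with orthonormal basis $f_{x,j}=\mu_\phi([x\theta_x^{-1}(j)])^{-1/2}\delta_j$ ($\delta_j$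 = $j$-th standard unit vector). Let $\Omega_x$ be the set of linear maps $U$ of $\mathbb{R}^{\alpha(x)}$ with positive determinant, preserving $\langle\cdot,\cdot\rangle_x$, and with $U(f_{x,\alpha(x)})=\mu_\phi([x])^{-1/2}(1,\dots,1)$. Fix $U_x\in\Omega_x$ for every $x\in\Sigma_A^*$ and, for $j\in\{1,\dots,\alpha(x)-1\}$, let $$e_{x,j}=\sum_{k=1}^{\alpha(x)}\mu_\phi([x\theta_x^{-1}(k)])^{-1/2}\,\langle f_{x,k},U_x(f_{x,j})\rangle_x\,\mathbf{1}_{[x\theta_x^{-1}(k)]}.$$ The functions $e_{x,j}$ ($x\in\Sigma_A^*$, $1\le j\le\alpha(x)-1$) together with $\mu_\phi([x])^{-1/2}\mathbf{1}_{[x]}$ ($x\in\Sigma$) form an orthonormal basis of $L^2(\Sigma_A,\mathcal{B},\mu_\phi)$, called a Haar basis for $(\Sigma_A,\mu_\phi)$. **Dirac operator.** The operator $D_{\mu_\phi}$ is defined on $\mathrm{Dom}(D_{\mu_\phi})$, a dense subset of $L^2(\Sigma_A,\mathcal{B},\mu_\phi)$ which contains all finite linear combinations of elements of the given Haar basis, by $$D_{\mu_\phi}=\sum_{x\in\Sigma}\frac{1}{\mu_\phi([x])}\langle\cdot,\mathbf{1}_{[x]}\rangle\mathbf{1}_{[x]}-\langle\cdot,\mathbf{1}_{\Sigma_A}\rangle\mathbf{1}_{\Sigma_A}+\sum_{y\in\Sigma_A^*}\frac{\alpha(y)-1}{\mu_\phi([y])}\sum_{k=1}^{\alpha(y)-1}\langle\cdot,e_{y,k}\rangle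 e_{y,k},$$ where $\langle\cdot,\cdot\rangle$ is the inner product of $L^2(\Sigma_A,\mathcal{B},\mu_\phi)$.
   Formalization: Unboundedness of the Dirac operator is required only when the L² space is infinite-dimensional (always so for l ≥ 2): for l = 1 the space is one-dimensional and the operator is 0, so strict unboundedness fails. *)

theory Defs
  imports
    "HOL-Probability.Probability"
    "HOL-Algebra.Module"
    "HOL-Algebra.Algebraic_Closure_Type"
    "Jordan_Normal_Form.Determinant"
begin

text \<open>HOL-Algebra's \<open>closure_of\<close> clashes with the topological closure.\<close>

no_notation eq_closure_of (\<open>closure'_of\<index>\<close>)

section \<open>Hilbert spaces, operators and spectral triples\<close>

abbreviation complex_ring :: "complex ring" where
  "complex_ring \<equiv> ring_of_type_algebra"

subsection \<open>Complex Hilbert spaces with explicit carrier\<close>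

text \<open>The ring multiplication and unit that the record \<open>module\<close> inherits are not used for
  Hilbert spaces.\<close>

record 'h hilb = "(complex, 'h) module" +
  hinner :: "'h \<Rightarrow> 'h \<Rightarrow> complex"

definition hnorm :: "('h, 'm) hilb_scheme \<Rightarrow> 'h \<Rightarrow> real" where
  "hnorm H x = sqrt (Re (hinner H x x))"

text \<open>The value 0 off the carrier is there because the locale \<open>Metric_space\<close> requires
  nonnegativity and symmetry on the whole type; likewise for \<open>adist\<close> below.\<close>

definition hdist :: "('h, 'm) hilb_scheme \<Rightarrow> 'h \<Rightarrow> 'h \<Rightarrow> real" where
  "hdist H x y = (if x \<in> carrier H \<and> y \<in> carrier H then hnorm H (x \<ominus>\<^bsub>H\<^esub> y) else 0)"

definition hilbert_topology :: "('h, 'm) hilb_scheme \<Rightarrow> 'h topology" where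
  "hilbert_topology H = Metric_space.mtopology (carrier H) (hdist H)"

locale hilbert_space = module complex_ring H
  for H :: "('h, 'm) hilb_scheme" (structure) +
  assumes hinner_add: "\<lbrakk>x \<in> carrier H; y \<in> carrier H; z \<in> carrier H\<rbrakk>
      \<Longrightarrow> hinner H (x \<oplus> y) z = hinner H x z + hinner H y z"
    and hinner_smult: "\<lbrakk>x \<in> carrier H; y \<in> carrier H\<rbrakk>
      \<Longrightarrow> hinner H (c \<odot> x) y = c * hinner H x y"
    and hinner_cnj: "\<lbrakk>x \<in> carrier H; y \<in> carrier H\<rbrakk> \<Longrightarrow> hinner H y x = cnj (hinner H x y)"
    and hinner_nonneg: "x \<in> carrier H \<Longrightarrow> 0 \<le> Re (hinner H x x)"
    and hinner_definite: "\<lbrakk>x \<in> carrier H; hinner H x x = 0\<rbrakk> \<Longrightarrow> x = \<zero>"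
    and complete: "Metric_space.mcomplete (carrier H) (hdist H)"

definition linear_subspace :: "('h, 'm) hilb_scheme \<Rightarrow> 'h set \<Rightarrow> bool" where
  "linear_subspace H V \<longleftrightarrow> V \<subseteq> carrier H \<and> \<zero>\<^bsub>H\<^esub> \<in> V \<and>
     (\<forall>x\<in>V. \<forall>y\<in>V. x \<oplus>\<^bsub>H\<^esub> y \<in> V) \<and> (\<forall>c. \<forall>x\<in>V. c \<odot>\<^bsub>H\<^esub> x \<in> V)"

definition linear_span :: "('h, 'm) hilb_scheme \<Rightarrow> 'h set \<Rightarrow> 'h set" where
  "linear_span H S = {finsum H (\<lambda>v. c v \<odot>\<^bsub>H\<^esub> v) F | c F. finite F \<and> F \<subseteq> S}"

definition finite_dimensional :: "('h, 'm) hilb_scheme \<Rightarrow> bool" where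
  "finite_dimensional H \<longleftrightarrow> (\<exists>F. finite F \<and> F \<subseteq> carrier H \<and> linear_span H F = carrier H)"

definition dense_in :: "('h, 'm) hilb_scheme \<Rightarrow> 'h set \<Rightarrow> bool" where
  "dense_in H V \<longleftrightarrow> hilbert_topology H closure_of V = carrier H"

text \<open>Unconditional convergence in norm of a family indexed by \<open>I\<close>.\<close>

definition hilbert_has_sum ::
  "('h, 'm) hilb_scheme \<Rightarrow> ('i \<Rightarrow> 'h) \<Rightarrow> 'i set \<Rightarrow> 'h \<Rightarrow> bool" where
  "hilbert_has_sum H f I s \<longleftrightarrow>
     limitin (hilbert_topology H) (\<lambda>F. finsum H f F) s (finite_subsets_at_top I)"

subsection \<open>Operators\<close>

text \<open>A linear operator is a pair \<open>(V, T)\<close> of a domain and a function; the values of \<open>T\<close> outside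
  \<open>V\<close> are irrelevant.\<close>

definition linear_operator :: "('h, 'm) hilb_scheme \<Rightarrow> 'h set \<Rightarrow> ('h \<Rightarrow> 'h) \<Rightarrow> bool" where
  "linear_operator H V T \<longleftrightarrow> linear_subspace H V \<and> T \<in> V \<rightarrow> carrier H \<and>
     (\<forall>x\<in>V. \<forall>y\<in>V. T (x \<oplus>\<^bsub>H\<^esub> y) = T x \<oplus>\<^bsub>H\<^esub> T y) \<and>
     (\<forall>c. \<forall>x\<in>V. T (c \<odot>\<^bsub>H\<^esub> x) = c \<odot>\<^bsub>H\<^esub> T x)"

definition bounded_on :: "('h, 'm) hilb_scheme \<Rightarrow> 'h set \<Rightarrow> ('h \<Rightarrow> 'h) \<Rightarrow> bool" where
  "bounded_on H V T \<longleftrightarrow> (\<exists>C. \<forall>x\<in>V. hnorm H (T x) \<le> C * hnorm H x)"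

definition bounded_operators :: "('h, 'm) hilb_scheme \<Rightarrow> ('h \<Rightarrow> 'h) set" where
  "bounded_operators H = {T. linear_operator H (carrier H) T \<and> bounded_on H (carrier H) T}"

definition compact_operator :: "('h, 'm) hilb_scheme \<Rightarrow> ('h \<Rightarrow> 'h) \<Rightarrow> bool" where
  "compact_operator H T \<longleftrightarrow> T \<in> bounded_operators H \<and>
     compactin (hilbert_topology H)
       (hilbert_topology H closure_of (T ` {x \<in> carrier H. hnorm H x \<le> 1}))"

text \<open>The closure and the adjoint of an operator are taken on the level of graphs.\<close>

definition operator_graph :: "'h set \<Rightarrow> ('h \<Rightarrow> 'h) \<Rightarrow> ('h \<times> 'h) set" where
  "operator_graph V T = (\<lambda>x. (x, T x)) ` V"

definition graph_closure :: "('h, 'm) hilb_scheme \<Rightarrow> ('h \<times> 'h) set \<Rightarrow> ('h \<times> 'h) set" where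
  "graph_closure H G = prod_topology (hilbert_topology H) (hilbert_topology H) closure_of G"

definition graph_adjoint :: "('h, 'm) hilb_scheme \<Rightarrow> ('h \<times> 'h) set \<Rightarrow> ('h \<times> 'h) set" where
  "graph_adjoint H G = {(y, z). y \<in> carrier H \<and> z \<in> carrier H \<and>
     (\<forall>(u, v)\<in>G. hinner H v y = hinner H u z)}"

text \<open>Symmetry and single-valuedness (closability) follow from the other conditions.\<close>

definition essentially_self_adjoint ::
  "('h, 'm) hilb_scheme \<Rightarrow> 'h set \<Rightarrow> ('h \<Rightarrow> 'h) \<Rightarrow> bool" where
  "essentially_self_adjoint H V T \<longleftrightarrow>
     linear_operator H V T \<and> dense_in H V \<and>
     (\<forall>x\<in>V. \<forall>y\<in>V. hinner H (T x) y = hinner H x (T y)) \<and>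
     single_valued (graph_closure H (operator_graph V T)) \<and>
     graph_adjoint H (graph_closure H (operator_graph V T)) = graph_closure H (operator_graph V T)"

text \<open>\<open>R\<close> is the everywhere defined bounded inverse of \<open>T - z\<close>, for the operator \<open>T\<close> with
  graph \<open>G\<close>.\<close>

definition is_resolvent ::
  "('h, 'm) hilb_scheme \<Rightarrow> ('h \<times> 'h) set \<Rightarrow> complex \<Rightarrow> ('h \<Rightarrow> 'h) \<Rightarrow> bool" where
  "is_resolvent H G z R \<longleftrightarrow> R \<in> bounded_operators H \<and>
     (\<forall>(x, w)\<in>G. R (w \<ominus>\<^bsub>H\<^esub> z \<odot>\<^bsub>H\<^esub> x) = x) \<and>
     (\<forall>y\<in>carrier H. (R y, y \<oplus>\<^bsub>H\<^esub> z \<odot>\<^bsub>H\<^esub> R y) \<in> G)"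

text \<open>Resolvents exist only for closed operators, so for an essentially self-adjoint operator
  the compact resolvent condition refers to its closure.\<close>

definition has_compact_resolvent ::
  "('h, 'm) hilb_scheme \<Rightarrow> 'h set \<Rightarrow> ('h \<Rightarrow> 'h) \<Rightarrow> bool" where
  "has_compact_resolvent H V T \<longleftrightarrow>
     (\<exists>z R. is_resolvent H (graph_closure H (operator_graph V T)) z R) \<and>
     (\<forall>z R. is_resolvent H (graph_closure H (operator_graph V T)) z R \<longrightarrow> compact_operator H R)"

subsection \<open>Unital C*-algebras\<close>

record 'a cstar = "(complex, 'a) module" +
  star :: "'a \<Rightarrow> 'a"
  anorm :: "'a \<Rightarrow> real"

definition adist :: "('a, 'm) cstar_scheme \<Rightarrow> 'a \<Rightarrow> 'a \<Rightarrow> real" where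
  "adist A x y = (if x \<in> carrier A \<and> y \<in> carrier A then anorm A (x \<ominus>\<^bsub>A\<^esub> y) else 0)"

locale unital_cstar_algebra = module complex_ring A + ring A
  for A :: "('a, 'm) cstar_scheme" (structure) +
  assumes smult_mult_left: "\<lbrakk>x \<in> carrier A; y \<in> carrier A\<rbrakk> \<Longrightarrow> (c \<odot> x) \<otimes> y = c \<odot> (x \<otimes> y)"
    and smult_mult_right: "\<lbrakk>x \<in> carrier A; y \<in> carrier A\<rbrakk> \<Longrightarrow> x \<otimes> (c \<odot> y) = c \<odot> (x \<otimes> y)"
    and star_closed: "x \<in> carrier A \<Longrightarrow> star A x \<in> carrier A"
    and star_star: "x \<in> carrier A \<Longrightarrow> star A (star A x) = x"
    and star_add: "\<lbrakk>x \<in> carrier A; y \<in> carrier A\<rbrakk> \<Longrightarrow> star A (x \<oplus> y) = star A x \<oplus> star A y"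
    and star_smult: "x \<in> carrier A \<Longrightarrow> star A (c \<odot> x) = cnj c \<odot> star A x"
    and star_mult: "\<lbrakk>x \<in> carrier A; y \<in> carrier A\<rbrakk> \<Longrightarrow> star A (x \<otimes> y) = star A y \<otimes> star A x"
    and anorm_nonneg: "x \<in> carrier A \<Longrightarrow> 0 \<le> anorm A x"
    and anorm_zero_iff: "x \<in> carrier A \<Longrightarrow> anorm A x = 0 \<longleftrightarrow> x = \<zero>"
    and anorm_add: "\<lbrakk>x \<in> carrier A; y \<in> carrier A\<rbrakk> \<Longrightarrow> anorm A (x \<oplus> y) \<le> anorm A x + anorm A y"
    and anorm_smult: "x \<in> carrier A \<Longrightarrow> anorm A (c \<odot> x) = cmod c * anorm A x"
    and anorm_mult: "\<lbrakk>x \<in> carrier A; y \<in> carrier A\<rbrakk> \<Longrightarrow> anorm A (x \<otimes> y) \<le> anorm A x * anorm A y"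
    and cstar_identity: "x \<in> carrier A \<Longrightarrow> anorm A (star A x \<otimes> x) = (anorm A x)\<^sup>2"
    and complete: "Metric_space.mcomplete (carrier A) (adist A)"

definition faithful_star_representation ::
  "('a, 'm) cstar_scheme \<Rightarrow> ('h, 'n) hilb_scheme \<Rightarrow> ('a \<Rightarrow> 'h \<Rightarrow> 'h) \<Rightarrow> bool" where
  "faithful_star_representation A H \<pi> \<longleftrightarrow>
     (\<forall>a\<in>carrier A. \<pi> a \<in> bounded_operators H) \<and>
     (\<forall>a\<in>carrier A. \<forall>b\<in>carrier A. \<forall>h\<in>carrier H. \<pi> (a \<oplus>\<^bsub>A\<^esub> b) h = \<pi> a h \<oplus>\<^bsub>H\<^esub> \<pi> b h) \<and>
     (\<forall>c. \<forall>a\<in>carrier A. \<forall>h\<in>carrier H. \<pi> (c \<odot>\<^bsub>A\<^esub> a) h = c \<odot>\<^bsub>H\<^esub> \<pi> a h) \<and>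
     (\<forall>a\<in>carrier A. \<forall>b\<in>carrier A. \<forall>h\<in>carrier H. \<pi> (a \<otimes>\<^bsub>A\<^esub> b) h = \<pi> a (\<pi> b h)) \<and>
     (\<forall>h\<in>carrier H. \<pi> \<one>\<^bsub>A\<^esub> h = h) \<and>
     (\<forall>a\<in>carrier A. \<forall>g\<in>carrier H. \<forall>h\<in>carrier H.
        hinner H (\<pi> a g) h = hinner H g (\<pi> (star A a) h)) \<and>
     (\<forall>a\<in>carrier A. \<forall>b\<in>carrier A. (\<forall>h\<in>carrier H. \<pi> a h = \<pi> b h) \<longrightarrow> a = b)"

subsection \<open>Spectral triples\<close>

definition commutator_domain :: "'h set \<Rightarrow> ('h \<Rightarrow> 'h) \<Rightarrow> 'h set" where
  "commutator_domain Dom T = {h \<in> Dom. T h \<in> Dom}"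

definition commutator_extends_bounded ::
  "('h, 'm) hilb_scheme \<Rightarrow> 'h set \<Rightarrow> ('h \<Rightarrow> 'h) \<Rightarrow> ('h \<Rightarrow> 'h) \<Rightarrow> bool" where
  "commutator_extends_bounded H Dom D T \<longleftrightarrow> dense_in H (commutator_domain Dom T) \<and>
     (\<exists>B\<in>bounded_operators H. \<forall>h\<in>commutator_domain Dom T. B h = D (T h) \<ominus>\<^bsub>H\<^esub> T (D h))"

text \<open>The operator \<open>D\<close> has domain \<open>Dom\<close>. A finite-dimensional Hilbert space carries no unbounded
  operator, so unboundedness is required only in infinite dimension.\<close>

definition spectral_triple ::
  "('a, 'm) cstar_scheme \<Rightarrow> ('h, 'n) hilb_scheme \<Rightarrow> ('a \<Rightarrow> 'h \<Rightarrow> 'h) \<Rightarrow> 'h set \<Rightarrow> ('h \<Rightarrow> 'h) \<Rightarrow> bool"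
where
  "spectral_triple A H \<pi> Dom D \<longleftrightarrow>
     unital_cstar_algebra A \<and>
     hilbert_space H \<and> separable_space (hilbert_topology H) \<and>
     faithful_star_representation A H \<pi> \<and>
     essentially_self_adjoint H Dom D \<and>
     (\<not> finite_dimensional H \<longrightarrow> \<not> bounded_on H Dom D) \<and>
     has_compact_resolvent H Dom D \<and>
     Metric_space.mtopology (carrier A) (adist A) closure_of
       {a \<in> carrier A. commutator_extends_bounded H Dom D (\<pi> a)} = carrier A"

section \<open>The C*-algebra \<open>C(Y)\<close> and the Hilbert space \<open>L\<^sup>2\<close>\<close>

text \<open>For compact nonempty \<open>Y\<close>; functions are \<open>undefined\<close> off \<open>topspace Y\<close>, so that
  equality of elements is equality on \<open>Y\<close>.\<close>

definition continuous_functions :: "'x topology \<Rightarrow> ('x \<Rightarrow> complex) cstar" where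
  "continuous_functions Y = \<lparr>
     carrier = {f \<in> extensional (topspace Y). continuous_map Y euclidean f},
     monoid.mult = (\<lambda>f g. \<lambda>x\<in>topspace Y. f x * g x),
     one = (\<lambda>x\<in>topspace Y. 1),
     zero = (\<lambda>x\<in>topspace Y. 0),
     add = (\<lambda>f g. \<lambda>x\<in>topspace Y. f x + g x),
     module.smult = (\<lambda>c f. \<lambda>x\<in>topspace Y. c * f x),
     star = (\<lambda>f. \<lambda>x\<in>topspace Y. cnj (f x)),
     anorm = (\<lambda>f. SUP x\<in>topspace Y. cmod (f x))\<rparr>"

definition L2_functions :: "'x measure \<Rightarrow> ('x \<Rightarrow> complex) set" where
  "L2_functions M = {f \<in> borel_measurable M. integrable M (\<lambda>x. (cmod (f x))\<^sup>2)}"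

definition ae_eq_rel :: "'x measure \<Rightarrow> (('x \<Rightarrow> complex) \<times> ('x \<Rightarrow> complex)) set" where
  "ae_eq_rel M = {(f, g). f \<in> L2_functions M \<and> g \<in> L2_functions M \<and> (AE x in M. f x = g x)}"

definition L2_class :: "'x measure \<Rightarrow> ('x \<Rightarrow> complex) \<Rightarrow> ('x \<Rightarrow> complex) set" where
  "L2_class M f = ae_eq_rel M `` {f}"

definition L2_rep :: "('x \<Rightarrow> complex) set \<Rightarrow> 'x \<Rightarrow> complex" where
  "L2_rep F = (SOME f. f \<in> F)"

definition L2 :: "'x measure \<Rightarrow> ('x \<Rightarrow> complex) set hilb" where
  "L2 M = \<lparr>
     carrier = L2_functions M // ae_eq_rel M,
     monoid.mult = undefined,
     one = undefined,
     zero = L2_class M (\<lambda>_. 0),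
     add = (\<lambda>F G. L2_class M (\<lambda>x. L2_rep F x + L2_rep G x)),
     module.smult = (\<lambda>c F. L2_class M (\<lambda>x. c * L2_rep F x)),
     hinner = (\<lambda>F G. \<integral>x. L2_rep F x * cnj (L2_rep G x) \<partial>M)\<rparr>"

definition multiplication_rep ::
  "'x measure \<Rightarrow> ('x \<Rightarrow> complex) \<Rightarrow> ('x \<Rightarrow> complex) set \<Rightarrow> ('x \<Rightarrow> complex) set" where
  "multiplication_rep M a F = L2_class M (\<lambda>x. a x * L2_rep F x)"

section \<open>Subshifts of finite type and Gibbs measures\<close>

text \<open>The alphabet is \<open>{1..l}\<close> with \<open>l = dim_row A\<close>, whereas matrix indices start at 0. A
  sequence \<open>(\<omega>\<^sub>1, \<omega>\<^sub>2, \<dots>)\<close> is a function on \<open>nat\<close> with \<open>\<omega> i\<close> in the place of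
  \<open>\<omega>\<^sub>i\<^sub>+\<^sub>1\<close>, and a word is a list.\<close>

definition alphabet :: "nat mat \<Rightarrow> nat set" where
  "alphabet A = {1..dim_row A}"

definition entry :: "nat mat \<Rightarrow> nat \<Rightarrow> nat \<Rightarrow> nat" where
  "entry A j k = A $$ (j - 1, k - 1)"

definition irreducible_mat :: "nat mat \<Rightarrow> bool" where
  "irreducible_mat A \<longleftrightarrow> (\<forall>i\<in>alphabet A. \<forall>j\<in>alphabet A. \<exists>n\<ge>1. entry (A ^\<^sub>m n) i j > 0)"

definition aperiodic_mat :: "nat mat \<Rightarrow> bool" where
  "aperiodic_mat A \<longleftrightarrow> (\<forall>i\<in>alphabet A. Gcd {n. 1 \<le> n \<and> entry (A ^\<^sub>m n) i i > 0} = 1)"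

definition subshift :: "nat mat \<Rightarrow> (nat \<Rightarrow> nat) set" where
  "subshift A = {\<omega>. (\<forall>k. \<omega> k \<in> alphabet A) \<and> (\<forall>k. entry A (\<omega> k) (\<omega> (Suc k)) = 1)}"

definition words_of_length :: "nat mat \<Rightarrow> nat \<Rightarrow> nat list set" where
  "words_of_length A k = {x. length x = k \<and> set x \<subseteq> alphabet A \<and>
     (\<forall>i. Suc i < k \<longrightarrow> entry A (x ! i) (x ! Suc i) = 1)}"

definition admissible_words :: "nat mat \<Rightarrow> nat list set" where
  "admissible_words A = (\<Union>k\<in>{1..}. words_of_length A k)"

definition cylinder :: "nat mat \<Rightarrow> nat list \<Rightarrow> (nat \<Rightarrow> nat) set" where
  "cylinder A x = {\<omega> \<in> subshift A. map \<omega> [0..<length x] = x}"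

definition subshift_topology :: "nat mat \<Rightarrow> (nat \<Rightarrow> nat) topology" where
  "subshift_topology A = topology_generated_by (cylinder A ` admissible_words A)"

definition subshift_borel :: "nat mat \<Rightarrow> (nat \<Rightarrow> nat) measure" where
  "subshift_borel A = sigma (subshift A) {V. openin (subshift_topology A) V}"

text \<open>For \<open>\<omega> \<noteq> \<upsilon>\<close> the least \<open>n\<close> with \<open>\<omega> n \<noteq> \<upsilon> n\<close> is the length of the longest common
  initial word.\<close>

definition subshift_dist :: "(nat \<Rightarrow> nat) \<Rightarrow> (nat \<Rightarrow> nat) \<Rightarrow> real" where
  "subshift_dist \<omega> \<upsilon> = (if \<omega> = \<upsilon> then 0 else (1 / 2) ^ (LEAST n. \<omega> n \<noteq> \<upsilon> n))"

definition hoelder_continuous :: "nat mat \<Rightarrow> ((nat \<Rightarrow> nat) \<Rightarrow> real) \<Rightarrow> bool" where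
  "hoelder_continuous A \<phi> \<longleftrightarrow> (\<exists>C \<beta>. 0 < \<beta> \<and>
     (\<forall>\<omega>\<in>subshift A. \<forall>\<upsilon>\<in>subshift A. \<bar>\<phi> \<omega> - \<phi> \<upsilon>\<bar> \<le> C * subshift_dist \<omega> \<upsilon> powr \<beta>))"

definition left_shift :: "(nat \<Rightarrow> nat) \<Rightarrow> nat \<Rightarrow> nat" where
  "left_shift \<omega> = (\<lambda>n. \<omega> (Suc n))"

definition birkhoff_sum :: "((nat \<Rightarrow> nat) \<Rightarrow> real) \<Rightarrow> nat \<Rightarrow> (nat \<Rightarrow> nat) \<Rightarrow> real" where
  "birkhoff_sum \<phi> k \<omega> = (\<Sum>m<k. \<phi> ((left_shift ^^ m) \<omega>))"

definition borel_probability :: "nat mat \<Rightarrow> (nat \<Rightarrow> nat) measure \<Rightarrow> bool" where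
  "borel_probability A \<mu> \<longleftrightarrow> prob_space \<mu> \<and> sets \<mu> = sets (subshift_borel A)"

definition shift_invariant :: "nat mat \<Rightarrow> (nat \<Rightarrow> nat) measure \<Rightarrow> bool" where
  "shift_invariant A \<mu> \<longleftrightarrow> (\<forall>E\<in>sets \<mu>. measure \<mu> (left_shift -` E \<inter> subshift A) = measure \<mu> E)"

text \<open>\<open>ln 0 = 0\<close> implements the convention \<open>0 ln 0 = 0\<close>.\<close>

definition measure_entropy :: "nat mat \<Rightarrow> (nat \<Rightarrow> nat) measure \<Rightarrow> real" where
  "measure_entropy A \<mu> = lim (\<lambda>k. 1 / real k *
     (\<Sum>x\<in>words_of_length A k. - measure \<mu> (cylinder A x) * ln (measure \<mu> (cylinder A x))))"

definition pressure :: "nat mat \<Rightarrow> ((nat \<Rightarrow> nat) \<Rightarrow> real) \<Rightarrow> real" where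
  "pressure A \<phi> = Sup {measure_entropy A \<mu> + (\<integral>\<omega>. \<phi> \<omega> \<partial>\<mu>) | \<mu>.
     borel_probability A \<mu> \<and> shift_invariant A \<mu>}"

definition gibbs_measure ::
  "nat mat \<Rightarrow> ((nat \<Rightarrow> nat) \<Rightarrow> real) \<Rightarrow> (nat \<Rightarrow> nat) measure \<Rightarrow> bool" where
  "gibbs_measure A \<phi> \<mu> \<longleftrightarrow> borel_probability A \<mu> \<and>
     (\<exists>c>1. \<forall>k\<ge>1. \<forall>\<omega>\<in>subshift A.
        1 / c \<le> measure \<mu> (cylinder A (map \<omega> [0..<k]))
                / exp (birkhoff_sum \<phi> k \<omega> - real k * pressure A \<phi>) \<and>
        measure \<mu> (cylinder A (map \<omega> [0..<k]))
                / exp (birkhoff_sum \<phi> k \<omega> - real k * pressure A \<phi>) \<le> c)"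

section \<open>Haar bases and the Dirac operator\<close>

definition alpha :: "nat mat \<Rightarrow> nat list \<Rightarrow> nat" where
  "alpha A x = (\<Sum>i\<in>alphabet A. entry A (last x) i)"

definition successors :: "nat mat \<Rightarrow> nat list \<Rightarrow> nat set" where
  "successors A x = {y \<in> alphabet A. entry A (last x) y = 1}"

definition child :: "nat mat \<Rightarrow> (nat list \<Rightarrow> nat \<Rightarrow> nat) \<Rightarrow> nat list \<Rightarrow> nat \<Rightarrow> nat list" where
  "child A \<theta> x j = x @ [inv_into (successors A x) (\<theta> x) j]"

definition child_mass ::
  "nat mat \<Rightarrow> (nat \<Rightarrow> nat) measure \<Rightarrow> (nat list \<Rightarrow> nat \<Rightarrow> nat) \<Rightarrow> nat list \<Rightarrow> nat \<Rightarrow> real" where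
  "child_mass A \<mu> \<theta> x j = measure \<mu> (cylinder A (child A \<theta> x j))"

text \<open>The space of real column vectors of dimension \<open>alpha A x\<close> has the coordinates
  \<open>1, \<dots>, alpha A x\<close> in the text and \<open>0, \<dots>, alpha A x - 1\<close> in the type \<open>vec\<close>.\<close>

definition inner_at :: "nat mat \<Rightarrow> (nat \<Rightarrow> nat) measure \<Rightarrow> (nat list \<Rightarrow> nat \<Rightarrow> nat) \<Rightarrow> nat list
    \<Rightarrow> real Matrix.vec \<Rightarrow> real Matrix.vec \<Rightarrow> real" where
  "inner_at A \<mu> \<theta> x r s =
     (\<Sum>j\<in>{1..alpha A x}. child_mass A \<mu> \<theta> x j * vec_index r (j - 1) * vec_index s (j - 1))"

definition frame_vec :: "nat mat \<Rightarrow> (nat \<Rightarrow> nat) measure \<Rightarrow> (nat list \<Rightarrow> nat \<Rightarrow> nat) \<Rightarrow> nat list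
    \<Rightarrow> nat \<Rightarrow> real Matrix.vec" where
  "frame_vec A \<mu> \<theta> x j = child_mass A \<mu> \<theta> x j powr (- 1 / 2) \<cdot>\<^sub>v unit_vec (alpha A x) (j - 1)"

text \<open>Linear maps are given by their matrices with respect to the standard basis. The determinant
  does not depend on the basis.\<close>

definition Omega :: "nat mat \<Rightarrow> (nat \<Rightarrow> nat) measure \<Rightarrow> (nat list \<Rightarrow> nat \<Rightarrow> nat) \<Rightarrow> nat list
    \<Rightarrow> real mat set" where
  "Omega A \<mu> \<theta> x = {M \<in> carrier_mat (alpha A x) (alpha A x).
     0 < Determinant.det M \<and>
     (\<forall>r\<in>carrier_vec (alpha A x). \<forall>s\<in>carrier_vec (alpha A x).
        inner_at A \<mu> \<theta> x (M *\<^sub>v r) (M *\<^sub>v s) = inner_at A \<mu> \<theta> x r s) \<and>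
     M *\<^sub>v frame_vec A \<mu> \<theta> x (alpha A x) =
       measure \<mu> (cylinder A x) powr (- 1 / 2) \<cdot>\<^sub>v Matrix.vec (alpha A x) (\<lambda>_. 1)}"

definition haar_choice :: "nat mat \<Rightarrow> (nat \<Rightarrow> nat) measure \<Rightarrow> (nat list \<Rightarrow> nat \<Rightarrow> nat)
    \<Rightarrow> (nat list \<Rightarrow> real mat) \<Rightarrow> bool" where
  "haar_choice A \<mu> \<theta> U \<longleftrightarrow> (\<forall>x\<in>admissible_words A.
     bij_betw (\<theta> x) (successors A x) {1..alpha A x} \<and> U x \<in> Omega A \<mu> \<theta> x)"

definition haar_function :: "nat mat \<Rightarrow> (nat \<Rightarrow> nat) measure \<Rightarrow> (nat list \<Rightarrow> nat \<Rightarrow> nat)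
    \<Rightarrow> (nat list \<Rightarrow> real mat) \<Rightarrow> nat list \<Rightarrow> nat \<Rightarrow> (nat \<Rightarrow> nat) \<Rightarrow> complex" where
  "haar_function A \<mu> \<theta> U x j = (\<lambda>\<omega>. complex_of_real (\<Sum>k\<in>{1..alpha A x}.
     child_mass A \<mu> \<theta> x k powr (- 1 / 2)
       * inner_at A \<mu> \<theta> x (frame_vec A \<mu> \<theta> x k) (U x *\<^sub>v frame_vec A \<mu> \<theta> x j)
       * indicator (cylinder A (child A \<theta> x k)) \<omega>))"

definition haar_vec :: "nat mat \<Rightarrow> (nat \<Rightarrow> nat) measure \<Rightarrow> (nat list \<Rightarrow> nat \<Rightarrow> nat)
    \<Rightarrow> (nat list \<Rightarrow> real mat) \<Rightarrow> nat list \<Rightarrow> nat \<Rightarrow> ((nat \<Rightarrow> nat) \<Rightarrow> complex) set" where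
  "haar_vec A \<mu> \<theta> U x j = L2_class \<mu> (haar_function A \<mu> \<theta> U x j)"

definition indicator_vec :: "(nat \<Rightarrow> nat) measure \<Rightarrow> (nat \<Rightarrow> nat) set
    \<Rightarrow> ((nat \<Rightarrow> nat) \<Rightarrow> complex) set" where
  "indicator_vec \<mu> E = L2_class \<mu> (indicator E)"

definition haar_basis :: "nat mat \<Rightarrow> (nat \<Rightarrow> nat) measure \<Rightarrow> (nat list \<Rightarrow> nat \<Rightarrow> nat)
    \<Rightarrow> (nat list \<Rightarrow> real mat) \<Rightarrow> ((nat \<Rightarrow> nat) \<Rightarrow> complex) set set" where
  "haar_basis A \<mu> \<theta> U =
     {haar_vec A \<mu> \<theta> U x j | x j. x \<in> admissible_words A \<and> j \<in> {1..alpha A x - 1}} \<union>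
     {complex_of_real (measure \<mu> (cylinder A [x]) powr (- 1 / 2))
        \<odot>\<^bsub>L2 \<mu>\<^esub> indicator_vec \<mu> (cylinder A [x]) | x. x \<in> alphabet A}"

definition dirac_term :: "nat mat \<Rightarrow> (nat \<Rightarrow> nat) measure \<Rightarrow> (nat list \<Rightarrow> nat \<Rightarrow> nat)
    \<Rightarrow> (nat list \<Rightarrow> real mat) \<Rightarrow> ((nat \<Rightarrow> nat) \<Rightarrow> complex) set \<Rightarrow> nat list
    \<Rightarrow> ((nat \<Rightarrow> nat) \<Rightarrow> complex) set" where
  "dirac_term A \<mu> \<theta> U h y =
     complex_of_real ((real (alpha A y) - 1) / measure \<mu> (cylinder A y)) \<odot>\<^bsub>L2 \<mu>\<^esub>
       (\<Oplus>\<^bsub>L2 \<mu>\<^esub> k\<in>{1..alpha A y - 1}.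
          hinner (L2 \<mu>) h (haar_vec A \<mu> \<theta> U y k) \<odot>\<^bsub>L2 \<mu>\<^esub> haar_vec A \<mu> \<theta> U y k)"

definition dirac :: "nat mat \<Rightarrow> (nat \<Rightarrow> nat) measure \<Rightarrow> (nat list \<Rightarrow> nat \<Rightarrow> nat)
    \<Rightarrow> (nat list \<Rightarrow> real mat) \<Rightarrow> ((nat \<Rightarrow> nat) \<Rightarrow> complex) set
    \<Rightarrow> ((nat \<Rightarrow> nat) \<Rightarrow> complex) set" where
  "dirac A \<mu> \<theta> U h =
     (\<Oplus>\<^bsub>L2 \<mu>\<^esub> x\<in>alphabet A.
        (complex_of_real (1 / measure \<mu> (cylinder A [x]))
           * hinner (L2 \<mu>) h (indicator_vec \<mu> (cylinder A [x])))
          \<odot>\<^bsub>L2 \<mu>\<^esub> indicator_vec \<mu> (cylinder A [x]))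
     \<ominus>\<^bsub>L2 \<mu>\<^esub> hinner (L2 \<mu>) h (indicator_vec \<mu> (subshift A))
          \<odot>\<^bsub>L2 \<mu>\<^esub> indicator_vec \<mu> (subshift A)
     \<oplus>\<^bsub>L2 \<mu>\<^esub> (THE s. hilbert_has_sum (L2 \<mu>) (dirac_term A \<mu> \<theta> U h) (admissible_words A) s)"

text \<open>The mathematical definition leaves the domain open: it is any linear subspace that contains
  the span of the Haar basis and on which the series defining the operator converges. It is
  automatically dense.\<close>

definition dirac_domain :: "nat mat \<Rightarrow> (nat \<Rightarrow> nat) measure \<Rightarrow> (nat list \<Rightarrow> nat \<Rightarrow> nat)
    \<Rightarrow> (nat list \<Rightarrow> real mat) \<Rightarrow> ((nat \<Rightarrow> nat) \<Rightarrow> complex) set set \<Rightarrow> bool" where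
  "dirac_domain A \<mu> \<theta> U Dom \<longleftrightarrow>
     linear_subspace (L2 \<mu>) Dom \<and>
     linear_span (L2 \<mu>) (haar_basis A \<mu> \<theta> U) \<subseteq> Dom \<and>
     (\<forall>h\<in>Dom. \<exists>s. hilbert_has_sum (L2 \<mu>) (dirac_term A \<mu> \<theta> U h) (admissible_words A) s)"

end

theory Submission
  imports Defs
begin

text \<open>The Haar functions, completed at the root of the word tree by an orthonormal basis of the
  functions of the first letter that contains the constant function, diagonalise the Dirac operator.
  In coordinates the Hilbert space is \<open>l\<^sup>2\<close>, and essential self-adjointness follows whatever the
  domain is, as long as it contains the basis. A Gibbs measure gives every child of a word at least
  a fixed fraction of the mass of the word. Hence only finitely many branching words have mass at
  least a given \<open>\<epsilon>\<close>, the eigenvalues tend to infinity, and the resolvents are compact. A locally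
  constant function that depends on the first \<open>n\<close> letters is constant on the support of each Haar
  function of a word of length at least \<open>n\<close>. Its commutator with the Dirac operator therefore has
  finite rank, and the locally constant functions are dense in the continuous ones.\<close>

section \<open>Hilbert spaces\<close>

text \<open>The domain of the Dirac operator is only bracketed: it contains the span of the basis,
  and the series converges on it. The closure of the operator on finite combinations is already the
  maximal operator of multiplication by the eigenvalues, so every domain in between has this
  closure.

  The sum over letters minus the rank-one term is the projection onto the functions of the first
  letter that are orthogonal to the constants. The letter indicators in the given basis do not
  diagonalise it in general, which is why they are replaced at the root; the eigenvalues there are 0
  and 1.

  A word with a single successor carries no Haar function and passes its full mass on, as when
  \<open>l = 1\<close> and the space is one point. Finiteness is therefore obtained by counting
  branching words, not from a rate of decay in the length.

  The commutator with \<open>T\<close> lives on the awkward domain of those \<open>h\<close> for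
  which \<open>h\<close> and \<open>T h\<close> lie in the domain. Pairing with a basis vector moves
  both operators onto that vector and describes the commutator on all of this domain at once,
  without approximating \<open>h\<close>.\<close>

lemma complex_ring_simps [simp]:
  "carrier complex_ring = UNIV" "x \<otimes>\<^bsub>complex_ring\<^esub> y = x * y" "\<one>\<^bsub>complex_ring\<^esub> = 1"
  "\<zero>\<^bsub>complex_ring\<^esub> = 0" "x \<oplus>\<^bsub>complex_ring\<^esub> y = x + y"
  by (simp_all add: ring_of_type_algebra_def)

lemma complex_ring_minus [simp]: "\<ominus>\<^bsub>complex_ring\<^esub> x = - x"
proof -
  interpret cring complex_ring by (rule cring_from_type_algebra)
  show ?thesis
    by (rule sum_zero_eq_neg[symmetric]) auto
qed

text \<open>Products of two balls of equal radius form a neighbourhood base of the product topology,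
  so closure points of an operator graph can be tested with one radius for both components.\<close>

lemma (in Metric_space) prod_closure_of_iff:
  "(x, w) \<in> prod_topology mtopology mtopology closure_of G \<longleftrightarrow> x \<in> M \<and> w \<in> M \<and>
     (\<forall>r>0. \<exists>(u, v)\<in>G. u \<in> M \<and> v \<in> M \<and> d x u < r \<and> d w v < r)"
  (is "?l \<longleftrightarrow> ?r")
proof -
  show ?thesis
  proof
    assume l: ?l
    have xw: "x \<in> M" "w \<in> M"
      using l by (auto simp: in_closure_of)
    have "\<exists>(u, v)\<in>G. u \<in> M \<and> v \<in> M \<and> d x u < r \<and> d w v < r" if "r > 0" for r
    proof -
      have "openin (prod_topology mtopology mtopology) (mball x r \<times> mball w r)"
        by (simp add: openin_prod_Times_iff)
      moreover have "(x, w) \<in> mball x r \<times> mball w r"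
        using xw that by simp
      moreover have "\<And>T. (x, w) \<in> T \<and> openin (prod_topology mtopology mtopology) T \<Longrightarrow> \<exists>y. y \<in> G \<and> y \<in> T"
        using l by (simp add: in_closure_of)
      ultimately obtain y where "y \<in> G" "y \<in> mball x r \<times> mball w r"
        by meson
      then show ?thesis by (cases y) (auto intro!: bexI[of _ y])
    qed
    with xw show ?r by simp
  next
    assume r: ?r
    have "\<exists>y. y \<in> G \<and> y \<in> W"
      if W: "(x, w) \<in> W" "openin (prod_topology mtopology mtopology) W" for W
    proof -
      obtain U V where UV: "openin mtopology U" "openin mtopology V" "x \<in> U" "w \<in> V" "U \<times> V \<subseteq> W"
        using W unfolding openin_prod_topology_alt by meson
      obtain r1 where r1: "r1 > 0" "mball x r1 \<subseteq> U"
        using UV unfolding openin_mtopology by meson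
      obtain r2 where r2: "r2 > 0" "mball w r2 \<subseteq> V"
        using UV unfolding openin_mtopology by meson
      have "min r1 r2 > 0" using r1 r2 by simp
      then obtain u v where uv: "(u, v) \<in> G" "u \<in> M" "v \<in> M"
          "d x u < min r1 r2" "d w v < min r1 r2"
        using r by blast
      then have "u \<in> mball x r1" "v \<in> mball w r2" using r by simp_all
      then show ?thesis using uv(1) UV(5) r1(2) r2(2) by blast
    qed
    then show ?l using r
      by (auto simp: in_closure_of)
  qed
qed

text \<open>A labelling with finitely many values and fibres of small diameter replaces an explicit
  net: one point per fibre serves as a centre. For compact operators the labels are rounded
  coordinates.\<close>

lemma (in Metric_space) mtotally_boundedI:
  assumes S: "S \<subseteq> M"
    and g: "\<And>\<epsilon>. \<epsilon> > 0 \<Longrightarrow> \<exists>g :: 'a \<Rightarrow> 'k. finite (g ` S) \<and> (\<forall>s\<in>S. \<forall>t\<in>S. g s = g t \<longrightarrow> d s t < \<epsilon>)"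
  shows "mtotally_bounded S"
proof -
  show ?thesis
    unfolding mtotally_bounded_def
  proof (intro allI impI)
    fix \<epsilon> :: real assume "\<epsilon> > 0"
    then obtain g :: "'a \<Rightarrow> 'k" where g: "finite (g ` S)" "\<forall>s\<in>S. \<forall>t\<in>S. g s = g t \<longrightarrow> d s t < \<epsilon>"
      using g by meson
    let ?K = "inv_into S g ` (g ` S)"
    have K: "?K \<subseteq> S" by (auto intro: inv_into_into)
    have "s \<in> (\<Union>x\<in>?K. mball x \<epsilon>)" if s: "s \<in> S" for s
    proof -
      have t: "inv_into S g (g s) \<in> S" "g (inv_into S g (g s)) = g s"
        using s by (auto intro: inv_into_into f_inv_into_f)
      then have "d (inv_into S g (g s)) s < \<epsilon>" using g s by metis
      then have "s \<in> mball (inv_into S g (g s)) \<epsilon>" using S s t by auto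
      then show ?thesis using s by blast
    qed
    then have "S \<subseteq> (\<Union>x\<in>?K. mball x \<epsilon>)" by (rule subsetI)
    with K g show "\<exists>K. finite K \<and> K \<subseteq> S \<and> S \<subseteq> (\<Union>x\<in>K. mball x \<epsilon>)"
      by (meson finite_imageI)
  qed
qed

text \<open>The axioms of \<open>hilbert_space\<close> without completeness. Completeness of
  \<open>L2\<close> can only be proved once its distance is known to be a metric, which already
  follows from these axioms.\<close>

locale inner_product_module = module complex_ring H for H :: "('h, 'm) hilb_scheme" (structure) +
  assumes hinner_add: "\<lbrakk>x \<in> carrier H; y \<in> carrier H; z \<in> carrier H\<rbrakk>
      \<Longrightarrow> hinner H (x \<oplus> y) z = hinner H x z + hinner H y z"
    and hinner_smult: "\<lbrakk>x \<in> carrier H; y \<in> carrier H\<rbrakk>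
      \<Longrightarrow> hinner H (c \<odot> x) y = c * hinner H x y"
    and hinner_cnj: "\<lbrakk>x \<in> carrier H; y \<in> carrier H\<rbrakk> \<Longrightarrow> hinner H y x = cnj (hinner H x y)"
    and hinner_nonneg: "x \<in> carrier H \<Longrightarrow> 0 \<le> Re (hinner H x x)"
    and hinner_definite: "\<lbrakk>x \<in> carrier H; hinner H x x = 0\<rbrakk> \<Longrightarrow> x = \<zero>"
begin

lemma smult_carrier [simp, intro]: "x \<in> carrier H \<Longrightarrow> c \<odot> x \<in> carrier H"
  by simp

lemma minus_carrier [simp, intro]: "x \<in> carrier H \<Longrightarrow> y \<in> carrier H \<Longrightarrow> x \<ominus> y \<in> carrier H"
  by simp

lemma finsum_carrier [intro]: "(\<And>i. i \<in> F \<Longrightarrow> f i \<in> carrier H) \<Longrightarrow> finsum H f F \<in> carrier H"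
  by (rule M.finsum_closed) auto

lemma hinner_add_right:
  "\<lbrakk>x \<in> carrier H; y \<in> carrier H; z \<in> carrier H\<rbrakk> \<Longrightarrow> hinner H z (x \<oplus> y) = hinner H z x + hinner H z y"
  by (metis M.add.m_closed complex_cnj_add hinner_add hinner_cnj)

lemma hinner_smult_right:
  "\<lbrakk>x \<in> carrier H; y \<in> carrier H\<rbrakk> \<Longrightarrow> hinner H x (c \<odot> y) = cnj c * hinner H x y"
  by (metis complex_cnj_mult hinner_cnj hinner_smult smult_carrier)

lemma hinner_zero_left [simp]: "x \<in> carrier H \<Longrightarrow> hinner H \<zero> x = 0"
  using hinner_smult[of \<zero> x 0] by simp

lemma hinner_zero_right [simp]: "x \<in> carrier H \<Longrightarrow> hinner H x \<zero> = 0"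
  by (metis M.zero_closed complex_cnj_zero hinner_cnj hinner_zero_left)

lemma uminus_smult: "x \<in> carrier H \<Longrightarrow> \<ominus> x = (- 1) \<odot> x"
  using smult_l_minus[of 1 x] smult_one[of x] by simp

lemma hinner_uminus: "\<lbrakk>x \<in> carrier H; y \<in> carrier H\<rbrakk> \<Longrightarrow> hinner H (\<ominus> x) y = - hinner H x y"
  by (simp add: uminus_smult hinner_smult)

lemma hinner_uminus_right: "\<lbrakk>x \<in> carrier H; y \<in> carrier H\<rbrakk> \<Longrightarrow> hinner H x (\<ominus> y) = - hinner H x y"
  by (simp add: uminus_smult hinner_smult_right)

lemma hinner_diff:
  "\<lbrakk>x \<in> carrier H; y \<in> carrier H; z \<in> carrier H\<rbrakk> \<Longrightarrow> hinner H (x \<ominus> y) z = hinner H x z - hinner H y z"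
  by (simp add: a_minus_def hinner_add hinner_uminus)

lemma hinner_diff_right:
  "\<lbrakk>x \<in> carrier H; y \<in> carrier H; z \<in> carrier H\<rbrakk> \<Longrightarrow> hinner H z (x \<ominus> y) = hinner H z x - hinner H z y"
  by (simp add: a_minus_def hinner_add_right hinner_uminus_right)

lemma hinner_finsum:
  assumes "\<And>i. i \<in> F \<Longrightarrow> f i \<in> carrier H" "y \<in> carrier H"
  shows "hinner H (finsum H f F) y = (\<Sum>i\<in>F. hinner H (f i) y)"
proof (cases "finite F")
  case True
  then show ?thesis using assms
  proof (induction F rule: finite_induct)
    case (insert a F)
    have "finsum H f (insert a F) = f a \<oplus> finsum H f F"
      using insert by (intro M.finsum_insert) auto
    then show ?case using insert by (simp add: hinner_add finsum_carrier)
  qed simp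
next
  case False
  then show ?thesis using assms by (simp add: M.finsum_infinite)
qed

lemma hinner_finsum_right:
  assumes "\<And>i. i \<in> F \<Longrightarrow> f i \<in> carrier H" "y \<in> carrier H"
  shows "hinner H y (finsum H f F) = (\<Sum>i\<in>F. hinner H y (f i))"
proof -
  have "hinner H y (finsum H f F) = cnj (hinner H (finsum H f F) y)"
    using assms by (intro hinner_cnj finsum_carrier) auto
  also have "\<dots> = (\<Sum>i\<in>F. cnj (hinner H (f i) y))"
    using assms by (simp add: hinner_finsum)
  also have "\<dots> = (\<Sum>i\<in>F. hinner H y (f i))"
    using assms by (intro sum.cong refl) (metis hinner_cnj)
  finally show ?thesis .
qed

section \<open>The norm and the Cauchy-Schwarz inequality\<close>

lemma hinner_self: "x \<in> carrier H \<Longrightarrow> hinner H x x = complex_of_real ((hnorm H x)\<^sup>2)"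
proof -
  assume x: "x \<in> carrier H"
  have "Im (hinner H x x) = 0"
    using arg_cong[OF hinner_cnj[OF x x], of Im] by simp
  then show ?thesis
    using hinner_nonneg[OF x] by (simp add: hnorm_def complex_eq_iff)
qed

lemma hnorm_nonneg [simp]: "x \<in> carrier H \<Longrightarrow> 0 \<le> hnorm H x"
  by (simp add: hnorm_def hinner_nonneg)

lemma hnorm_sq: "x \<in> carrier H \<Longrightarrow> (hnorm H x)\<^sup>2 = Re (hinner H x x)"
  by (simp add: hnorm_def hinner_nonneg)

lemma hnorm_eq_0 [simp]: "x \<in> carrier H \<Longrightarrow> hnorm H x = 0 \<longleftrightarrow> x = \<zero>"
  using hinner_self[of x] hinner_definite[of x] by (auto simp: hnorm_def)

lemma hnorm_smult: "x \<in> carrier H \<Longrightarrow> hnorm H (c \<odot> x) = cmod c * hnorm H x"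
proof (rule power2_eq_imp_eq)
  assume x: "x \<in> carrier H"
  have "complex_of_real ((hnorm H (c \<odot> x))\<^sup>2) = c * cnj c * hinner H x x"
    using x by (subst hinner_self[symmetric]) (auto simp: hinner_smult hinner_smult_right)
  also have "\<dots> = complex_of_real ((cmod c * hnorm H x)\<^sup>2)"
    using x by (simp add: hinner_self complex_norm_square[symmetric] power_mult_distrib)
  finally show "(hnorm H (c \<odot> x))\<^sup>2 = (cmod c * hnorm H x)\<^sup>2"
    using of_real_eq_iff by blast
qed auto

lemma hnorm_add_sq:
  assumes "x \<in> carrier H" "y \<in> carrier H"
  shows "(hnorm H (x \<oplus> y))\<^sup>2 = (hnorm H x)\<^sup>2 + (hnorm H y)\<^sup>2 + 2 * Re (hinner H x y)"
  using assms hinner_cnj[of x y]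
  by (simp add: hnorm_sq hinner_add hinner_add_right)

lemma hnorm_diff_sq:
  assumes "x \<in> carrier H" "y \<in> carrier H"
  shows "(hnorm H (x \<ominus> y))\<^sup>2 = (hnorm H x)\<^sup>2 + (hnorm H y)\<^sup>2 - 2 * Re (hinner H x y)"
  using assms hinner_cnj[of x y]
  by (simp add: hnorm_sq hinner_diff hinner_diff_right)

lemma Cauchy_Schwarz:
  assumes x: "x \<in> carrier H" and y: "y \<in> carrier H"
  shows "cmod (hinner H x y) \<le> hnorm H x * hnorm H y"
proof (cases "y = \<zero>")
  case True
  then show ?thesis using x by simp
next
  case False
  then have ny: "hnorm H y > 0" using y hnorm_nonneg[OF y] hnorm_eq_0[OF y] by linarith
  \<comment> \<open>\<open>c \<odot> y\<close> is the orthogonal projection of \<open>x\<close> on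
    the line of \<open>y\<close>; the inequality is the nonnegativity of the squared length of the
    residual.\<close>
  define c where "c = hinner H x y / complex_of_real ((hnorm H y)\<^sup>2)"
  have "0 \<le> (hnorm H (x \<ominus> c \<odot> y))\<^sup>2" by simp
  also have "\<dots> = (hnorm H x)\<^sup>2 + (cmod c)\<^sup>2 * (hnorm H y)\<^sup>2 - 2 * Re (cnj c * hinner H x y)"
    using x y by (simp add: hnorm_diff_sq hnorm_smult hinner_smult_right power_mult_distrib)
  also have "cnj c * hinner H x y = complex_of_real ((cmod (hinner H x y))\<^sup>2 / (hnorm H y)\<^sup>2)"
    by (simp add: c_def complex_norm_square mult.commute del: of_real_power)
  also have "(cmod c)\<^sup>2 * (hnorm H y)\<^sup>2 = (cmod (hinner H x y))\<^sup>2 / (hnorm H y)\<^sup>2"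
    using ny by (simp add: c_def norm_divide norm_power norm_mult power_divide power2_eq_square)
  finally have "(cmod (hinner H x y))\<^sup>2 / (hnorm H y)\<^sup>2 \<le> (hnorm H x)\<^sup>2" by simp
  then have "(cmod (hinner H x y))\<^sup>2 \<le> (hnorm H x * hnorm H y)\<^sup>2"
    using ny by (simp add: field_simps power_mult_distrib)
  then show ?thesis
    by (rule power2_le_imp_le) (use x y in simp)
qed

lemma hnorm_triangle:
  assumes x: "x \<in> carrier H" and y: "y \<in> carrier H"
  shows "hnorm H (x \<oplus> y) \<le> hnorm H x + hnorm H y"
proof (rule power2_le_imp_le)
  have "Re (hinner H x y) \<le> hnorm H x * hnorm H y"
    using Cauchy_Schwarz[OF x y] complex_Re_le_cmod order_trans by blast
  then show "(hnorm H (x \<oplus> y))\<^sup>2 \<le> (hnorm H x + hnorm H y)\<^sup>2"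
    using x y by (simp add: hnorm_add_sq power2_sum)
qed (use x y in auto)

lemma hnorm_uminus: "x \<in> carrier H \<Longrightarrow> hnorm H (\<ominus> x) = hnorm H x"
  by (simp add: uminus_smult hnorm_smult)

lemma hnorm_zero [simp]: "hnorm H \<zero> = 0"
  by simp

lemma hnorm_finsum_le:
  assumes "\<And>i. i \<in> F \<Longrightarrow> f i \<in> carrier H"
  shows "hnorm H (finsum H f F) \<le> (\<Sum>i\<in>F. hnorm H (f i))"
proof (cases "finite F")
  case True
  then show ?thesis using assms
  proof (induction F rule: finite_induct)
    case (insert a F)
    have "finsum H f (insert a F) = f a \<oplus> finsum H f F"
      using insert by (intro M.finsum_insert) auto
    then have "hnorm H (finsum H f (insert a F)) \<le> hnorm H (f a) + hnorm H (finsum H f F)"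
      using insert by (simp add: hnorm_triangle finsum_carrier)
    then show ?case using insert by fastforce
  qed simp
next
  case False
  then show ?thesis using assms by (simp add: M.finsum_infinite)
qed

lemma diff_eq_zero_iff:
  assumes "x \<in> carrier H" "y \<in> carrier H"
  shows "x \<ominus> y = \<zero> \<longleftrightarrow> x = y"
proof
  assume "x \<ominus> y = \<zero>"
  then have "\<ominus> (\<ominus> y) = x"
    using assms by (intro M.minus_equality) (auto simp: a_minus_def)
  then show "x = y" using assms by simp
next
  assume "x = y"
  then show "x \<ominus> y = \<zero>" using assms by (simp add: a_minus_def M.r_neg)
qed

text \<open>Definiteness applied to \<open>x \<ominus> y\<close>. It reduces vector identities such
  as \<open>x \<ominus> z = (x \<ominus> y) \<oplus> (y \<ominus> z)\<close> to identities between
  complex numbers.\<close>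

lemma hinner_eqI:
  assumes "x \<in> carrier H" "y \<in> carrier H" "\<And>z. z \<in> carrier H \<Longrightarrow> hinner H x z = hinner H y z"
  shows "x = y"
proof -
  have "hinner H (x \<ominus> y) (x \<ominus> y) = 0"
    using assms by (simp add: hinner_diff)
  then show ?thesis
    using assms hinner_definite[of "x \<ominus> y"] by (simp add: diff_eq_zero_iff)
qed

section \<open>The metric topology, closures of graphs and limits\<close>

lemma metric_space: "Metric_space (carrier H) (hdist H)"
proof
  show "0 \<le> hdist H x y" for x y by (simp add: hdist_def)
  have comm: "x \<ominus> y = \<ominus> (y \<ominus> x)" if "x \<in> carrier H" "y \<in> carrier H" for x y
    using that by (intro hinner_eqI) (auto simp: hinner_diff hinner_uminus)
  show "hdist H x y = hdist H y x" for x y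
  proof (cases "x \<in> carrier H \<and> y \<in> carrier H")
    case True
    then show ?thesis using comm[of x y] hnorm_uminus[of "y \<ominus> x"] by (simp add: hdist_def)
  qed (auto simp: hdist_def)
  show "hdist H x y = 0 \<longleftrightarrow> x = y" if "x \<in> carrier H" "y \<in> carrier H" for x y
    using that by (simp add: hdist_def diff_eq_zero_iff)
  show "hdist H x z \<le> hdist H x y + hdist H y z"
    if "x \<in> carrier H" "y \<in> carrier H" "z \<in> carrier H" for x y z
  proof -
    have eq: "x \<ominus> z = (x \<ominus> y) \<oplus> (y \<ominus> z)"
      using that by (intro hinner_eqI) (auto simp: hinner_diff hinner_add)
    have "hnorm H (x \<ominus> z) \<le> hnorm H (x \<ominus> y) + hnorm H (y \<ominus> z)"
      by (subst eq, rule hnorm_triangle) (use that in auto)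
    with that show ?thesis unfolding hdist_def by presburger
  qed
qed

lemma hilbert_topology_eq: "hilbert_topology H = Metric_space.mtopology (carrier H) (hdist H)"
  by (simp add: hilbert_topology_def)

lemma hdist_eq: "\<lbrakk>x \<in> carrier H; y \<in> carrier H\<rbrakk> \<Longrightarrow> hdist H x y = hnorm H (x \<ominus> y)"
  by (simp add: hdist_def)

lemma topspace_hilbert [simp]: "topspace (hilbert_topology H) = carrier H"
  by (simp add: hilbert_topology_eq Metric_space.topspace_mtopology[OF metric_space])

lemma limitin_hilbert:
  "limitin (hilbert_topology H) f s F \<longleftrightarrow>
     s \<in> carrier H \<and> (\<forall>\<^sub>F i in F. f i \<in> carrier H) \<and> ((\<lambda>i. hdist H (f i) s) \<longlongrightarrow> 0) F"
  by (simp add: hilbert_topology_eq Metric_space.limitin_metric_dist_null[OF metric_space])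

lemma hilbert_closure_of:
  "hilbert_topology H closure_of S =
     {x \<in> carrier H. \<forall>r>0. \<exists>y\<in>S. y \<in> carrier H \<and> hdist H x y < r}"
  by (auto simp: hilbert_topology_eq Metric_space.metric_closure_of[OF metric_space]
      Metric_space.in_mball[OF metric_space])

lemma subspace_finsum:
  assumes V: "linear_subspace H V" and f: "\<And>i. i \<in> F \<Longrightarrow> f i \<in> V"
  shows "finsum H f F \<in> V"
proof (cases "finite F")
  case True
  then show ?thesis using f
  proof (induction F rule: finite_induct)
    case empty
    then show ?case using V by (simp add: linear_subspace_def)
  next
    case (insert a F)
    have sub: "V \<subseteq> carrier H" and add: "\<And>x y. x \<in> V \<Longrightarrow> y \<in> V \<Longrightarrow> x \<oplus> y \<in> V"
      using V by (auto simp: linear_subspace_def)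
    have "finsum H f (insert a F) = f a \<oplus> finsum H f F"
      using insert sub by (intro M.finsum_insert) auto
    then show ?case using insert add by simp
  qed
next
  case False
  then show ?thesis using V by (simp add: M.finsum_infinite linear_subspace_def)
qed

lemma graph_closure_iff:
  "(x, w) \<in> graph_closure H G \<longleftrightarrow> x \<in> carrier H \<and> w \<in> carrier H \<and>
     (\<forall>r>0. \<exists>(u, v)\<in>G. u \<in> carrier H \<and> v \<in> carrier H \<and> hdist H x u < r \<and> hdist H w v < r)"
  unfolding graph_closure_def hilbert_topology_eq by (rule Metric_space.prod_closure_of_iff[OF metric_space])

text \<open>By Cauchy-Schwarz the inner product is Lipschitz in its first argument. The filter is
  arbitrary because both sequences of partial sums and unconditional sums over finite subsets
  occur.\<close>

lemma limitin_hinner: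
  assumes "limitin (hilbert_topology H) f s F" "y \<in> carrier H"
  shows "((\<lambda>i. hinner H (f i) y) \<longlongrightarrow> hinner H s y) F"
proof -
  have s: "s \<in> carrier H" and ev: "\<forall>\<^sub>F i in F. f i \<in> carrier H"
    and lim: "((\<lambda>i. hdist H (f i) s) \<longlongrightarrow> 0) F"
    using assms(1) by (auto simp: limitin_hilbert)
  have "((\<lambda>i. hinner H (f i) y - hinner H s y) \<longlongrightarrow> 0) F"
  proof (rule Lim_null_comparison)
    show "\<forall>\<^sub>F i in F. norm (hinner H (f i) y - hinner H s y) \<le> hdist H (f i) s * hnorm H y"
      using ev
    proof eventually_elim
      case (elim i)
      then show ?case
        using Cauchy_Schwarz[of "f i \<ominus> s" y] s assms(2) by (simp add: hinner_diff hdist_eq)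
    qed
    show "((\<lambda>i. hdist H (f i) s * hnorm H y) \<longlongrightarrow> 0) F"
      using tendsto_mult_left_zero[OF lim] .
  qed
  then show ?thesis by (rule LIM_zero_cancel)
qed

end

sublocale hilbert_space \<subseteq> inner_product_module
  by unfold_locales (fact hinner_add hinner_smult hinner_cnj hinner_nonneg hinner_definite)+

section \<open>Orthonormal bases\<close>

text \<open>Totality is stated as a trivial orthogonal complement rather than as a dense span: for
  the Haar functions it becomes a statement about vanishing integrals. Countability allows
  expansions to be ordinary sequences.\<close>

locale hilbert_basis = hilbert_space H for H :: "('h, 'm) hilb_scheme" (structure) +
  fixes e :: "'i \<Rightarrow> 'h" and I :: "'i set"
  assumes basis_carrier: "i \<in> I \<Longrightarrow> e i \<in> carrier H"
    and basis_orthonormal: "\<lbrakk>i \<in> I; j \<in> I\<rbrakk> \<Longrightarrow> hinner H (e i) (e j) = (if i = j then 1 else 0)"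
    and basis_total: "\<lbrakk>h \<in> carrier H; \<And>i. i \<in> I \<Longrightarrow> hinner H h (e i) = 0\<rbrakk> \<Longrightarrow> h = \<zero>"
    and basis_countable: "countable I"
begin

definition coord :: "'h \<Rightarrow> 'i \<Rightarrow> complex" where
  "coord h i = hinner H h (e i)"

definition comb :: "('i \<Rightarrow> complex) \<Rightarrow> 'i set \<Rightarrow> 'h" where
  "comb c F = finsum H (\<lambda>i. c i \<odot> e i) F"

text \<open>An exhaustion of \<open>I\<close> by finite sets. It treats finite and infinite
  \<open>I\<close> alike, since \<open>to_nat_on\<close> is injective in both cases.\<close>

definition initial :: "nat \<Rightarrow> 'i set" where
  "initial n = {i \<in> I. to_nat_on I i < n}"

lemma comb_carrier: "F \<subseteq> I \<Longrightarrow> comb c F \<in> carrier H"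
  unfolding comb_def by (rule finsum_carrier) (meson basis_carrier smult_carrier subsetD)

lemma basis_norm: "i \<in> I \<Longrightarrow> hnorm H (e i) = 1"
  by (simp add: hnorm_def basis_orthonormal)

lemma coord_simps:
  "\<lbrakk>x \<in> carrier H; y \<in> carrier H; i \<in> I\<rbrakk> \<Longrightarrow> coord (x \<oplus> y) i = coord x i + coord y i"
  "\<lbrakk>x \<in> carrier H; y \<in> carrier H; i \<in> I\<rbrakk> \<Longrightarrow> coord (x \<ominus> y) i = coord x i - coord y i"
  "\<lbrakk>x \<in> carrier H; i \<in> I\<rbrakk> \<Longrightarrow> coord (c \<odot> x) i = c * coord x i"
  by (simp_all add: coord_def hinner_add hinner_diff hinner_smult basis_carrier)

lemma coord_basis: "\<lbrakk>i \<in> I; j \<in> I\<rbrakk> \<Longrightarrow> coord (e i) j = (if i = j then 1 else 0)"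
  by (simp add: coord_def basis_orthonormal)

lemma coord_comb:
  assumes "finite F" "F \<subseteq> I" "j \<in> I"
  shows "coord (comb c F) j = (if j \<in> F then c j else 0)"
proof -
  have "coord (comb c F) j = (\<Sum>i\<in>F. hinner H (c i \<odot> e i) (e j))"
    unfolding coord_def comb_def
    by (rule hinner_finsum) (use assms basis_carrier in \<open>auto simp: subset_iff\<close>)
  also have "\<dots> = (\<Sum>i\<in>F. if i = j then c i else 0)"
    by (rule sum.cong) (use assms in \<open>auto simp: subset_iff hinner_smult basis_carrier basis_orthonormal\<close>)
  finally show ?thesis using assms by simp
qed

lemma coord_eqI:
  assumes "x \<in> carrier H" "y \<in> carrier H" "\<And>i. i \<in> I \<Longrightarrow> coord x i = coord y i"
  shows "x = y"
proof -
  have "x \<ominus> y = \<zero>"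
    by (rule basis_total) (use assms in \<open>simp_all add: coord_simps flip: coord_def\<close>)
  then show ?thesis using assms by (simp add: diff_eq_zero_iff)
qed

lemma hinner_comb:
  assumes "F \<subseteq> I" "y \<in> carrier H"
  shows "hinner H (comb c F) y = (\<Sum>i\<in>F. c i * cnj (coord y i))"
proof -
  have "hinner H (comb c F) y = (\<Sum>i\<in>F. hinner H (c i \<odot> e i) y)"
    unfolding comb_def
    by (rule hinner_finsum) (use assms basis_carrier in \<open>auto simp: subset_iff\<close>)
  also have "\<dots> = (\<Sum>i\<in>F. c i * cnj (coord y i))"
    by (rule sum.cong)
      (use assms in \<open>auto simp: subset_iff hinner_smult basis_carrier coord_def intro!: hinner_cnj\<close>)
  finally show ?thesis .
qed

lemma hnorm_comb_sq:
  assumes "finite F" "F \<subseteq> I"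
  shows "(hnorm H (comb c F))\<^sup>2 = (\<Sum>i\<in>F. (cmod (c i))\<^sup>2)"
proof -
  have "hinner H (comb c F) (comb c F) = (\<Sum>i\<in>F. c i * cnj (coord (comb c F) i))"
    by (rule hinner_comb) (use assms comb_carrier in auto)
  also have "\<dots> = (\<Sum>i\<in>F. complex_of_real ((cmod (c i))\<^sup>2))"
    by (rule sum.cong)
      (use assms in \<open>auto simp: subset_iff coord_comb complex_norm_square simp del: of_real_power\<close>)
  finally show ?thesis
    using assms by (simp add: hnorm_sq comb_carrier)
qed

lemma hnorm_residual_sq:
  assumes "finite F" "F \<subseteq> I" "h \<in> carrier H"
  shows "(hnorm H (h \<ominus> comb (coord h) F))\<^sup>2 = (hnorm H h)\<^sup>2 - (\<Sum>i\<in>F. (cmod (coord h i))\<^sup>2)"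
proof -
  have c: "comb (coord h) F \<in> carrier H" using assms comb_carrier by simp
  have "hinner H (comb (coord h) F) h = (\<Sum>i\<in>F. coord h i * cnj (coord h i))"
    by (rule hinner_comb) (use assms in auto)
  also have "\<dots> = (\<Sum>i\<in>F. complex_of_real ((cmod (coord h i))\<^sup>2))"
    by (simp add: complex_norm_square del: of_real_power)
  finally have "Re (hinner H h (comb (coord h) F)) = (\<Sum>i\<in>F. (cmod (coord h i))\<^sup>2)"
    using hinner_cnj[OF c assms(3)] by simp
  then show ?thesis
    using assms c by (simp add: hnorm_diff_sq hnorm_comb_sq)
qed

lemma Bessel:
  assumes "finite F" "F \<subseteq> I" "h \<in> carrier H"
  shows "(\<Sum>i\<in>F. (cmod (coord h i))\<^sup>2) \<le> (hnorm H h)\<^sup>2"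
  using hnorm_residual_sq[OF assms] zero_le_power2[of "hnorm H (h \<ominus> comb (coord h) F)"] by linarith

section \<open>Convergence of orthonormal expansions\<close>

lemma initial_subset: "initial n \<subseteq> I"
  by (auto simp: initial_def)

lemma finite_initial: "finite (initial n)"
proof (rule finite_imageD)
  show "finite (to_nat_on I ` initial n)"
    by (rule finite_subset[of _ "{..<n}"]) (auto simp: initial_def)
  show "inj_on (to_nat_on I) (initial n)"
    using inj_on_to_nat_on[OF basis_countable] initial_subset by (rule inj_on_subset)
qed

lemma initial_mono: "m \<le> n \<Longrightarrow> initial m \<subseteq> initial n"
  by (auto simp: initial_def)

lemma eventually_initial: "i \<in> I \<Longrightarrow> \<forall>\<^sub>F n in sequentially. i \<in> initial n"
  using eventually_gt_at_top[of "to_nat_on I i"] by (simp add: initial_def)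

text \<open>Distances between partial sums are square roots of differences of the increasing bounded
  sequence \<open>s\<close>, so completeness gives a limit, and coordinates pass to it by
  continuity. The convergence is part of the conclusion because \<open>expansion\<close> rests on
  it.\<close>

lemma Riesz_Fischer_limit:
  assumes bound: "\<And>F. \<lbrakk>finite F; F \<subseteq> I\<rbrakk> \<Longrightarrow> (\<Sum>i\<in>F. (cmod (c i))\<^sup>2) \<le> B"
  obtains h where "h \<in> carrier H" "\<And>i. i \<in> I \<Longrightarrow> coord h i = c i"
    "limitin (hilbert_topology H) (\<lambda>n. comb c (initial n)) h sequentially"
proof -
  interpret HM: Metric_space "carrier H" "hdist H" by (rule metric_space)
  define s where "s n = (\<Sum>i\<in>initial n. (cmod (c i))\<^sup>2)" for n
  have mono: "incseq s"
    unfolding s_def by (intro incseq_SucI sum_mono2 finite_initial initial_mono) auto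
  have "\<forall>n. s n \<le> B"
    by (auto simp: s_def intro!: bound finite_initial initial_subset)
  then have "convergent s"
    using incseq_convergent[OF mono] convergentI by metis
  then have Cauchy: "Cauchy s" by (rule convergent_Cauchy)
  have d: "hdist H (comb c (initial n)) (comb c (initial m)) = sqrt (s n - s m)" if "m \<le> n" for m n
  proof -
    have sub: "initial m \<subseteq> initial n" using that by (rule initial_mono)
    have "comb c (initial n) \<ominus> comb c (initial m) = comb c (initial n - initial m)"
    proof (rule coord_eqI)
      fix i assume i: "i \<in> I"
      show "coord (comb c (initial n) \<ominus> comb c (initial m)) i = coord (comb c (initial n - initial m)) i"
        using i sub initial_subset[of n]
        by (auto simp: coord_simps comb_carrier initial_subset coord_comb finite_initial subset_iff)
    qed (use initial_subset comb_carrier in \<open>auto intro!: comb_carrier minus_carrier simp: subset_iff\<close>)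
    moreover have "(hnorm H (comb c (initial n - initial m)))\<^sup>2 = s n - s m"
      using sub initial_subset[of n] 
      by (subst hnorm_comb_sq) (auto simp: s_def finite_initial sum_diff)
    moreover have "comb c (initial n - initial m) \<in> carrier H"
      using initial_subset[of n] by (intro comb_carrier) auto
    ultimately show ?thesis
      by (simp add: hdist_eq comb_carrier initial_subset real_sqrt_unique)
  qed
  have "HM.MCauchy (\<lambda>n. comb c (initial n))"
    unfolding HM.MCauchy_def
  proof (intro conjI allI impI)
    show "range (\<lambda>n. comb c (initial n)) \<subseteq> carrier H"
      by (simp add: image_subset_iff comb_carrier initial_subset)
    fix \<epsilon> :: real assume \<epsilon>: "\<epsilon> > 0"
    then obtain N where N: "\<And>m n. m \<ge> N \<Longrightarrow> n \<ge> N \<Longrightarrow> norm (s m - s n) < \<epsilon>\<^sup>2"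
      using CauchyD[OF Cauchy, of "\<epsilon>\<^sup>2"] by auto
    have "hdist H (comb c (initial n)) (comb c (initial n')) < \<epsilon>" if "N \<le> n" "N \<le> n'" for n n'
    proof -
      have *: "hdist H (comb c (initial n)) (comb c (initial m)) < \<epsilon>" if "m \<le> n" "N \<le> n" "N \<le> m" for m n
        using N[of n m] that \<epsilon> by (simp add: d real_less_lsqrt)
      show ?thesis
        using *[of n n'] *[of n' n] that by (cases "n \<le> n'") (auto simp: HM.commute)
    qed
    then show "\<exists>N. \<forall>n n'. N \<le> n \<longrightarrow> N \<le> n' \<longrightarrow> hdist H (comb c (initial n)) (comb c (initial n')) < \<epsilon>"
      by meson
  qed
  then obtain h where h: "limitin HM.mtopology (\<lambda>n. comb c (initial n)) h sequentially"
    using complete by (meson HM.mcomplete_def)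
  have lim: "limitin (hilbert_topology H) (\<lambda>n. comb c (initial n)) h sequentially"
    using h by (simp add: hilbert_topology_eq)
  have "coord h i = c i" if i: "i \<in> I" for i
  proof (rule tendsto_unique[OF sequentially_bot])
    show "(\<lambda>n. coord (comb c (initial n)) i) \<longlonglongrightarrow> coord h i"
      unfolding coord_def by (rule limitin_hinner[OF lim basis_carrier[OF i]])
    have "\<forall>\<^sub>F n in sequentially. coord (comb c (initial n)) i = c i"
      using eventually_initial[OF i]
      by eventually_elim (simp add: coord_comb finite_initial initial_subset i)
    then show "(\<lambda>n. coord (comb c (initial n)) i) \<longlonglongrightarrow> c i"
      by (rule tendsto_eventually)
  qed
  moreover have "h \<in> carrier H" using lim by (simp add: limitin_hilbert)
  ultimately show ?thesis using that lim by simp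
qed

lemma Riesz_Fischer:
  assumes "\<And>F. \<lbrakk>finite F; F \<subseteq> I\<rbrakk> \<Longrightarrow> (\<Sum>i\<in>F. (cmod (c i))\<^sup>2) \<le> B"
  shows "\<exists>h\<in>carrier H. \<forall>i\<in>I. coord h i = c i"
  using Riesz_Fischer_limit[of c B] assms by metis

text \<open>Bessel's inequality makes the partial sums converge to some vector with the coordinates
  of \<open>h\<close>, and totality identifies the two.\<close>

lemma expansion:
  assumes h: "h \<in> carrier H"
  shows "limitin (hilbert_topology H) (\<lambda>n. comb (coord h) (initial n)) h sequentially"
proof -
  obtain h' where h': "h' \<in> carrier H" "\<And>i. i \<in> I \<Longrightarrow> coord h' i = coord h i"
    "limitin (hilbert_topology H) (\<lambda>n. comb (coord h) (initial n)) h' sequentially"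
    using Riesz_Fischer_limit[of "coord h" "(hnorm H h)\<^sup>2"] Bessel h by metis
  then have "h' = h" using h by (intro coord_eqI)
  with h' show ?thesis by simp
qed

lemma hinner_expansion:
  assumes "x \<in> carrier H" "y \<in> carrier H"
  shows "(\<lambda>n. \<Sum>i\<in>initial n. coord x i * cnj (coord y i)) \<longlonglongrightarrow> hinner H x y"
  using limitin_hinner[OF expansion[OF assms(1)] assms(2)] assms
  by (simp add: hinner_comb initial_subset)

text \<open>The counterpart of Bessel's inequality: estimates of finite coordinate sums become norm
  estimates. The bounds for resolvents are proved in this way.\<close>

lemma hnorm_sq_leI:
  assumes h: "h \<in> carrier H" and "\<And>F. \<lbrakk>finite F; F \<subseteq> I\<rbrakk> \<Longrightarrow> (\<Sum>i\<in>F. (cmod (coord h i))\<^sup>2) \<le> B"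
  shows "(hnorm H h)\<^sup>2 \<le> B"
proof -
  have "(\<lambda>n. Re (\<Sum>i\<in>initial n. coord h i * cnj (coord h i))) \<longlonglongrightarrow> Re (hinner H h h)"
    by (intro tendsto_Re hinner_expansion h)
  then have "(\<lambda>n. \<Sum>i\<in>initial n. (cmod (coord h i))\<^sup>2) \<longlonglongrightarrow> (hnorm H h)\<^sup>2"
    using h by (simp add: hnorm_sq complex_mult_cnj cmod_power2)
  then show ?thesis
    by (rule LIMSEQ_le_const2) (use assms finite_initial initial_subset in auto)
qed

lemma subspace_comb:
  assumes V: "linear_subspace H V" and e: "\<And>i. i \<in> F \<Longrightarrow> e i \<in> V"
  shows "comb c F \<in> V"
  unfolding comb_def by (rule subspace_finsum[OF V]) (use V e in \<open>simp add: linear_subspace_def\<close>)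

lemma expansion_dist:
  assumes "h \<in> carrier H" "r > 0"
  shows "\<forall>\<^sub>F n in sequentially. hdist H h (comb (coord h) (initial n)) < r"
proof -
  have "((\<lambda>n. hdist H (comb (coord h) (initial n)) h) \<longlongrightarrow> 0) sequentially"
    using expansion[OF assms(1)] by (simp add: limitin_hilbert)
  then have "\<forall>\<^sub>F n in sequentially. hdist H (comb (coord h) (initial n)) h < r"
    using assms(2) by (rule order_tendstoD)
  then show ?thesis
    by (simp add: Metric_space.commute[OF metric_space])
qed

lemma dense_subspace:
  assumes V: "linear_subspace H V" and e: "\<And>i. i \<in> I \<Longrightarrow> e i \<in> V"
  shows "dense_in H V"
proof -
  have "\<exists>y\<in>V. y \<in> carrier H \<and> hdist H h y < r" if hr: "h \<in> carrier H" "r > 0" for h r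
  proof -
    obtain n where "hdist H h (comb (coord h) (initial n)) < r"
      using eventually_happens'[OF _ expansion_dist[OF hr]] by auto
    moreover have "comb (coord h) (initial n) \<in> V"
      using initial_subset e by (intro subspace_comb[OF V]) auto
    ultimately show ?thesis using V comb_carrier initial_subset by (meson subsetD)
  qed
  then show ?thesis by (auto simp: dense_in_def hilbert_closure_of)
qed

lemma hnorm_comb_le:
  assumes "F \<subseteq> I"
  shows "hnorm H (comb c F) \<le> (\<Sum>i\<in>F. cmod (c i))"
proof -
  have "hnorm H (comb c F) \<le> (\<Sum>i\<in>F. hnorm H (c i \<odot> e i))"
    unfolding comb_def by (rule hnorm_finsum_le) (use assms basis_carrier in auto)
  also have "\<dots> = (\<Sum>i\<in>F. cmod (c i))"
    by (rule sum.cong) (use assms basis_carrier basis_norm in \<open>auto simp: hnorm_smult subset_iff\<close>)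
  finally show ?thesis .
qed

lemma comb_diff:
  assumes "finite F" "F \<subseteq> I"
  shows "comb c F \<ominus> comb b F = comb (\<lambda>i. c i - b i) F"
  by (rule coord_eqI) (use assms comb_carrier in \<open>auto simp: coord_simps coord_comb\<close>)

lemma separable: "separable_space (hilbert_topology H)"
proof -
  obtain Q :: "complex set" where Q: "countable Q" "\<And>S. open S \<Longrightarrow> S \<noteq> {} \<Longrightarrow> \<exists>q\<in>Q. q \<in> S"
    using countable_dense_setE by metis
  define C where "C = (\<Union>F\<in>{F. finite F \<and> F \<subseteq> I}. (\<lambda>q. comb q F) ` (PiE F (\<lambda>_. Q)))"
  have "countable C"
    unfolding C_def
    by (intro countable_UN countable_image countable_PiE countable_Collect_finite_subset basis_countable)
      (auto simp: Q)
  moreover have sub: "C \<subseteq> carrier H"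
    unfolding C_def using comb_carrier by auto
  moreover have "\<exists>y\<in>C. y \<in> carrier H \<and> hdist H h y < r" if hr: "h \<in> carrier H" "r > 0" for h r
  proof -
    obtain n where n: "hdist H h (comb (coord h) (initial n)) < r / 2"
      using eventually_happens'[OF _ expansion_dist[of h "r / 2"]] hr by auto
    let ?F = "initial n"
    \<comment> \<open>The summand 1 keeps the denominator positive when \<open>?F\<close> is empty
      and makes \<open>card ?F\<close> errors of size \<open>\<delta>\<close> add up to strictly
      less than \<open>r / 2\<close>.\<close>
    define \<delta> where "\<delta> = r / (2 * (real (card ?F) + 1))"
    have \<delta>: "\<delta> > 0" using hr by (simp add: \<delta>_def)
    have "\<forall>i. \<exists>q\<in>Q. q \<in> ball (coord h i) \<delta>"
      using \<delta> by (intro allI Q) auto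
    then obtain q where q: "\<And>i. q i \<in> Q" "\<And>i. dist (coord h i) (q i) < \<delta>"
      unfolding mem_ball by metis
    \<comment> \<open>Restriction makes the coefficients an element of the extensional product in
      the definition of \<open>C\<close>, which is countable.\<close>
    define q' where "q' = restrict q ?F"
    have c: "comb q' ?F \<in> C"
      unfolding C_def
      by (rule UN_I[of ?F]) (use finite_initial initial_subset q(1) in \<open>auto simp: q'_def intro!: imageI\<close>)
    have cc: "comb q' ?F \<in> carrier H" "comb (coord h) ?F \<in> carrier H"
      by (simp_all add: comb_carrier initial_subset)
    have "hdist H (comb (coord h) ?F) (comb q' ?F) = hnorm H (comb (\<lambda>i. coord h i - q' i) ?F)"
      by (simp add: hdist_eq cc comb_diff finite_initial initial_subset)
    also have "\<dots> \<le> (\<Sum>i\<in>?F. cmod (coord h i - q' i))"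
      by (rule hnorm_comb_le) (rule initial_subset)
    also have "\<dots> \<le> (\<Sum>i\<in>?F. \<delta>)"
      by (rule sum_mono) (use q(2) in \<open>simp add: q'_def dist_norm less_imp_le\<close>)
    also have "\<dots> < r / 2"
      using hr by (simp add: \<delta>_def field_simps)
    finally have "hdist H h (comb q' ?F) < r"
      using Metric_space.triangle[OF metric_space hr(1) cc(2) cc(1)] n by linarith
    then show ?thesis using c cc by auto
  qed
  ultimately show ?thesis
    unfolding separable_space_def by (intro exI[of _ C]) (auto simp: hilbert_closure_of)
qed

text \<open>Its contrapositive makes the index set infinite in the infinite-dimensional case, the
  one in which unboundedness is demanded.\<close>

lemma finite_dimensional_if_finite:
  assumes "finite I"
  shows "finite_dimensional H"
  unfolding finite_dimensional_def
proof (intro exI conjI)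
  show "finite (e ` I)" "e ` I \<subseteq> carrier H"
    using assms basis_carrier by auto
  have inj: "inj_on e I"
  proof (rule inj_onI)
    fix i j assume "i \<in> I" "j \<in> I" "e i = e j"
    then show "i = j" using basis_orthonormal[of i i] basis_orthonormal[of i j] by (auto split: if_splits)
  qed
  have "h \<in> linear_span H (e ` I)" if h: "h \<in> carrier H" for h
  proof -
    have "h = comb (coord h) I"
      by (rule coord_eqI) (use h assms in \<open>auto simp: comb_carrier coord_comb\<close>)
    \<comment> \<open>\<open>linear_span\<close> sums over vectors and not over indices, so the sum
      is reindexed along the injective map \<open>e\<close>.\<close>
    also have "\<dots> = finsum H (\<lambda>v. coord h (inv_into I e v) \<odot> v) (e ` I)"
      unfolding comb_def
      by (subst M.finsum_reindex) (use inj basis_carrier in \<open>auto intro!: M.finsum_cong' simp: inv_into_f_f\<close>)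
    finally show ?thesis
      unfolding linear_span_def mem_Collect_eq
      by (intro exI[of _ "\<lambda>v. coord h (inv_into I e v)"] exI[of _ "e ` I"]) (use assms in auto)
  qed
  moreover have "linear_span H (e ` I) \<subseteq> carrier H"
    unfolding linear_span_def using basis_carrier by (auto intro!: finsum_carrier smult_carrier)
  ultimately show "linear_span H (e ` I) = carrier H" by auto
qed

end

section \<open>Diagonal operators\<close>

context hilbert_basis
begin

text \<open>Up to uniformly small tails only finitely many coordinates matter on the image of the
  unit ball. They are bounded, so rounding them to a grid leaves finitely many labels and the image
  is totally bounded; completeness turns this into a compact closure.\<close>

lemma compact_operatorI:
  assumes T: "T \<in> bounded_operators H"
    and tail: "\<And>\<epsilon>. \<epsilon> > 0 \<Longrightarrow> \<exists>F. finite F \<and> F \<subseteq> I \<and>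
      (\<forall>h\<in>carrier H. hnorm H h \<le> 1 \<longrightarrow> hnorm H (T h \<ominus> comb (coord (T h)) F) \<le> \<epsilon>)"
  shows "compact_operator H T"
proof -
  interpret HM: Metric_space "carrier H" "hdist H" by (rule metric_space)
  let ?S = "T ` {x \<in> carrier H. hnorm H x \<le> 1}"
  have Tc: "T h \<in> carrier H" if "h \<in> carrier H" for h
    using T that by (auto simp: bounded_operators_def linear_operator_def)
  obtain C where C: "\<And>h. h \<in> carrier H \<Longrightarrow> hnorm H (T h) \<le> C * hnorm H h"
    using T by (auto simp: bounded_operators_def bounded_on_def)
  have S: "?S \<subseteq> carrier H" using Tc by auto
  have bound: "hnorm H s \<le> \<bar>C\<bar>" if s: "s \<in> ?S" for s
  proof -
    obtain h where h: "h \<in> carrier H" "hnorm H h \<le> 1" "s = T h" using s by auto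
    have "C * hnorm H h \<le> \<bar>C\<bar> * 1"
      using h by (intro mult_mono) auto
    then show ?thesis using C[OF h(1)] h(3) by simp
  qed
  have "HM.mtotally_bounded ?S"
  proof (rule HM.mtotally_boundedI[where 'k = "'i \<Rightarrow> int \<times> int"])
    show "?S \<subseteq> carrier H" by (rule S)
    fix \<epsilon> :: real assume \<epsilon>: "\<epsilon> > 0"
    then obtain F where F: "finite F" "F \<subseteq> I"
      "\<And>h. \<lbrakk>h \<in> carrier H; hnorm H h \<le> 1\<rbrakk> \<Longrightarrow> hnorm H (T h \<ominus> comb (coord (T h)) F) \<le> \<epsilon> / 4"
      using tail[of "\<epsilon> / 4"] by auto
    \<comment> \<open>Equal labels mean a difference of at most \<open>\<delta>\<close> in the real
      and in the imaginary part of each coordinate, so the truncations to \<open>F\<close> are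
      closer than \<open>\<epsilon> / 2\<close>; the two tails account for
      \<open>\<epsilon> / 4\<close> each.\<close>
    define \<delta> where "\<delta> = \<epsilon> / (8 * (real (card F) + 1))"
    have \<delta>: "\<delta> > 0" using \<epsilon> by (simp add: \<delta>_def)
    define g where "g s = restrict (\<lambda>i. (\<lfloor>Re (coord s i) / \<delta>\<rfloor>, \<lfloor>Im (coord s i) / \<delta>\<rfloor>)) F" for s
    define m where "m = \<lceil>\<bar>C\<bar> / \<delta>\<rceil> + 1"
    have floor_range: "\<lfloor>t / \<delta>\<rfloor> \<in> {- m..m}" if "\<bar>t\<bar> \<le> \<bar>C\<bar>" for t
    proof -
      have "t / \<delta> \<le> \<bar>C\<bar> / \<delta>" "- (\<bar>C\<bar> / \<delta>) \<le> t / \<delta>"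
        using divide_right_mono[of t "\<bar>C\<bar>" \<delta>] divide_right_mono[of "- \<bar>C\<bar>" t \<delta>] that \<delta> by auto
      then show ?thesis unfolding m_def by (simp; linarith)
    qed
    have "g (T s) \<in> PiE F (\<lambda>_. {- m..m} \<times> {- m..m})"
      if s: "s \<in> carrier H" "hnorm H s \<le> 1" for s
    proof -
      have "coord (T s) i \<in> cball 0 \<bar>C\<bar>" if "i \<in> F" for i
      proof -
        have i: "i \<in> I" using that F by auto
        have "cmod (coord (T s) i) \<le> hnorm H (T s) * hnorm H (e i)"
          unfolding coord_def by (rule Cauchy_Schwarz) (use s Tc basis_carrier i in auto)
        also have "\<dots> \<le> \<bar>C\<bar>" using bound[of "T s"] s by (simp add: basis_norm i)
        finally show ?thesis by simp
      qed
      then have "\<bar>Re (coord (T s) i)\<bar> \<le> \<bar>C\<bar> \<and> \<bar>Im (coord (T s) i)\<bar> \<le> \<bar>C\<bar>" if "i \<in> F" for i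
        using that abs_Re_le_cmod[of "coord (T s) i"] abs_Im_le_cmod[of "coord (T s) i"] by force
      then show ?thesis
        using floor_range by (simp add: g_def del: atLeastAtMost_iff)
    qed
    then have "g ` ?S \<subseteq> PiE F (\<lambda>_. {- m..m} \<times> {- m..m})"
      by (simp add: image_subset_iff)
    then have "finite (g ` ?S)"
      by (rule finite_subset) (intro finite_PiE F finite_cartesian_product finite_atLeastAtMost_int)
    moreover have "hdist H s t < \<epsilon>" if st: "s \<in> ?S" "t \<in> ?S" "g s = g t" for s t
    proof -
      have stc: "s \<in> carrier H" "t \<in> carrier H" using st S by auto
      let ?s = "comb (coord s) F" and ?t = "comb (coord t) F"
      have c: "?s \<in> carrier H" "?t \<in> carrier H" using F by (auto intro: comb_carrier)
      have s: "hdist H s ?s \<le> \<epsilon> / 4" and t: "hdist H t ?t \<le> \<epsilon> / 4"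
        using st F(3) stc c by (auto simp: hdist_eq)
      have close: "cmod (coord s i - coord t i) \<le> 2 * \<delta>" if "i \<in> F" for i
      proof -
        have floor_close: "\<bar>a - b\<bar> \<le> \<delta>" if "\<lfloor>a / \<delta>\<rfloor> = \<lfloor>b / \<delta>\<rfloor>" for a b
        proof -
          have "\<bar>a / \<delta> - b / \<delta>\<bar> \<le> 1" using that by linarith
          then have "\<bar>(a - b) / \<delta>\<bar> \<le> 1" by (simp add: diff_divide_distrib)
          then show ?thesis using \<delta> by (simp add: abs_divide divide_le_eq)
        qed
        have "g s i = g t i" using st(3) by simp
        then have "\<bar>Re (coord s i - coord t i)\<bar> \<le> \<delta>" "\<bar>Im (coord s i - coord t i)\<bar> \<le> \<delta>"
          using that by (auto simp: g_def intro!: floor_close)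
        then show ?thesis using cmod_le[of "coord s i - coord t i"] by linarith
      qed
      have "hdist H ?s ?t = hnorm H (comb (\<lambda>i. coord s i - coord t i) F)"
        using c F by (simp add: hdist_eq comb_diff)
      also have "\<dots> \<le> (\<Sum>i\<in>F. cmod (coord s i - coord t i))"
        by (rule hnorm_comb_le[OF F(2)])
      also have "\<dots> \<le> (\<Sum>i\<in>F. 2 * \<delta>)"
        by (rule sum_mono) (rule close)
      also have "\<dots> < \<epsilon> / 4 + \<epsilon> / 4"
        using \<epsilon> by (simp add: \<delta>_def field_simps add_pos_nonneg)
      finally have "hdist H ?s ?t < \<epsilon> / 2" by simp
      moreover have "hdist H s t \<le> hdist H s ?s + hdist H ?s t"
        by (rule HM.triangle) (use stc c in auto)
      moreover have "hdist H ?s t \<le> hdist H ?s ?t + hdist H ?t t"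
        by (rule HM.triangle) (use stc c in auto)
      moreover have "hdist H ?t t = hdist H t ?t" by (rule HM.commute)
      ultimately show ?thesis using s t by linarith
    qed
    ultimately show "\<exists>g :: 'h \<Rightarrow> 'i \<Rightarrow> int \<times> int. finite (g ` ?S) \<and> (\<forall>s\<in>?S. \<forall>t\<in>?S. g s = g t \<longrightarrow> hdist H s t < \<epsilon>)"
      by (intro exI[of _ g]) auto
  qed
  then have "compactin HM.mtopology (HM.mtopology closure_of ?S)"
    using HM.mtotally_bounded_eq_compact_closure_of[OF complete] by simp
  then show ?thesis
    using T by (simp add: compact_operator_def hilbert_topology_eq)
qed

end

text \<open>Only the coordinates of \<open>D h\<close> are prescribed; linearity and symmetry
  follow. The domain is any subspace that contains the basis, since the Dirac operator comes with no
  particular one.\<close>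

locale diagonal_operator = hilbert_basis H e I
  for H :: "('h, 'm) hilb_scheme" (structure) and e :: "'i \<Rightarrow> 'h" and I +
  fixes lam :: "'i \<Rightarrow> real" and V :: "'h set" and D :: "'h \<Rightarrow> 'h"
  assumes subspace: "linear_subspace H V"
    and basis_in_domain: "i \<in> I \<Longrightarrow> e i \<in> V"
    and closed: "h \<in> V \<Longrightarrow> D h \<in> carrier H"
    and coord_D: "\<lbrakk>h \<in> V; i \<in> I\<rbrakk> \<Longrightarrow> coord (D h) i = complex_of_real (lam i) * coord h i"
begin

section \<open>Closure and adjoint of a diagonal operator\<close>

lemma domain_carrier: "h \<in> V \<Longrightarrow> h \<in> carrier H"
  using subspace by (auto simp: linear_subspace_def)

lemma linear_operator: "linear_operator H V D"
proof -
  have add: "D (x \<oplus> y) = D x \<oplus> D y" if "x \<in> V" "y \<in> V" for x y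
  proof -
    have xy: "x \<oplus> y \<in> V" using subspace that by (simp add: linear_subspace_def)
    show ?thesis
      by (rule coord_eqI)
        (use that xy closed domain_carrier in \<open>simp_all add: coord_D coord_simps algebra_simps\<close>)
  qed
  have smult: "D (c \<odot> x) = c \<odot> D x" if "x \<in> V" for c x
  proof -
    have cx: "c \<odot> x \<in> V" using subspace that by (simp add: linear_subspace_def)
    show ?thesis
      by (rule coord_eqI)
        (use that cx closed domain_carrier in \<open>simp_all add: coord_D coord_simps\<close>)
  qed
  show ?thesis
    using add smult subspace closed by (simp add: linear_operator_def)
qed

text \<open>By Parseval both sides are limits of the same sums, because the eigenvalues are
  real.\<close>

lemma D_symmetric:
  assumes x: "x \<in> V" and y: "y \<in> V"
  shows "hinner H (D x) y = hinner H x (D y)"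
proof (rule LIMSEQ_unique)
  show "(\<lambda>n. \<Sum>i\<in>initial n. coord (D x) i * cnj (coord y i)) \<longlonglongrightarrow> hinner H (D x) y"
    by (rule hinner_expansion) (use x y closed domain_carrier in auto)
  have "(\<lambda>n. \<Sum>i\<in>initial n. coord x i * cnj (coord (D y) i)) \<longlonglongrightarrow> hinner H x (D y)"
    by (rule hinner_expansion) (use x y closed domain_carrier in auto)
  also have "(\<lambda>n. \<Sum>i\<in>initial n. coord x i * cnj (coord (D y) i)) =
      (\<lambda>n. \<Sum>i\<in>initial n. coord (D x) i * cnj (coord y i))"
    by (intro ext sum.cong) (use x y initial_subset in \<open>auto simp: coord_D subset_iff\<close>)
  finally show "(\<lambda>n. \<Sum>i\<in>initial n. coord (D x) i * cnj (coord y i)) \<longlonglongrightarrow> hinner H x (D y)" .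
qed

text \<open>The graph of the maximal operator of multiplication by \<open>lam\<close> in
  coordinates. It does not mention \<open>V\<close>, and this is how the choice of the domain
  disappears.\<close>

definition closure_graph :: "('h \<times> 'h) set" where
  "closure_graph = {(x, w). x \<in> carrier H \<and> w \<in> carrier H \<and>
     (\<forall>i\<in>I. coord w i = complex_of_real (lam i) * coord x i)}"

lemma D_comb:
  assumes "finite F" "F \<subseteq> I"
  shows "D (comb c F) = comb (\<lambda>i. complex_of_real (lam i) * c i) F"
proof -
  have "comb c F \<in> V" using assms basis_in_domain by (intro subspace_comb subspace) auto
  then show ?thesis
    by (intro coord_eqI) (use assms comb_carrier closed in \<open>auto simp: coord_D coord_comb\<close>)
qed

text \<open>Coordinates are continuous, so the relation between the coordinates of \<open>x\<close>
  and \<open>w\<close> passes to limits. Conversely \<open>D\<close> maps the truncation of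
  \<open>x\<close> to the truncation of \<open>w\<close>, and both converge, so finite combinations
  of basis vectors are already dense in the maximal graph.\<close>

lemma graph_closure_eq: "graph_closure H (operator_graph V D) = closure_graph"
proof (rule Set.set_eqI, rule iffI)
  fix p assume p: "p \<in> graph_closure H (operator_graph V D)"
  obtain x w where xw: "p = (x, w)" by (cases p)
  have c: "x \<in> carrier H" "w \<in> carrier H"
    and app: "\<And>r. r > 0 \<Longrightarrow> \<exists>u\<in>V. hdist H x u < r \<and> hdist H w (D u) < r"
    using p unfolding xw graph_closure_iff by (auto simp: operator_graph_def)
  have "coord w i = complex_of_real (lam i) * coord x i" if i: "i \<in> I" for i
  proof -
    have small: "cmod (coord w i - complex_of_real (lam i) * coord x i) \<le> (1 + \<bar>lam i\<bar>) * r" if r: "r > 0" for r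
    proof -
      obtain u where u: "u \<in> V" "hdist H x u < r" "hdist H w (D u) < r" using app[OF r] by (elim bexE conjE)
      have uc: "u \<in> carrier H" "D u \<in> carrier H" using u domain_carrier closed by auto
      have CS: "cmod (coord (y \<ominus> z) i) \<le> hdist H y z" if "y \<in> carrier H" "z \<in> carrier H" for y z
        using Cauchy_Schwarz[of "y \<ominus> z" "e i"] that i basis_carrier[OF i]
        by (simp add: coord_def hdist_eq basis_norm)
      have "coord w i - complex_of_real (lam i) * coord x i =
          coord (w \<ominus> D u) i - complex_of_real (lam i) * coord (x \<ominus> u) i"
        using i c uc u(1) by (simp add: coord_simps coord_D algebra_simps)
      then have "cmod (coord w i - complex_of_real (lam i) * coord x i) \<le>
          cmod (coord (w \<ominus> D u) i) + \<bar>lam i\<bar> * cmod (coord (x \<ominus> u) i)"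
        by (metis norm_mult norm_of_real norm_triangle_ineq4)
      also have "\<dots> \<le> r + \<bar>lam i\<bar> * r"
        using CS[of w "D u"] CS[of x u] c uc u by (intro add_mono mult_left_mono) auto
      finally show ?thesis by (simp add: algebra_simps)
    qed
    \<comment> \<open>The radius \<open>r / (1 + \<bar>lam i\<bar>)\<close> cancels the factor in
      \<open>small\<close>.\<close>
    have "cmod (coord w i - complex_of_real (lam i) * coord x i) \<le> 0"
    proof (rule field_le_epsilon)
      fix r :: real assume "r > 0"
      moreover have "1 + \<bar>lam i\<bar> > 0" by linarith
      ultimately show "cmod (coord w i - complex_of_real (lam i) * coord x i) \<le> 0 + r"
        using small[of "r / (1 + \<bar>lam i\<bar>)"] by simp
    qed
    then show ?thesis by simp
  qed
  then show "p \<in> closure_graph" using c by (simp add: closure_graph_def xw)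
next
  fix p assume p: "p \<in> closure_graph"
  obtain x w where xw: "p = (x, w)" by (cases p)
  have c: "x \<in> carrier H" "w \<in> carrier H"
    and lam: "\<And>i. i \<in> I \<Longrightarrow> coord w i = complex_of_real (lam i) * coord x i"
    using p by (auto simp: closure_graph_def xw)
  have "\<exists>(u, v)\<in>operator_graph V D. u \<in> carrier H \<and> v \<in> carrier H \<and> hdist H x u < r \<and> hdist H w v < r"
    if r: "r > 0" for r
  proof -
    have "\<forall>\<^sub>F n in sequentially. hdist H x (comb (coord x) (initial n)) < r \<and>
        hdist H w (comb (coord w) (initial n)) < r"
      using expansion_dist[OF c(1) r] expansion_dist[OF c(2) r] by (rule eventually_conj)
    then obtain n where n: "hdist H x (comb (coord x) (initial n)) < r"
        "hdist H w (comb (coord w) (initial n)) < r"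
      using eventually_happens' by (metis (no_types, lifting) sequentially_bot)
    have "D (comb (coord x) (initial n)) = comb (\<lambda>i. complex_of_real (lam i) * coord x i) (initial n)"
      by (rule D_comb[OF finite_initial initial_subset])
    also have "\<dots> = comb (coord w) (initial n)"
      unfolding comb_def
      by (rule M.finsum_cong') (use initial_subset lam basis_carrier in \<open>auto simp: subset_iff\<close>)
    finally have "(comb (coord x) (initial n), comb (coord w) (initial n)) \<in> operator_graph V D"
      unfolding operator_graph_def
      using subspace_comb[OF subspace, of "initial n" "coord x"] initial_subset basis_in_domain
      by (intro image_eqI[of _ _ "comb (coord x) (initial n)"]) auto
    then show ?thesis
      by (rule bexI[rotated]) (use n in \<open>simp add: comb_carrier initial_subset\<close>)
  qed
  then show "p \<in> graph_closure H (operator_graph V D)"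
    unfolding xw graph_closure_iff using c by simp
qed

lemma single_valued_closure: "single_valued closure_graph"
  by (auto simp: single_valued_def closure_graph_def intro: coord_eqI)

text \<open>The pairs of a basis vector and its image lie in the graph and test every coordinate of
  an element of the adjoint. The other inclusion is Parseval with real eigenvalues, as for
  symmetry.\<close>

lemma graph_adjoint_closure: "graph_adjoint H closure_graph = closure_graph"
proof (rule Set.set_eqI, rule iffI)
  fix p assume p: "p \<in> graph_adjoint H closure_graph"
  obtain y z where yz: "p = (y, z)" by (cases p)
  have c: "y \<in> carrier H" "z \<in> carrier H"
    and adj: "\<And>u v. (u, v) \<in> closure_graph \<Longrightarrow> hinner H v y = hinner H u z"
    using p by (auto simp: graph_adjoint_def yz)
  have "coord z i = complex_of_real (lam i) * coord y i" if i: "i \<in> I" for i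
  proof -
    have "(e i, complex_of_real (lam i) \<odot> e i) \<in> closure_graph"
      using i by (auto simp: closure_graph_def basis_carrier coord_simps coord_basis)
    then have "complex_of_real (lam i) * hinner H (e i) y = hinner H (e i) z"
      using adj[of "e i" "complex_of_real (lam i) \<odot> e i"] c basis_carrier[OF i] by (simp add: hinner_smult)
    then have "cnj (complex_of_real (lam i) * hinner H (e i) y) = cnj (hinner H (e i) z)"
      by simp
    then show ?thesis
      using hinner_cnj[of "e i" y] hinner_cnj[of "e i" z] c basis_carrier[OF i] by (simp add: coord_def)
  qed
  then show "p \<in> closure_graph" using c by (simp add: closure_graph_def yz)
next
  fix p assume p: "p \<in> closure_graph"
  obtain y z where yz: "p = (y, z)" by (cases p)
  have c: "y \<in> carrier H" "z \<in> carrier H"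
    and z: "\<And>i. i \<in> I \<Longrightarrow> coord z i = complex_of_real (lam i) * coord y i"
    using p by (auto simp: closure_graph_def yz)
  have "hinner H v y = hinner H u z" if "(u, v) \<in> closure_graph" for u v
  proof (rule LIMSEQ_unique)
    have uv: "u \<in> carrier H" "v \<in> carrier H"
      and v: "\<And>i. i \<in> I \<Longrightarrow> coord v i = complex_of_real (lam i) * coord u i"
      using that by (auto simp: closure_graph_def)
    show "(\<lambda>n. \<Sum>i\<in>initial n. coord v i * cnj (coord y i)) \<longlonglongrightarrow> hinner H v y"
      by (rule hinner_expansion[OF uv(2) c(1)])
    have "(\<lambda>n. \<Sum>i\<in>initial n. coord u i * cnj (coord z i)) \<longlonglongrightarrow> hinner H u z"
      by (rule hinner_expansion[OF uv(1) c(2)])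
    also have "(\<lambda>n. \<Sum>i\<in>initial n. coord u i * cnj (coord z i)) =
        (\<lambda>n. \<Sum>i\<in>initial n. coord v i * cnj (coord y i))"
      by (intro ext sum.cong) (use v z initial_subset in \<open>auto simp: subset_iff\<close>)
    finally show "(\<lambda>n. \<Sum>i\<in>initial n. coord v i * cnj (coord y i)) \<longlonglongrightarrow> hinner H u z" .
  qed
  then show "p \<in> graph_adjoint H closure_graph"
    using c by (auto simp: graph_adjoint_def yz)
qed

lemma essentially_self_adjoint: "essentially_self_adjoint H V D"
  unfolding essentially_self_adjoint_def graph_closure_eq
  using linear_operator dense_subspace[OF subspace basis_in_domain] D_symmetric
    single_valued_closure graph_adjoint_closure by simp

section \<open>Unboundedness, resolvents and commutators of a diagonal operator\<close>

lemma D_basis: "i \<in> I \<Longrightarrow> D (e i) = complex_of_real (lam i) \<odot> e i"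
  by (rule coord_eqI) (use basis_in_domain closed basis_carrier in \<open>auto simp: coord_D coord_simps coord_basis\<close>)

lemma not_bounded:
  assumes "\<And>C. finite {i \<in> I. \<bar>lam i\<bar> \<le> C}" and "infinite I"
  shows "\<not> bounded_on H V D"
proof
  assume "bounded_on H V D"
  then obtain C where C: "\<And>x. x \<in> V \<Longrightarrow> hnorm H (D x) \<le> C * hnorm H x"
    by (auto simp: bounded_on_def)
  have "\<bar>lam i\<bar> \<le> C" if "i \<in> I" for i
    using C[OF basis_in_domain[OF that]] that
    by (simp add: D_basis hnorm_smult basis_carrier basis_norm)
  then have "I \<subseteq> {i \<in> I. \<bar>lam i\<bar> \<le> C}" by auto
  then show False using assms finite_subset by metis
qed

text \<open>The product form avoids dividing by \<open>lam i - z\<close>. The resolvent is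
  arbitrary, since compactness is demanded of every one of them.\<close>

lemma resolvent_coord:
  assumes R: "is_resolvent H closure_graph z R" and "y \<in> carrier H" "i \<in> I"
  shows "coord y i = (complex_of_real (lam i) - z) * coord (R y) i"
proof -
  have "R y \<in> carrier H"
    using R assms(2) by (auto simp: is_resolvent_def bounded_operators_def linear_operator_def)
  moreover have "(R y, y \<oplus> z \<odot> R y) \<in> closure_graph"
    using R assms(2) by (simp add: is_resolvent_def)
  ultimately have "coord (y \<oplus> z \<odot> R y) i = complex_of_real (lam i) * coord (R y) i"
    using assms(3) by (simp add: closure_graph_def)
  then show ?thesis
    using \<open>R y \<in> carrier H\<close> assms by (simp add: coord_simps algebra_simps)
qed

lemma resolvent_compact:
  assumes fin: "\<And>C. finite {i \<in> I. \<bar>lam i\<bar> \<le> C}" and R: "is_resolvent H closure_graph z R"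
  shows "compact_operator H R"
proof (rule compact_operatorI)
  show bR: "R \<in> bounded_operators H" using R by (simp add: is_resolvent_def)
  have Rc: "R h \<in> carrier H" if "h \<in> carrier H" for h
    using bR that by (auto simp: bounded_operators_def linear_operator_def)
  fix \<epsilon> :: real assume \<epsilon>: "\<epsilon> > 0"
  \<comment> \<open>Outside this finite set \<open>lam i\<close> has distance at least
    \<open>1 / \<epsilon>\<close> from \<open>z\<close>, so a coordinate of \<open>R h\<close> is at
    most \<open>\<epsilon>\<close> times that of \<open>h\<close>, and Bessel's inequality bounds
    the tail.\<close>
  let ?F = "{i \<in> I. \<bar>lam i\<bar> \<le> 1 / \<epsilon> + cmod z}"
  have "hnorm H (R h \<ominus> comb (coord (R h)) ?F) \<le> \<epsilon>" if h: "h \<in> carrier H" "hnorm H h \<le> 1" for h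
  proof -
    have c: "comb (coord (R h)) ?F \<in> carrier H" by (rule comb_carrier) auto
    have "(hnorm H (R h \<ominus> comb (coord (R h)) ?F))\<^sup>2 \<le> \<epsilon>\<^sup>2"
    proof (rule hnorm_sq_leI)
      show "R h \<ominus> comb (coord (R h)) ?F \<in> carrier H" using Rc h c by simp
      fix G assume G: "finite G" "G \<subseteq> I"
      have "(\<Sum>i\<in>G. (cmod (coord (R h \<ominus> comb (coord (R h)) ?F) i))\<^sup>2) \<le>
          (\<Sum>i\<in>G. \<epsilon>\<^sup>2 * (cmod (coord h i))\<^sup>2)"
      proof (rule sum_mono)
        fix i assume "i \<in> G"
        then have i: "i \<in> I" using G by auto
        have eq: "coord (R h \<ominus> comb (coord (R h)) ?F) i = (if i \<in> ?F then 0 else coord (R h) i)"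
          using i c Rc h fin by (simp add: coord_simps coord_comb)
        show "(cmod (coord (R h \<ominus> comb (coord (R h)) ?F) i))\<^sup>2 \<le> \<epsilon>\<^sup>2 * (cmod (coord h i))\<^sup>2"
        proof (cases "i \<in> ?F")
          case False
          then have "1 / \<epsilon> + cmod z < \<bar>lam i\<bar>" using i by simp
          moreover have "\<bar>lam i\<bar> - cmod z \<le> cmod (complex_of_real (lam i) - z)"
            by (metis norm_of_real norm_triangle_ineq2)
          ultimately have "1 / \<epsilon> \<le> cmod (complex_of_real (lam i) - z)" by linarith
          then have "1 / \<epsilon> * cmod (coord (R h) i) \<le> cmod (coord h i)"
            using mult_right_mono[of "1 / \<epsilon>" "cmod (complex_of_real (lam i) - z)" "cmod (coord (R h) i)"]
            by (simp add: resolvent_coord[OF R h(1) i] norm_mult)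
          then have "cmod (coord (R h) i) \<le> \<epsilon> * cmod (coord h i)"
            using \<epsilon> by (simp add: field_simps)
          then have "(cmod (coord (R h) i))\<^sup>2 \<le> (\<epsilon> * cmod (coord h i))\<^sup>2"
            by (rule power_mono) simp
          then show ?thesis using False by (simp add: eq power_mult_distrib)
        qed (simp add: eq)
      qed
      also have "\<dots> \<le> \<epsilon>\<^sup>2 * 1"
        unfolding sum_distrib_left[symmetric]
        using Bessel[OF G h(1)] h(1) power_mono[OF h(2), of 2] 
        by (intro mult_left_mono) auto
      finally show "(\<Sum>i\<in>G. (cmod (coord (R h \<ominus> comb (coord (R h)) ?F) i))\<^sup>2) \<le> \<epsilon>\<^sup>2" by simp
    qed
    then show ?thesis by (rule power2_le_imp_le) (use \<epsilon> in simp)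
  qed
  then show "\<exists>F. finite F \<and> F \<subseteq> I \<and>
      (\<forall>h\<in>carrier H. hnorm H h \<le> 1 \<longrightarrow> hnorm H (R h \<ominus> comb (coord (R h)) F) \<le> \<epsilon>)"
    using fin by (intro exI[of _ ?F]) auto
qed

text \<open>Real numbers have distance at least 1 from \<open>\<i>\<close>, so the factors
  \<open>r i\<close> are bounded by 1. Multiplying coordinates by them keeps them square-summable,
  and Riesz-Fischer supplies the vector.\<close>

lemma resolvent_exists: "\<exists>R. is_resolvent H closure_graph \<i> R"
proof -
  define r where "r i = 1 / (complex_of_real (lam i) - \<i>)" for i
  have ne: "complex_of_real (lam i) - \<i> \<noteq> 0" for i
    by (simp add: complex_eq_iff)
  have r: "cmod (r i) \<le> 1" for i
    using abs_Im_le_cmod[of "complex_of_real (lam i) - \<i>"] ne[of i]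
    by (simp add: r_def norm_divide divide_le_eq)
  have sq: "(\<Sum>i\<in>F. (cmod (r i * coord y i))\<^sup>2) \<le> (hnorm H y)\<^sup>2"
    if "finite F" "F \<subseteq> I" "y \<in> carrier H" for F y
  proof -
    have "(\<Sum>i\<in>F. (cmod (r i * coord y i))\<^sup>2) \<le> (\<Sum>i\<in>F. (cmod (coord y i))\<^sup>2)"
      by (intro sum_mono power_mono) (simp_all add: norm_mult r mult_left_le_one_le)
    then show ?thesis using Bessel that by fastforce
  qed
  \<comment> \<open>Coordinates determine a vector, so there is only one candidate; the linearity of
    \<open>R\<close> follows from the same uniqueness.\<close>
  define R where "R y = (SOME h. h \<in> carrier H \<and> (\<forall>i\<in>I. coord h i = r i * coord y i))" for y
  have "R y \<in> carrier H \<and> (\<forall>i\<in>I. coord (R y) i = r i * coord y i)" if y: "y \<in> carrier H" for y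
  proof -
    have "\<exists>h\<in>carrier H. \<forall>i\<in>I. coord h i = r i * coord y i"
      by (rule Riesz_Fischer) (rule sq[OF _ _ y])
    then show ?thesis unfolding R_def Bex_def by (rule someI_ex)
  qed
  then have R: "\<And>y. y \<in> carrier H \<Longrightarrow> R y \<in> carrier H"
      "\<And>y i. y \<in> carrier H \<Longrightarrow> i \<in> I \<Longrightarrow> coord (R y) i = r i * coord y i"
    by simp_all
  have "hnorm H (R y) \<le> 1 * hnorm H y" if y: "y \<in> carrier H" for y
  proof -
    have "(hnorm H (R y))\<^sup>2 \<le> (hnorm H y)\<^sup>2"
    proof (rule hnorm_sq_leI)
      fix F assume "finite F" "F \<subseteq> I"
      then show "(\<Sum>i\<in>F. (cmod (coord (R y) i))\<^sup>2) \<le> (hnorm H y)\<^sup>2"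
        using sq[of F y] y R(2)[OF y] by (simp add: subset_iff)
    qed (use R y in simp)
    then have "hnorm H (R y) \<le> hnorm H y" by (rule power2_le_imp_le) (use y in simp)
    then show ?thesis by simp
  qed
  then have "bounded_on H (carrier H) R" unfolding bounded_on_def by (intro exI[of _ 1]) simp
  moreover have "R (x \<oplus> y) = R x \<oplus> R y" if "x \<in> carrier H" "y \<in> carrier H" for x y
    by (rule coord_eqI) (use that R in \<open>simp_all add: coord_simps algebra_simps\<close>)
  moreover have "R (c \<odot> x) = c \<odot> R x" if "x \<in> carrier H" for c x
    by (rule coord_eqI) (use that R in \<open>simp_all add: coord_simps\<close>)
  ultimately have "R \<in> bounded_operators H"
    using R by (simp add: bounded_operators_def linear_operator_def linear_subspace_def)
  moreover have "R (w \<ominus> \<i> \<odot> x) = x" if "(x, w) \<in> closure_graph" for x w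
  proof (rule coord_eqI)
    have xw: "x \<in> carrier H" "w \<in> carrier H"
      "\<And>i. i \<in> I \<Longrightarrow> coord w i = complex_of_real (lam i) * coord x i"
      using that by (auto simp: closure_graph_def)
    show "R (w \<ominus> \<i> \<odot> x) \<in> carrier H" "x \<in> carrier H" using R xw by simp_all
    fix i assume i: "i \<in> I"
    have "coord (R (w \<ominus> \<i> \<odot> x)) i = r i * ((complex_of_real (lam i) - \<i>) * coord x i)"
      using i xw by (simp add: R coord_simps left_diff_distrib)
    then show "coord (R (w \<ominus> \<i> \<odot> x)) i = coord x i"
      using ne by (simp add: r_def)
  qed
  moreover have "(R y, y \<oplus> \<i> \<odot> R y) \<in> closure_graph" if y: "y \<in> carrier H" for y
  proof -
    have "coord (y \<oplus> \<i> \<odot> R y) i = complex_of_real (lam i) * coord (R y) i" if i: "i \<in> I" for i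
    proof -
      have "coord y i = (complex_of_real (lam i) - \<i>) * coord (R y) i"
        using ne[of i] i y by (simp add: R r_def)
      then show ?thesis using i y R by (simp add: coord_simps algebra_simps)
    qed
    then show ?thesis using y R by (simp add: closure_graph_def)
  qed
  ultimately have "is_resolvent H closure_graph \<i> R"
    unfolding is_resolvent_def by (simp add: split_beta)
  then show ?thesis by (rule exI[of _ R])
qed

lemma compact_resolvent:
  assumes "\<And>C. finite {i \<in> I. \<bar>lam i\<bar> \<le> C}"
  shows "has_compact_resolvent H V D"
  unfolding has_compact_resolvent_def graph_closure_eq
  using resolvent_exists resolvent_compact[OF assms] by (intro conjI exI[of _ \<i>] allI impI)

text \<open>Pairing the commutator at \<open>h\<close> with \<open>e i\<close> gives the inner
  product of \<open>h\<close> with \<open>lam i\<close> times \<open>T' (e i)\<close> minus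
  \<open>D (T' (e i))\<close>, and this vanishes when \<open>e i\<close> is an eigenvector of the
  adjoint \<open>T'\<close>. Only the coordinates in \<open>F\<close> survive, so the commutator is
  the restriction of an operator of finite rank.\<close>

lemma bounded_commutator:
  assumes T: "T \<in> bounded_operators H"
    and T': "\<And>h. h \<in> carrier H \<Longrightarrow> T' h \<in> carrier H"
    and adj: "\<And>g h. \<lbrakk>g \<in> carrier H; h \<in> carrier H\<rbrakk> \<Longrightarrow> hinner H (T g) h = hinner H g (T' h)"
    and TV: "\<And>i. i \<in> I \<Longrightarrow> T (e i) \<in> V"
    and F: "finite F" "F \<subseteq> I"
    and diag: "\<And>i. i \<in> I - F \<Longrightarrow> T' (e i) = m i \<odot> e i"
    and TF: "\<And>i. i \<in> F \<Longrightarrow> T' (e i) \<in> V"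
  shows "commutator_extends_bounded H V D T"
  unfolding commutator_extends_bounded_def
proof
  have Tc: "\<And>h. h \<in> carrier H \<Longrightarrow> T h \<in> carrier H"
    and Tadd: "\<And>x y. \<lbrakk>x \<in> carrier H; y \<in> carrier H\<rbrakk> \<Longrightarrow> T (x \<oplus> y) = T x \<oplus> T y"
    and Tsm: "\<And>c x. x \<in> carrier H \<Longrightarrow> T (c \<odot> x) = c \<odot> T x"
    using T by (auto simp: bounded_operators_def linear_operator_def)
  have V0: "\<zero> \<in> V" and Vadd: "\<And>x y. \<lbrakk>x \<in> V; y \<in> V\<rbrakk> \<Longrightarrow> x \<oplus> y \<in> V"
    and Vsm: "\<And>c x. x \<in> V \<Longrightarrow> c \<odot> x \<in> V"
    using subspace by (auto simp: linear_subspace_def)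
  have "T \<zero> = 0 \<odot> T \<zero>" using Tsm[of \<zero> 0] smult_l_null[of \<zero>] by simp
  then have T0: "T \<zero> = \<zero>" using smult_l_null[OF Tc[OF M.zero_closed]] by simp
  have "linear_subspace H (commutator_domain V T)"
    unfolding linear_subspace_def commutator_domain_def
    using V0 Vadd Vsm T0 Tadd Tsm domain_carrier by (auto simp: subset_iff)
  then show "dense_in H (commutator_domain V T)"
    by (rule dense_subspace) (simp add: commutator_domain_def basis_in_domain TV)
  \<comment> \<open>The vector \<open>w i\<close> represents coordinate \<open>i\<close> of the
    commutator as a functional of \<open>h\<close>. It makes sense because \<open>T' (e i)\<close>
    lies in the domain for \<open>i\<close> in \<open>F\<close>.\<close>
  define w where "w i = complex_of_real (lam i) \<odot> T' (e i) \<ominus> D (T' (e i))" for i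
  have wc: "w i \<in> carrier H" if "i \<in> F" for i
    using that F T' basis_carrier TF closed by (auto simp: w_def subset_iff)
  define B where "B h = comb (\<lambda>i. hinner H h (w i)) F" for h
  have Bc: "B h \<in> carrier H" for h using F by (simp add: B_def comb_carrier)
  have cB: "coord (B h) i = (if i \<in> F then hinner H h (w i) else 0)" if "i \<in> I" for h i
    using that F by (simp add: B_def coord_comb)
  have "B (x \<oplus> y) = B x \<oplus> B y" if "x \<in> carrier H" "y \<in> carrier H" for x y
    by (rule coord_eqI) (use that Bc wc in \<open>simp_all add: coord_simps cB hinner_add\<close>)
  moreover have "B (c \<odot> x) = c \<odot> B x" if "x \<in> carrier H" for c x
    by (rule coord_eqI) (use that Bc wc in \<open>simp_all add: coord_simps cB hinner_smult\<close>)
  moreover have "hnorm H (B h) \<le> (\<Sum>i\<in>F. hnorm H (w i)) * hnorm H h" if h: "h \<in> carrier H" for h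
  proof -
    have "hnorm H (B h) \<le> (\<Sum>i\<in>F. cmod (hinner H h (w i)))"
      unfolding B_def by (rule hnorm_comb_le[OF F(2)])
    also have "\<dots> \<le> (\<Sum>i\<in>F. hnorm H h * hnorm H (w i))"
      by (intro sum_mono Cauchy_Schwarz h wc)
    finally show ?thesis by (simp add: sum_distrib_left mult.commute)
  qed
  then have "bounded_on H (carrier H) B"
    unfolding bounded_on_def by (intro exI[of _ "\<Sum>i\<in>F. hnorm H (w i)"]) simp
  ultimately have "B \<in> bounded_operators H"
    using Bc by (simp add: bounded_operators_def linear_operator_def linear_subspace_def)
  moreover have "B h = D (T h) \<ominus> T (D h)" if h: "h \<in> commutator_domain V T" for h
  proof (rule coord_eqI)
    have hV: "h \<in> V" "T h \<in> V" using h by (auto simp: commutator_domain_def)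
    then have hc: "h \<in> carrier H" "D h \<in> carrier H" "D (T h) \<in> carrier H" "T (D h) \<in> carrier H"
      using domain_carrier closed Tc by auto
    then show "D (T h) \<ominus> T (D h) \<in> carrier H" by simp
    fix i assume i: "i \<in> I"
    note ei = basis_carrier[OF i]
    have eq: "coord (D (T h) \<ominus> T (D h)) i =
        complex_of_real (lam i) * hinner H h (T' (e i)) - hinner H (D h) (T' (e i))"
      using i ei hV hc by (simp add: coord_simps coord_D) (simp add: coord_def adj)
    show "coord (B h) i = coord (D (T h) \<ominus> T (D h)) i"
    proof (cases "i \<in> F")
      case True
      have "hinner H (D h) (T' (e i)) = hinner H h (D (T' (e i)))"
        by (rule D_symmetric[OF hV(1) TF[OF True]])
      then show ?thesis
        unfolding eq using True i hc T'[OF ei] closed[OF TF[OF True]]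
        by (simp add: cB w_def hinner_diff_right hinner_smult_right)
    next
      case False
      have "hinner H (D h) (e i) = complex_of_real (lam i) * hinner H h (e i)"
        using coord_D[OF hV(1) i] by (simp add: coord_def)
      then show ?thesis
        unfolding eq using False i hc ei by (simp add: cB diag hinner_smult_right)
    qed
  qed (rule Bc)
  ultimately show "\<exists>B\<in>bounded_operators H. \<forall>h\<in>commutator_domain V T. B h = D (T h) \<ominus> T (D h)"
    by (intro bexI[of _ B]) auto
qed

end

section \<open>The space of square-integrable functions\<close>

lemma borel_measurable_cnj [measurable (raw)]:
  "f \<in> borel_measurable M \<Longrightarrow> (\<lambda>x. cnj (f x)) \<in> borel_measurable M"
  by (rule measurable_compose[of f M borel cnj])
    (auto intro!: borel_measurable_continuous_onI continuous_intros)

lemma L2_functions_measurable [measurable_dest]: "f \<in> L2_functions M \<Longrightarrow> f \<in> borel_measurable M"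
  by (simp add: L2_functions_def)

lemma L2_functions_integrable_sq: "f \<in> L2_functions M \<Longrightarrow> integrable M (\<lambda>x. (cmod (f x))\<^sup>2)"
  by (simp add: L2_functions_def)

lemma L2_functions_integrable_mult:
  assumes "f \<in> L2_functions M" "g \<in> L2_functions M"
  shows "integrable M (\<lambda>x. f x * cnj (g x))"
proof (rule Bochner_Integration.integrable_bound)
  show "integrable M (\<lambda>x. (cmod (f x))\<^sup>2 + (cmod (g x))\<^sup>2)"
    using assms by (intro Bochner_Integration.integrable_add L2_functions_integrable_sq)
  show "(\<lambda>x. f x * cnj (g x)) \<in> borel_measurable M"
    using assms by measurable
  have "a * b \<le> a\<^sup>2 + b\<^sup>2" if "a \<ge> 0" "b \<ge> 0" for a b :: real
    using sum_squares_bound[of a b] mult_nonneg_nonneg[OF that] by linarith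
  then show "AE x in M. norm (f x * cnj (g x)) \<le> norm ((cmod (f x))\<^sup>2 + (cmod (g x))\<^sup>2)"
    by (simp add: norm_mult)
qed

lemma L2_functions_add:
  assumes "f \<in> L2_functions M" "g \<in> L2_functions M"
  shows "(\<lambda>x. f x + g x) \<in> L2_functions M"
proof -
  have "integrable M (\<lambda>x. (cmod (f x + g x))\<^sup>2)"
  proof (rule Bochner_Integration.integrable_bound)
    show "integrable M (\<lambda>x. 2 * (cmod (f x))\<^sup>2 + 2 * (cmod (g x))\<^sup>2)"
      using assms by (intro Bochner_Integration.integrable_add integrable_mult_right L2_functions_integrable_sq)
    show "(\<lambda>x. (cmod (f x + g x))\<^sup>2) \<in> borel_measurable M"
      using assms by measurable
    have "(cmod (a + b))\<^sup>2 \<le> 2 * (cmod a)\<^sup>2 + 2 * (cmod b)\<^sup>2" for a b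
    proof -
      have "(cmod (a + b))\<^sup>2 \<le> (cmod a + cmod b)\<^sup>2"
        by (intro power_mono norm_triangle_ineq) simp
      also have "\<dots> \<le> 2 * (cmod a)\<^sup>2 + 2 * (cmod b)\<^sup>2"
        using sum_squares_bound[of "cmod a" "cmod b"] by (simp add: power2_sum)
      finally show ?thesis .
    qed
    then show "AE x in M. norm ((cmod (f x + g x))\<^sup>2) \<le> norm (2 * (cmod (f x))\<^sup>2 + 2 * (cmod (g x))\<^sup>2)"
      by simp
  qed
  then show ?thesis using assms by (simp add: L2_functions_def borel_measurable_add)
qed

lemma L2_functions_mult:
  assumes f: "f \<in> L2_functions M" and a: "a \<in> borel_measurable M" "\<And>x. x \<in> space M \<Longrightarrow> cmod (a x) \<le> C"
  shows "(\<lambda>x. a x * f x) \<in> L2_functions M"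
proof -
  have "integrable M (\<lambda>x. (cmod (a x * f x))\<^sup>2)"
  proof (rule Bochner_Integration.integrable_bound)
    show "integrable M (\<lambda>x. C\<^sup>2 * (cmod (f x))\<^sup>2)"
      using f by (intro integrable_mult_right L2_functions_integrable_sq)
    show "(\<lambda>x. (cmod (a x * f x))\<^sup>2) \<in> borel_measurable M"
      using f a(1) by measurable
    have "(cmod (a x * f x))\<^sup>2 \<le> C\<^sup>2 * (cmod (f x))\<^sup>2" if "x \<in> space M" for x
      using a(2)[OF that] by (simp add: norm_mult power_mult_distrib mult_right_mono power_mono)
    then show "AE x in M. norm ((cmod (a x * f x))\<^sup>2) \<le> norm (C\<^sup>2 * (cmod (f x))\<^sup>2)"
      by simp
  qed
  then show ?thesis using f a(1) by (simp add: L2_functions_def borel_measurable_times)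
qed

lemma L2_functions_smult: "f \<in> L2_functions M \<Longrightarrow> (\<lambda>x. c * f x) \<in> L2_functions M"
  by (rule L2_functions_mult[where C = "cmod c"]) auto

lemma L2_functions_zero [simp]: "(\<lambda>_. 0) \<in> L2_functions M"
  by (simp add: L2_functions_def)

lemma L2_functions_diff:
  assumes "f \<in> L2_functions M" "g \<in> L2_functions M"
  shows "(\<lambda>x. f x - g x) \<in> L2_functions M"
  using L2_functions_add[OF assms(1) L2_functions_smult[OF assms(2), of "- 1"]] by simp

lemma L2_functions_sum:
  "(\<And>i. i \<in> F \<Longrightarrow> f i \<in> L2_functions M) \<Longrightarrow> (\<lambda>x. \<Sum>i\<in>F. f i x) \<in> L2_functions M"
  by (induction F rule: infinite_finite_induct) (auto intro: L2_functions_add)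

lemma (in finite_measure) L2_functions_bounded:
  assumes f: "f \<in> borel_measurable M" "\<And>x. x \<in> space M \<Longrightarrow> cmod (f x) \<le> C"
  shows "f \<in> L2_functions M"
proof -
  have "(\<lambda>_. 1) \<in> L2_functions M" by (simp add: L2_functions_def)
  from L2_functions_mult[OF this f] show ?thesis by simp
qed

lemma (in finite_measure) L2_functions_integrable:
  assumes "f \<in> L2_functions M"
  shows "integrable M f"
proof -
  have "(\<lambda>_. 1) \<in> L2_functions M" by (simp add: L2_functions_def)
  from L2_functions_integrable_mult[OF assms this] show ?thesis by simp
qed

section \<open>Classes of functions that agree almost everywhere\<close>

lemma equiv_ae_eq: "equiv (L2_functions M) (ae_eq_rel M)"
proof (rule equivI)
  show "ae_eq_rel M \<subseteq> L2_functions M \<times> L2_functions M" by (auto simp: ae_eq_rel_def)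
  show "refl_on (L2_functions M) (ae_eq_rel M)" by (auto simp: refl_on_def ae_eq_rel_def)
  show "sym (ae_eq_rel M)" by (auto simp: sym_def ae_eq_rel_def)
  show "trans (ae_eq_rel M)"
  proof (rule transI)
    fix f g h assume fgh: "(f, g) \<in> ae_eq_rel M" "(g, h) \<in> ae_eq_rel M"
    then have "AE x in M. f x = g x" "AE x in M. g x = h x" by (auto simp: ae_eq_rel_def)
    then have "AE x in M. f x = h x" by eventually_elim simp
    then show "(f, h) \<in> ae_eq_rel M" using fgh by (auto simp: ae_eq_rel_def)
  qed
qed

lemma L2_class_carrier: "f \<in> L2_functions M \<Longrightarrow> L2_class M f \<in> carrier (L2 M)"
  by (simp add: L2_def L2_class_def quotientI)

lemma L2_class_eq_iff:
  assumes "f \<in> L2_functions M" "g \<in> L2_functions M"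
  shows "L2_class M f = L2_class M g \<longleftrightarrow> (AE x in M. f x = g x)"
  using eq_equiv_class_iff[OF equiv_ae_eq assms] assms by (auto simp: L2_class_def ae_eq_rel_def)

lemma L2_rep_in: "F \<in> carrier (L2 M) \<Longrightarrow> L2_rep F \<in> F"
proof -
  assume "F \<in> carrier (L2 M)"
  then obtain f where "f \<in> L2_functions M" "F = ae_eq_rel M `` {f}"
    by (auto simp: L2_def elim: quotientE)
  then have "f \<in> F" by (simp add: ae_eq_rel_def)
  then show ?thesis unfolding L2_rep_def by (rule someI[of "\<lambda>f. f \<in> F"])
qed

lemma L2_rep_L2_functions: "F \<in> carrier (L2 M) \<Longrightarrow> L2_rep F \<in> L2_functions M"
  using L2_rep_in[of F M] in_quotient_imp_subset[OF equiv_ae_eq, of F M] by (auto simp: L2_def)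

lemma L2_class_rep: "F \<in> carrier (L2 M) \<Longrightarrow> L2_class M (L2_rep F) = F"
proof -
  assume F: "F \<in> carrier (L2 M)"
  then obtain f where f: "f \<in> L2_functions M" "F = L2_class M f"
    by (auto simp: L2_def L2_class_def elim: quotientE)
  have "(f, L2_rep F) \<in> ae_eq_rel M"
    using L2_rep_in[OF F] f by (simp add: L2_class_def)
  then have "L2_class M f = L2_class M (L2_rep F)"
    unfolding L2_class_def by (rule equiv_class_eq[OF equiv_ae_eq])
  with f show ?thesis by simp
qed

lemma L2_carrierE:
  assumes "F \<in> carrier (L2 M)"
  obtains f where "f \<in> L2_functions M" "F = L2_class M f"
  using L2_rep_L2_functions[OF assms] L2_class_rep[OF assms] by metis

text \<open>The Hilbert space operations are defined through the choice \<open>L2_rep\<close>. Its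
  agreement almost everywhere with any other representative lets the rules for sums, multiples and
  inner products refer to arbitrary representatives.\<close>

lemma L2_rep_class:
  assumes "f \<in> L2_functions M"
  shows "AE x in M. L2_rep (L2_class M f) x = f x"
  using L2_class_eq_iff[OF L2_rep_L2_functions[OF L2_class_carrier[OF assms]] assms]
    L2_class_rep[OF L2_class_carrier[OF assms]] by simp

lemma L2_zero: "\<zero>\<^bsub>L2 M\<^esub> = L2_class M (\<lambda>_. 0)"
  by (simp add: L2_def)

lemma L2_add:
  assumes f: "f \<in> L2_functions M" and g: "g \<in> L2_functions M"
  shows "L2_class M f \<oplus>\<^bsub>L2 M\<^esub> L2_class M g = L2_class M (\<lambda>x. f x + g x)"
proof -
  have "AE x in M. L2_rep (L2_class M f) x + L2_rep (L2_class M g) x = f x + g x"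
    using L2_rep_class[OF f] L2_rep_class[OF g] by eventually_elim simp
  moreover have "L2_rep (L2_class M f) \<in> L2_functions M" "L2_rep (L2_class M g) \<in> L2_functions M"
    by (simp_all add: L2_rep_L2_functions L2_class_carrier f g)
  ultimately show ?thesis
    using f g by (simp add: L2_def L2_class_eq_iff L2_functions_add)
qed

text \<open>The common core of scalar multiplication, where \<open>a\<close> is constant, and of the
  multiplication representation.\<close>

lemma L2_class_mult:
  assumes f: "f \<in> L2_functions M" and a: "a \<in> borel_measurable M" "\<And>x. x \<in> space M \<Longrightarrow> cmod (a x) \<le> C"
  shows "L2_class M (\<lambda>x. a x * L2_rep (L2_class M f) x) = L2_class M (\<lambda>x. a x * f x)"
proof -
  have "L2_rep (L2_class M f) \<in> L2_functions M"
    by (simp add: L2_rep_L2_functions L2_class_carrier f)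
  moreover have "AE x in M. a x * L2_rep (L2_class M f) x = a x * f x"
    using L2_rep_class[OF f] by eventually_elim simp
  ultimately show ?thesis
    using L2_functions_mult[OF _ a] f by (simp add: L2_class_eq_iff)
qed

lemma L2_smult:
  assumes f: "f \<in> L2_functions M"
  shows "c \<odot>\<^bsub>L2 M\<^esub> L2_class M f = L2_class M (\<lambda>x. c * f x)"
  using L2_class_mult[OF f, of "\<lambda>_. c" "cmod c"] by (simp add: L2_def)

lemma L2_hinner:
  assumes f: "f \<in> L2_functions M" and g: "g \<in> L2_functions M"
  shows "hinner (L2 M) (L2_class M f) (L2_class M g) = (\<integral>x. f x * cnj (g x) \<partial>M)"
proof -
  have [measurable]: "f \<in> borel_measurable M" "g \<in> borel_measurable M"
      "L2_rep (L2_class M f) \<in> borel_measurable M" "L2_rep (L2_class M g) \<in> borel_measurable M"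
    using f g by (auto intro: L2_functions_measurable L2_rep_L2_functions L2_class_carrier)
  have "AE x in M. L2_rep (L2_class M f) x * cnj (L2_rep (L2_class M g) x) = f x * cnj (g x)"
    using L2_rep_class[OF f] L2_rep_class[OF g] by eventually_elim simp
  then show ?thesis
    by (simp add: L2_def) (intro integral_cong_AE; measurable)
qed

lemma L2_module: "module complex_ring (L2 M)"
proof (rule moduleI)
  show "cring complex_ring" by (rule cring_from_type_algebra)
  show "abelian_group (L2 M)"
  proof (rule abelian_groupI)
    show "x \<oplus>\<^bsub>L2 M\<^esub> y \<in> carrier (L2 M)" if "x \<in> carrier (L2 M)" "y \<in> carrier (L2 M)" for x y
      using that by (elim L2_carrierE) (simp add: L2_add L2_class_carrier L2_functions_add)
    show "\<zero>\<^bsub>L2 M\<^esub> \<in> carrier (L2 M)" by (simp add: L2_zero L2_class_carrier)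
    show "x \<oplus>\<^bsub>L2 M\<^esub> y \<oplus>\<^bsub>L2 M\<^esub> z = x \<oplus>\<^bsub>L2 M\<^esub> (y \<oplus>\<^bsub>L2 M\<^esub> z)"
      if "x \<in> carrier (L2 M)" "y \<in> carrier (L2 M)" "z \<in> carrier (L2 M)" for x y z
      using that by (elim L2_carrierE) (simp add: L2_add L2_functions_add add.assoc)
    show "x \<oplus>\<^bsub>L2 M\<^esub> y = y \<oplus>\<^bsub>L2 M\<^esub> x" if "x \<in> carrier (L2 M)" "y \<in> carrier (L2 M)" for x y
      using that by (elim L2_carrierE) (simp add: L2_add add.commute)
    show "\<zero>\<^bsub>L2 M\<^esub> \<oplus>\<^bsub>L2 M\<^esub> x = x" if "x \<in> carrier (L2 M)" for x
      using that by (elim L2_carrierE) (simp add: L2_zero L2_add)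
    show "\<exists>y\<in>carrier (L2 M). y \<oplus>\<^bsub>L2 M\<^esub> x = \<zero>\<^bsub>L2 M\<^esub>" if x: "x \<in> carrier (L2 M)" for x
    proof -
      obtain f where f: "f \<in> L2_functions M" "x = L2_class M f" using x by (rule L2_carrierE)
      have g: "(\<lambda>x. - 1 * f x) \<in> L2_functions M" using f(1) by (rule L2_functions_smult)
      show ?thesis
        by (rule bexI[of _ "L2_class M (\<lambda>x. - 1 * f x)"])
          (use f g in \<open>simp_all add: L2_add L2_zero L2_class_carrier\<close>)
    qed
  qed
  show "a \<odot>\<^bsub>L2 M\<^esub> x \<in> carrier (L2 M)" if "x \<in> carrier (L2 M)" for a x
    using that by (elim L2_carrierE) (simp add: L2_smult L2_class_carrier L2_functions_smult)
  show "(a \<oplus>\<^bsub>complex_ring\<^esub> b) \<odot>\<^bsub>L2 M\<^esub> x = a \<odot>\<^bsub>L2 M\<^esub> x \<oplus>\<^bsub>L2 M\<^esub> b \<odot>\<^bsub>L2 M\<^esub> x"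
    if "x \<in> carrier (L2 M)" for a b x
    using that by (elim L2_carrierE) (simp add: L2_smult L2_add L2_functions_smult distrib_right)
  show "a \<odot>\<^bsub>L2 M\<^esub> (x \<oplus>\<^bsub>L2 M\<^esub> y) = a \<odot>\<^bsub>L2 M\<^esub> x \<oplus>\<^bsub>L2 M\<^esub> a \<odot>\<^bsub>L2 M\<^esub> y"
    if "x \<in> carrier (L2 M)" "y \<in> carrier (L2 M)" for a x y
    using that
    by (elim L2_carrierE) (simp add: L2_smult L2_add L2_functions_smult L2_functions_add distrib_left)
  show "(a \<otimes>\<^bsub>complex_ring\<^esub> b) \<odot>\<^bsub>L2 M\<^esub> x = a \<odot>\<^bsub>L2 M\<^esub> (b \<odot>\<^bsub>L2 M\<^esub> x)"
    if "x \<in> carrier (L2 M)" for a b x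
    using that by (elim L2_carrierE) (simp add: L2_smult L2_functions_smult mult.assoc)
  show "\<one>\<^bsub>complex_ring\<^esub> \<odot>\<^bsub>L2 M\<^esub> x = x" if "x \<in> carrier (L2 M)" for x
    using that by (elim L2_carrierE) (simp add: L2_smult)
qed

lemma L2_diff:
  assumes f: "f \<in> L2_functions M" and g: "g \<in> L2_functions M"
  shows "L2_class M f \<ominus>\<^bsub>L2 M\<^esub> L2_class M g = L2_class M (\<lambda>x. f x - g x)"
proof -
  interpret module complex_ring "L2 M" by (rule L2_module)
  have "\<ominus>\<^bsub>L2 M\<^esub> L2_class M g = L2_class M (\<lambda>x. - 1 * g x)"
    by (rule M.minus_equality)
      (use L2_functions_smult[OF g, of "- 1"] g in \<open>simp_all add: L2_add L2_zero L2_class_carrier\<close>)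
  then show ?thesis
    using L2_add[OF f L2_functions_smult[OF g, of "- 1"]] by (simp add: a_minus_def)
qed

lemma L2_hnorm_sq:
  assumes f: "f \<in> L2_functions M"
  shows "(hnorm (L2 M) (L2_class M f))\<^sup>2 = (\<integral>x. (cmod (f x))\<^sup>2 \<partial>M)"
    and "hnorm (L2 M) (L2_class M f) \<ge> 0"
proof -
  have "hinner (L2 M) (L2_class M f) (L2_class M f) = (\<integral>x. complex_of_real ((cmod (f x))\<^sup>2) \<partial>M)"
    by (simp add: L2_hinner f complex_norm_square del: of_real_power)
  also have "\<dots> = complex_of_real (\<integral>x. (cmod (f x))\<^sup>2 \<partial>M)"
    by (rule integral_complex_of_real)
  finally show "(hnorm (L2 M) (L2_class M f))\<^sup>2 = (\<integral>x. (cmod (f x))\<^sup>2 \<partial>M)"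
    "hnorm (L2 M) (L2_class M f) \<ge> 0"
    by (simp_all add: hnorm_def)
qed

text \<open>The elementary bound \<open>u \<le> 2\<^sup>-\<^sup>k + 2\<^sup>k u\<^sup>2\<close> turns square-integrable increments that decay
  like \<open>4\<^sup>-\<^sup>k\<close> into a pointwise summable series, so that Minkowski's inequality for series is
  not needed.\<close>

lemma AE_convergent_of_fast_Cauchy:
  fixes f :: "nat \<Rightarrow> 'x \<Rightarrow> complex"
  assumes f: "\<And>k. f k \<in> L2_functions M"
    and fast: "\<And>k. (\<integral>x. (cmod (f (Suc k) x - f k x))\<^sup>2 \<partial>M) \<le> (1 / 4) ^ k"
  shows "AE x in M. convergent (\<lambda>k. f k x)"
proof -
  have [measurable]: "f k \<in> borel_measurable M" for k using f by (rule L2_functions_measurable)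
  define u where "u k x = 2 ^ k * (cmod (f (Suc k) x - f k x))\<^sup>2" for k x
  have [measurable]: "u k \<in> borel_measurable M" for k unfolding u_def by measurable
  have int: "(\<integral>\<^sup>+x. ennreal (u k x) \<partial>M) \<le> ennreal ((1 / 2) ^ k)" for k
  proof -
    have "integrable M (\<lambda>x. (cmod (f (Suc k) x - f k x))\<^sup>2)"
      by (rule L2_functions_integrable_sq) (intro L2_functions_diff f)
    then have "integrable M (u k)" unfolding u_def by (rule integrable_mult_right)
    then have "(\<integral>\<^sup>+x. ennreal (u k x) \<partial>M) = ennreal (\<integral>x. u k x \<partial>M)"
      by (rule nn_integral_eq_integral) (simp add: u_def)
    also have "(\<integral>x. u k x \<partial>M) \<le> 2 ^ k * (1 / 4) ^ k"
      unfolding u_def using fast[of k] by simp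
    also have "(2::real) ^ k * (1 / 4) ^ k = (1 / 2) ^ k"
      by (simp flip: power_mult_distrib)
    finally show ?thesis by (simp add: ennreal_leI)
  qed
  have "(\<integral>\<^sup>+x. (\<Sum>k. ennreal (u k x)) \<partial>M) = (\<Sum>k. \<integral>\<^sup>+x. ennreal (u k x) \<partial>M)"
    by (rule nn_integral_suminf) simp
  also have "\<dots> \<le> (\<Sum>k. ennreal ((1 / 2) ^ k))"
    by (intro suminf_le int) auto
  also have "\<dots> = ennreal (\<Sum>k. (1 / 2) ^ k)"
    by (rule suminf_ennreal2) (auto simp: summable_geometric)
  also have "\<dots> < \<infinity>" by simp
  finally have "AE x in M. (\<Sum>k. ennreal (u k x)) \<noteq> \<infinity>"
    by (intro nn_integral_noteq_infinite) auto
  then show ?thesis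
  proof eventually_elim
    case (elim x)
    then have "summable (\<lambda>k. u k x)"
      by (intro summable_suminf_not_top) (auto simp: u_def)
    then have sum: "summable (\<lambda>k. (1 / 2) ^ k + u k x)"
      by (intro summable_add) (auto simp: summable_geometric)
    have "cmod (f (Suc k) x - f k x) \<le> (1 / 2) ^ k + u k x" for k
    proof (cases "cmod (f (Suc k) x - f k x) \<le> (1 / 2) ^ k")
      case True
      then show ?thesis by (simp add: u_def add_increasing2)
    next
      case False
      let ?t = "cmod (f (Suc k) x - f k x)"
      have "1 \<le> 2 ^ k * ?t"
        using False mult_left_mono[of "(1 / 2) ^ k" ?t "2 ^ k"] by (simp add: power_one_over)
      then have "?t * 1 \<le> ?t * (2 ^ k * ?t)" by (intro mult_left_mono) auto
      then have "?t \<le> u k x" by (simp add: u_def power2_eq_square mult_ac)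
      then show ?thesis by (simp add: add_increasing)
    qed
    then have "summable (\<lambda>k. f (Suc k) x - f k x)"
      by (intro summable_comparison_test'[OF sum, of 0]) simp
    then have "convergent (\<lambda>n. (\<Sum>k<n. f (Suc k) x - f k x) + f 0 x)"
      by (intro convergent_add) (auto simp: summable_iff_convergent convergent_const)
    then show ?case using sum_lessThan_telescope[of "\<lambda>k. f k x"] by simp
  qed
qed

section \<open>Completeness of the space of square-integrable functions\<close>

lemma L2_hdist:
  assumes f: "f \<in> L2_functions M" and g: "g \<in> L2_functions M"
  shows "(hdist (L2 M) (L2_class M f) (L2_class M g))\<^sup>2 = (\<integral>x. (cmod (f x - g x))\<^sup>2 \<partial>M)"
  using f g by (simp add: hdist_def L2_class_carrier L2_diff L2_hnorm_sq L2_functions_diff)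

text \<open>A subsequence with quickly decaying increments converges almost everywhere, and Fatou's
  lemma along it bounds the distance of every late \<open>f n\<close> from the limit.\<close>

lemma L2_Cauchy_limit:
  fixes f :: "nat \<Rightarrow> 'x \<Rightarrow> complex"
  assumes f: "\<And>n. f n \<in> L2_functions M"
    and Cauchy: "\<And>\<epsilon>. \<epsilon> > 0 \<Longrightarrow> \<exists>N. \<forall>m\<ge>N. \<forall>n\<ge>N. (\<integral>x. (cmod (f m x - f n x))\<^sup>2 \<partial>M) \<le> \<epsilon>"
  obtains g where "g \<in> L2_functions M" "(\<lambda>n. \<integral>x. (cmod (f n x - g x))\<^sup>2 \<partial>M) \<longlonglongrightarrow> 0"
proof -
  have [measurable]: "f k \<in> borel_measurable M" for k using f by (rule L2_functions_measurable)
  obtain N where N: "\<And>\<epsilon> m n. \<lbrakk>\<epsilon> > 0; m \<ge> N \<epsilon>; n \<ge> N \<epsilon>\<rbrakk> \<Longrightarrow> (\<integral>x. (cmod (f m x - f n x))\<^sup>2 \<partial>M) \<le> \<epsilon>"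
    using Cauchy by metis
  \<comment> \<open>The sum puts \<open>r k\<close> beyond the threshold for
    \<open>(1 / 4) ^ k\<close> and never decreases; the added \<open>k\<close> makes
    \<open>r\<close> strictly increasing and at least \<open>k\<close>.\<close>
  define r where "r k = (\<Sum>j\<le>k. N ((1 / 4) ^ j)) + k" for k
  have r_mono: "r k < r (Suc k)" for k by (simp add: r_def)
  have r_ge: "r k \<ge> N ((1 / 4) ^ k)" for k
    by (simp add: r_def) (metis atMost_iff finite_atMost le_refl member_le_sum trans_le_add1 zero_le)
  have r_ge_k: "r k \<ge> k" for k by (simp add: r_def)
  have "(\<integral>x. (cmod (f (r (Suc k)) x - f (r k) x))\<^sup>2 \<partial>M) \<le> (1 / 4) ^ k" for k
    using r_ge[of k] r_mono[of k] by (intro N) auto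
  then have conv: "AE x in M. convergent (\<lambda>k. f (r k) x)"
    using AE_convergent_of_fast_Cauchy[of "\<lambda>k. f (r k)" M] f by simp
  define g where "g x = lim (\<lambda>k. f (r k) x)" for x
  have [measurable]: "g \<in> borel_measurable M"
    unfolding g_def by (rule borel_measurable_lim_metric) measurable
  have lim: "AE x in M. (\<lambda>k. f (r k) x) \<longlonglongrightarrow> g x"
    using conv by eventually_elim (simp add: g_def convergent_LIMSEQ_iff)
  \<comment> \<open>The estimate is made with extended nonnegative integrals because
    \<open>f n - g\<close> is not yet known to be square-integrable; that is read off from the case
    \<open>\<epsilon> = 1\<close>.\<close>
  have bound: "(\<integral>\<^sup>+x. ennreal ((cmod (f n x - g x))\<^sup>2) \<partial>M) \<le> ennreal \<epsilon>"
    if "\<epsilon> > 0" "n \<ge> N \<epsilon>" for n \<epsilon>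
  proof -
    have "AE x in M. ennreal ((cmod (f n x - g x))\<^sup>2) =
        liminf (\<lambda>k. ennreal ((cmod (f n x - f (r k) x))\<^sup>2))"
      using lim
    proof eventually_elim
      case (elim x)
      then have "(\<lambda>k. ennreal ((cmod (f n x - f (r k) x))\<^sup>2)) \<longlonglongrightarrow> ennreal ((cmod (f n x - g x))\<^sup>2)"
        by (intro tendsto_intros)
      then show ?case by (intro lim_imp_Liminf[symmetric]) auto
    qed
    then have "(\<integral>\<^sup>+x. ennreal ((cmod (f n x - g x))\<^sup>2) \<partial>M) =
        (\<integral>\<^sup>+x. liminf (\<lambda>k. ennreal ((cmod (f n x - f (r k) x))\<^sup>2)) \<partial>M)"
      by (rule nn_integral_cong_AE)
    also have "\<dots> \<le> liminf (\<lambda>k. \<integral>\<^sup>+x. ennreal ((cmod (f n x - f (r k) x))\<^sup>2) \<partial>M)"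
      by (rule nn_integral_liminf) measurable
    also have "\<dots> \<le> ennreal \<epsilon>"
    proof (rule Liminf_le)
      show "\<forall>\<^sub>F k in sequentially. (\<integral>\<^sup>+x. ennreal ((cmod (f n x - f (r k) x))\<^sup>2) \<partial>M) \<le> ennreal \<epsilon>"
        using eventually_ge_at_top[of "N \<epsilon>"]
      proof eventually_elim
        case (elim k)
        have "integrable M (\<lambda>x. (cmod (f n x - f (r k) x))\<^sup>2)"
          by (rule L2_functions_integrable_sq) (intro L2_functions_diff f)
        then have "(\<integral>\<^sup>+x. ennreal ((cmod (f n x - f (r k) x))\<^sup>2) \<partial>M) =
            ennreal (\<integral>x. (cmod (f n x - f (r k) x))\<^sup>2 \<partial>M)"
          by (rule nn_integral_eq_integral) simp
        also have "\<dots> \<le> ennreal \<epsilon>"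
          using N[of \<epsilon> n "r k"] that elim r_ge_k[of k] by (intro ennreal_leI) auto
        finally show ?case .
      qed
    qed simp
    finally show ?thesis .
  qed
  have diff: "(\<lambda>x. f n x - g x) \<in> L2_functions M" if "n \<ge> N 1" for n
  proof -
    have "(\<integral>\<^sup>+x. ennreal ((cmod (f n x - g x))\<^sup>2) \<partial>M) < \<infinity>"
      using bound[of 1 n] that by (simp add: le_less_trans)
    then show ?thesis by (simp add: L2_functions_def integrable_iff_bounded)
  qed
  have g: "g \<in> L2_functions M"
    using L2_functions_diff[OF f diff, of "N 1" "N 1"] by simp
  moreover have "(\<lambda>n. \<integral>x. (cmod (f n x - g x))\<^sup>2 \<partial>M) \<longlonglongrightarrow> 0"
  proof (rule LIMSEQ_I)
    fix \<epsilon> :: real assume \<epsilon>: "\<epsilon> > 0"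
    have "norm ((\<integral>x. (cmod (f n x - g x))\<^sup>2 \<partial>M) - 0) < \<epsilon>" if n: "n \<ge> N (\<epsilon> / 2)" for n
    proof -
      have "integrable M (\<lambda>x. (cmod (f n x - g x))\<^sup>2)"
        by (rule L2_functions_integrable_sq) (intro L2_functions_diff f g)
      then have "(\<integral>\<^sup>+x. ennreal ((cmod (f n x - g x))\<^sup>2) \<partial>M) = ennreal (\<integral>x. (cmod (f n x - g x))\<^sup>2 \<partial>M)"
        by (rule nn_integral_eq_integral) simp
      then have "(\<integral>x. (cmod (f n x - g x))\<^sup>2 \<partial>M) \<le> \<epsilon> / 2"
        using bound[of "\<epsilon> / 2" n] n \<epsilon> by (simp add: ennreal_le_iff)
      then show ?thesis using \<epsilon> by simp
    qed
    then show "\<exists>n0. \<forall>n\<ge>n0. norm ((\<integral>x. (cmod (f n x - g x))\<^sup>2 \<partial>M) - 0) < \<epsilon>" by blast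
  qed
  ultimately show ?thesis by (rule that)
qed

lemma L2_inner_product_module: "inner_product_module (L2 M)"
proof (rule inner_product_module.intro[OF L2_module], unfold_locales)
  show "hinner (L2 M) (x \<oplus>\<^bsub>L2 M\<^esub> y) z = hinner (L2 M) x z + hinner (L2 M) y z"
    if "x \<in> carrier (L2 M)" "y \<in> carrier (L2 M)" "z \<in> carrier (L2 M)" for x y z
    using that
    by (elim L2_carrierE)
      (simp add: L2_add L2_hinner L2_functions_add distrib_right L2_functions_integrable_mult)
  show "hinner (L2 M) (c \<odot>\<^bsub>L2 M\<^esub> x) y = c * hinner (L2 M) x y"
    if "x \<in> carrier (L2 M)" "y \<in> carrier (L2 M)" for x y c
    using that by (elim L2_carrierE) (simp add: L2_smult L2_hinner L2_functions_smult mult.assoc)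
  show "hinner (L2 M) y x = cnj (hinner (L2 M) x y)"
    if xy: "x \<in> carrier (L2 M)" "y \<in> carrier (L2 M)" for x y
  proof -
    obtain f g where fg: "f \<in> L2_functions M" "x = L2_class M f" "g \<in> L2_functions M" "y = L2_class M g"
      using xy by (elim L2_carrierE)
    then show ?thesis
      using Bochner_Integration.integral_cnj[of M "\<lambda>x. f x * cnj (g x)"] by (simp add: L2_hinner mult.commute)
  qed
  show "0 \<le> Re (hinner (L2 M) x x)" if "x \<in> carrier (L2 M)" for x
  proof -
    obtain f where f: "f \<in> L2_functions M" "x = L2_class M f" using \<open>x \<in> carrier (L2 M)\<close> by (rule L2_carrierE)
    show ?thesis using L2_hnorm_sq(2)[OF f(1)] by (simp add: hnorm_def f)
  qed
  show "x = \<zero>\<^bsub>L2 M\<^esub>" if x: "x \<in> carrier (L2 M)" and 0: "hinner (L2 M) x x = 0" for x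
  proof -
    obtain f where f: "f \<in> L2_functions M" "x = L2_class M f" using x by (rule L2_carrierE)
    have "(\<integral>x. (cmod (f x))\<^sup>2 \<partial>M) = 0"
      using L2_hnorm_sq(1)[OF f(1)] 0 by (simp add: hnorm_def f)
    then have "AE x in M. (cmod (f x))\<^sup>2 = 0"
      using integral_nonneg_eq_0_iff_AE[OF L2_functions_integrable_sq[OF f(1)]] by simp
    then have "AE x in M. f x = 0" by eventually_elim simp
    then show ?thesis using f by (simp add: L2_zero L2_class_eq_iff)
  qed
qed

lemma L2_hilbert_space: "hilbert_space (L2 M)"
proof -
  interpret inner_product_module "L2 M" by (rule L2_inner_product_module)
  interpret HM: Metric_space "carrier (L2 M)" "hdist (L2 M)" by (rule metric_space)
  have complete: "HM.mcomplete"
    unfolding HM.mcomplete_def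
  proof (intro allI impI)
    fix \<sigma> assume \<sigma>: "HM.MCauchy \<sigma>"
    define f where "f n = L2_rep (\<sigma> n)" for n
    have \<sigma>c: "\<sigma> n \<in> carrier (L2 M)" for n using \<sigma> by (auto simp: HM.MCauchy_def)
    have f: "f n \<in> L2_functions M" "\<sigma> n = L2_class M (f n)" for n
      by (simp_all add: f_def L2_rep_L2_functions L2_class_rep \<sigma>c)
    have fC: "\<exists>N. \<forall>m\<ge>N. \<forall>n\<ge>N. (\<integral>x. (cmod (f m x - f n x))\<^sup>2 \<partial>M) \<le> \<epsilon>" if "\<epsilon> > 0" for \<epsilon>
    proof -
      obtain N where N: "\<And>n n'. N \<le> n \<Longrightarrow> N \<le> n' \<Longrightarrow> hdist (L2 M) (\<sigma> n) (\<sigma> n') < sqrt \<epsilon>"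
        using \<sigma> real_sqrt_gt_zero[OF \<open>\<epsilon> > 0\<close>] unfolding HM.MCauchy_def by meson
      have "(\<integral>x. (cmod (f m x - f n x))\<^sup>2 \<partial>M) \<le> \<epsilon>" if "m \<ge> N" "n \<ge> N" for m n
      proof -
        have "(hdist (L2 M) (\<sigma> m) (\<sigma> n))\<^sup>2 \<le> (sqrt \<epsilon>)\<^sup>2"
          using N[OF that] by (intro power_mono) auto
        then show ?thesis using \<open>\<epsilon> > 0\<close> f by (simp add: L2_hdist)
      qed
      then show ?thesis by (intro exI[of _ N]) simp
    qed
    obtain g where g: "g \<in> L2_functions M" "(\<lambda>n. \<integral>x. (cmod (f n x - g x))\<^sup>2 \<partial>M) \<longlonglongrightarrow> 0"
      by (rule L2_Cauchy_limit[OF f(1) fC])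
    have "(\<lambda>n. (hdist (L2 M) (\<sigma> n) (L2_class M g))\<^sup>2) \<longlonglongrightarrow> 0"
      using g by (simp add: f L2_hdist)
    then have "(\<lambda>n. sqrt ((hdist (L2 M) (\<sigma> n) (L2_class M g))\<^sup>2)) \<longlonglongrightarrow> sqrt 0"
      by (rule tendsto_real_sqrt)
    then have "(\<lambda>n. hdist (L2 M) (\<sigma> n) (L2_class M g)) \<longlonglongrightarrow> 0"
      by simp
    then have "limitin HM.mtopology \<sigma> (L2_class M g) sequentially"
      using g \<sigma>c by (simp add: HM.limitin_metric_dist_null L2_class_carrier)
    then show "\<exists>x. limitin HM.mtopology \<sigma> x sequentially" by (rule exI)
  qed
  show ?thesis
  proof (rule hilbert_space.intro[OF L2_module], rule hilbert_space_axioms.intro)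
  qed (erule (2) hinner_add | erule (1) hinner_smult | erule (1) hinner_cnj | erule hinner_nonneg
      | erule (1) hinner_definite | rule complete)+
qed

lemma L2_class_cong:
  assumes "f \<in> L2_functions M" "g \<in> L2_functions M" "\<And>x. x \<in> space M \<Longrightarrow> f x = g x"
  shows "L2_class M f = L2_class M g"
  using assms by (simp add: L2_class_eq_iff AE_I2)

lemma L2_finsum:
  assumes "\<And>i. i \<in> F \<Longrightarrow> f i \<in> L2_functions M"
  shows "finsum (L2 M) (\<lambda>i. L2_class M (f i)) F = L2_class M (\<lambda>x. \<Sum>i\<in>F. f i x)"
proof -
  interpret hilbert_space "L2 M" by (rule L2_hilbert_space)
  show ?thesis
  proof (cases "finite F")
    case True
    then show ?thesis using assms
    proof (induction F rule: finite_induct)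
      case empty
      then show ?case by (simp add: L2_zero)
    next
      case (insert a F)
      have "finsum (L2 M) (\<lambda>i. L2_class M (f i)) (insert a F) =
          L2_class M (f a) \<oplus>\<^bsub>L2 M\<^esub> finsum (L2 M) (\<lambda>i. L2_class M (f i)) F"
        using insert by (intro M.finsum_insert) (auto simp: L2_class_carrier)
      also have "\<dots> = L2_class M (\<lambda>x. f a x + (\<Sum>i\<in>F. f i x))"
        using insert by (simp add: L2_add L2_functions_sum)
      finally show ?case using insert by simp
    qed
  next
    case False
    then show ?thesis by (simp add: M.finsum_infinite L2_zero)
  qed
qed

section \<open>Multiplication operators\<close>

lemma multiplication_rep_class:
  assumes f: "f \<in> L2_functions M" and a: "a \<in> borel_measurable M" "\<And>x. x \<in> space M \<Longrightarrow> cmod (a x) \<le> C"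
  shows "multiplication_rep M a (L2_class M f) = L2_class M (\<lambda>x. a x * f x)"
  unfolding multiplication_rep_def using L2_class_mult[OF assms] .

lemma multiplication_rep_closed:
  assumes F: "F \<in> carrier (L2 M)" and a: "a \<in> borel_measurable M" "\<And>x. x \<in> space M \<Longrightarrow> cmod (a x) \<le> C"
  shows "multiplication_rep M a F \<in> carrier (L2 M)"
proof -
  obtain f where "f \<in> L2_functions M" "F = L2_class M f" using F by (rule L2_carrierE)
  then show ?thesis
    using a by (simp add: multiplication_rep_class[where C = C] L2_class_carrier L2_functions_mult[where C = C])
qed

lemma multiplication_rep_bounded_operator:
  assumes a: "a \<in> borel_measurable M" "\<And>x. x \<in> space M \<Longrightarrow> cmod (a x) \<le> C"
  shows "multiplication_rep M a \<in> bounded_operators (L2 M)"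
proof -
  interpret hilbert_space "L2 M" by (rule L2_hilbert_space)
  note rep = multiplication_rep_class[OF _ a] and cl = L2_functions_mult[OF _ a]
  have "multiplication_rep M a (x \<oplus>\<^bsub>L2 M\<^esub> y) = multiplication_rep M a x \<oplus>\<^bsub>L2 M\<^esub> multiplication_rep M a y"
    if "x \<in> carrier (L2 M)" "y \<in> carrier (L2 M)" for x y
    using that
    by (elim L2_carrierE) (simp add: L2_add rep cl L2_functions_add distrib_left)
  moreover have "multiplication_rep M a (c \<odot>\<^bsub>L2 M\<^esub> x) = c \<odot>\<^bsub>L2 M\<^esub> multiplication_rep M a x"
    if "x \<in> carrier (L2 M)" for c x
    using that
    by (elim L2_carrierE) (simp add: L2_smult rep cl L2_functions_smult mult.left_commute)
  \<comment> \<open>On an empty space \<open>C\<close> may be negative, hence the absolute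
    value.\<close>
  moreover have "hnorm (L2 M) (multiplication_rep M a x) \<le> \<bar>C\<bar> * hnorm (L2 M) x"
    if x: "x \<in> carrier (L2 M)" for x
  proof -
    obtain f where f: "f \<in> L2_functions M" "x = L2_class M f" using x by (rule L2_carrierE)
    have "(\<integral>t. (cmod (a t * f t))\<^sup>2 \<partial>M) \<le> (\<integral>t. C\<^sup>2 * (cmod (f t))\<^sup>2 \<partial>M)"
    proof (rule integral_mono)
      show "integrable M (\<lambda>t. (cmod (a t * f t))\<^sup>2)"
        by (rule L2_functions_integrable_sq) (rule cl[OF f(1)])
      show "integrable M (\<lambda>t. C\<^sup>2 * (cmod (f t))\<^sup>2)"
        by (intro integrable_mult_right L2_functions_integrable_sq f)
      show "(cmod (a t * f t))\<^sup>2 \<le> C\<^sup>2 * (cmod (f t))\<^sup>2" if "t \<in> space M" for t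
        using a(2)[OF that] by (simp add: norm_mult power_mult_distrib mult_right_mono power_mono)
    qed
    then have "(hnorm (L2 M) (multiplication_rep M a x))\<^sup>2 \<le> (\<bar>C\<bar> * hnorm (L2 M) x)\<^sup>2"
      using f by (simp add: rep cl L2_hnorm_sq power_mult_distrib)
    then show ?thesis by (rule power2_le_imp_le) (simp add: f L2_hnorm_sq)
  qed
  then have "bounded_on (L2 M) (carrier (L2 M)) (multiplication_rep M a)"
    unfolding bounded_on_def by (intro exI[of _ "\<bar>C\<bar>"] ballI)
  ultimately show ?thesis
    using multiplication_rep_closed[OF _ a]
    by (simp add: bounded_operators_def linear_operator_def linear_subspace_def)
qed

text \<open>The relation between \<open>a\<close> and \<open>b\<close> is confined to the space
  because elements of \<open>continuous_functions\<close> are \<open>undefined\<close>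
  elsewhere.\<close>

lemma multiplication_rep_adjoint:
  assumes a: "a \<in> borel_measurable M" "\<And>x. x \<in> space M \<Longrightarrow> cmod (a x) \<le> C"
    and b: "b \<in> borel_measurable M" "\<And>x. x \<in> space M \<Longrightarrow> b x = cnj (a x)"
    and FG: "F \<in> carrier (L2 M)" "G \<in> carrier (L2 M)"
  shows "hinner (L2 M) (multiplication_rep M a F) G = hinner (L2 M) F (multiplication_rep M b G)"
proof -
  obtain f where f: "f \<in> L2_functions M" "F = L2_class M f" using FG(1) by (rule L2_carrierE)
  obtain g where g: "g \<in> L2_functions M" "G = L2_class M g" using FG(2) by (rule L2_carrierE)
  have bC: "\<And>x. x \<in> space M \<Longrightarrow> cmod (b x) \<le> C" using a b by simp
  have "(\<integral>x. a x * f x * cnj (g x) \<partial>M) = (\<integral>x. f x * cnj (b x * g x) \<partial>M)"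
    by (rule Bochner_Integration.integral_cong) (simp_all add: b)
  then show ?thesis
    using f g a(1) b(1) bC a(2)
    by (simp add: multiplication_rep_class[where C = C] L2_hinner L2_functions_mult[where C = C])
qed

section \<open>Continuous functions on a compact space\<close>

text \<open>Cauchy sequences and their limits stay in the carrier, so completeness depends only on
  the distances there. This matters because \<open>adist\<close> is cut off to 0 outside the
  carrier.\<close>

lemma mcomplete_cong:
  assumes M: "Metric_space M d" "Metric_space M d'"
    and eq: "\<And>x y. \<lbrakk>x \<in> M; y \<in> M\<rbrakk> \<Longrightarrow> d x y = d' x y"
    and complete: "Metric_space.mcomplete M d"
  shows "Metric_space.mcomplete M d'"
proof -
  interpret A: Metric_space M d by (rule M)
  interpret B: Metric_space M d' by (rule M)
  show ?thesis
    unfolding B.mcomplete_def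
  proof (intro allI impI)
    fix s assume s: "B.MCauchy s"
    then have sM: "s n \<in> M" for n by (auto simp: B.MCauchy_def)
    then have "A.MCauchy s" using s by (simp add: A.MCauchy_def B.MCauchy_def eq)
    then obtain x where x: "limitin A.mtopology s x sequentially"
      using complete by (auto simp: A.mcomplete_def)
    then have "x \<in> M" by (rule A.limitin_mspace)
    then have "(\<lambda>n. d (s n) x) = (\<lambda>n. d' (s n) x)" using sM eq by auto
    with x have "limitin B.mtopology s x sequentially"
      by (simp add: A.limitin_metric_dist_null B.limitin_metric_dist_null)
    then show "\<exists>x. limitin B.mtopology s x sequentially" by (rule exI)
  qed
qed

lemma continuous_map_complex_mult:
  fixes f g :: "'x \<Rightarrow> complex"
  assumes "continuous_map Y euclidean f" "continuous_map Y euclidean g"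
  shows "continuous_map Y euclidean (\<lambda>x. f x * g x)"
  using assms by (simp add: continuous_map_atin tendsto_mult)

lemma continuous_map_cnj:
  assumes "continuous_map Y euclidean f"
  shows "continuous_map Y euclidean (\<lambda>x. cnj (f x))"
  using assms by (simp add: continuous_map_atin tendsto_cnj)

lemma continuous_map_restrict_topspace:
  "continuous_map Y Z f \<Longrightarrow> continuous_map Y Z (restrict f (topspace Y))"
  by (erule continuous_map_eq) simp

lemma continuous_functions_carrier_iff:
  "f \<in> carrier (continuous_functions Y) \<longleftrightarrow> f \<in> extensional (topspace Y) \<and> continuous_map Y euclidean f"
  by (simp add: continuous_functions_def)

lemma continuous_functions_simps:
  "f \<otimes>\<^bsub>continuous_functions Y\<^esub> g = (\<lambda>x\<in>topspace Y. f x * g x)"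
  "\<one>\<^bsub>continuous_functions Y\<^esub> = (\<lambda>x\<in>topspace Y. 1)"
  "\<zero>\<^bsub>continuous_functions Y\<^esub> = (\<lambda>x\<in>topspace Y. 0)"
  "f \<oplus>\<^bsub>continuous_functions Y\<^esub> g = (\<lambda>x\<in>topspace Y. f x + g x)"
  "c \<odot>\<^bsub>continuous_functions Y\<^esub> f = (\<lambda>x\<in>topspace Y. c * f x)"
  "star (continuous_functions Y) f = (\<lambda>x\<in>topspace Y. cnj (f x))"
  "anorm (continuous_functions Y) f = (SUP x\<in>topspace Y. cmod (f x))"
  by (simp_all add: continuous_functions_def)

lemma continuous_functions_closed:
  assumes "f \<in> carrier (continuous_functions Y)" "g \<in> carrier (continuous_functions Y)"
  shows "(\<lambda>x\<in>topspace Y. f x * g x) \<in> carrier (continuous_functions Y)"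
    "(\<lambda>x\<in>topspace Y. f x + g x) \<in> carrier (continuous_functions Y)"
    "(\<lambda>x\<in>topspace Y. f x - g x) \<in> carrier (continuous_functions Y)"
    "(\<lambda>x\<in>topspace Y. c * f x) \<in> carrier (continuous_functions Y)"
    "(\<lambda>x\<in>topspace Y. - f x) \<in> carrier (continuous_functions Y)"
    "(\<lambda>x\<in>topspace Y. cnj (f x)) \<in> carrier (continuous_functions Y)"
    "(\<lambda>x\<in>topspace Y. c) \<in> carrier (continuous_functions Y)"
  using assms
  by (auto simp: continuous_functions_carrier_iff
      intro!: continuous_map_restrict_topspace continuous_map_complex_mult continuous_map_cnj
        continuous_map_add continuous_map_diff continuous_map_minus)

lemma continuous_functions_eqI:
  assumes "f \<in> carrier (continuous_functions Y)" "g \<in> carrier (continuous_functions Y)"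
    "\<And>x. x \<in> topspace Y \<Longrightarrow> f x = g x"
  shows "f = g"
  using assms by (auto simp: continuous_functions_carrier_iff intro: extensionalityI)

lemma continuous_functions_module: "module complex_ring (continuous_functions Y)"
proof (rule moduleI)
  let ?A = "continuous_functions Y"
  show "cring complex_ring" by (rule cring_from_type_algebra)
  show "abelian_group ?A"
  proof (rule abelian_groupI)
    show "\<exists>y\<in>carrier ?A. y \<oplus>\<^bsub>?A\<^esub> f = \<zero>\<^bsub>?A\<^esub>" if "f \<in> carrier ?A" for f
      by (rule bexI[OF _ continuous_functions_closed(5)[OF that that]])
        (simp only: continuous_functions_simps, rule restrict_ext, simp)
    show "\<zero>\<^bsub>?A\<^esub> \<oplus>\<^bsub>?A\<^esub> f = f" if "f \<in> carrier ?A" for f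
      by (simp only: continuous_functions_simps)
        (rule extensionalityI[where A = "topspace Y"], use that in \<open>simp_all add: continuous_functions_carrier_iff\<close>)
    show "\<zero>\<^bsub>?A\<^esub> \<in> carrier ?A"
      by (simp add: continuous_functions_simps continuous_functions_carrier_iff continuous_map_restrict_topspace)
  qed (simp_all only: continuous_functions_simps complex_ring_simps,
    ((rule continuous_functions_closed, assumption, assumption) | (rule restrict_ext, simp add: algebra_simps))+)
  show "\<one>\<^bsub>complex_ring\<^esub> \<odot>\<^bsub>?A\<^esub> f = f" if "f \<in> carrier ?A" for f
    by (simp only: continuous_functions_simps complex_ring_simps)
      (rule extensionalityI[where A = "topspace Y"], use that in \<open>simp_all add: continuous_functions_carrier_iff\<close>)
qed (simp_all only: continuous_functions_simps complex_ring_simps,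
    ((rule continuous_functions_closed, assumption, assumption) | (rule restrict_ext, simp add: algebra_simps))+)

lemma continuous_functions_ring: "ring (continuous_functions Y)"
proof (rule ringI)
  let ?A = "continuous_functions Y"
  interpret module complex_ring ?A by (rule continuous_functions_module)
  show "abelian_group ?A" by (rule M.abelian_group_axioms)
  show "Group.monoid ?A"
  proof (rule Group.monoidI)
    show "\<one>\<^bsub>?A\<^esub> \<otimes>\<^bsub>?A\<^esub> f = f" "f \<otimes>\<^bsub>?A\<^esub> \<one>\<^bsub>?A\<^esub> = f" if "f \<in> carrier ?A" for f
      by (simp only: continuous_functions_simps;
          rule extensionalityI[where A = "topspace Y"];
          use that in \<open>simp add: continuous_functions_carrier_iff\<close>)+
    show "\<one>\<^bsub>?A\<^esub> \<in> carrier ?A"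
      by (simp add: continuous_functions_simps continuous_functions_carrier_iff continuous_map_restrict_topspace)
  qed (simp_all only: continuous_functions_simps complex_ring_simps,
    ((rule continuous_functions_closed, assumption, assumption) | (rule restrict_ext, simp add: algebra_simps))+)
qed (simp_all only: continuous_functions_simps complex_ring_simps,
    ((rule continuous_functions_closed, assumption, assumption) | (rule restrict_ext, simp add: algebra_simps))+)

lemma continuous_functions_minus:
  assumes "f \<in> carrier (continuous_functions Y)" "g \<in> carrier (continuous_functions Y)"
  shows "f \<ominus>\<^bsub>continuous_functions Y\<^esub> g = (\<lambda>x\<in>topspace Y. f x - g x)"
proof -
  interpret module complex_ring "continuous_functions Y" by (rule continuous_functions_module)
  have "\<ominus>\<^bsub>continuous_functions Y\<^esub> g = (\<lambda>x\<in>topspace Y. - g x)"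
    by (rule M.minus_equality[OF _ assms(2) continuous_functions_closed(5)[OF assms(2,2)]])
      (simp only: continuous_functions_simps, rule restrict_ext, simp)
  then show ?thesis by (auto simp: a_minus_def continuous_functions_simps)
qed

text \<open>Compactness bounds the set whose supremum is \<open>anorm\<close>, and a point keeps
  this set from being empty.\<close>

locale compact_nonempty_space =
  fixes Y :: "'x topology"
  assumes compact: "compact_space Y" and nonempty: "topspace Y \<noteq> {}"
begin

abbreviation "CY \<equiv> continuous_functions Y"

section \<open>The supremum norm and the C*-algebra axioms\<close>

lemma bdd_above_norm: "f \<in> carrier CY \<Longrightarrow> bdd_above ((\<lambda>x. cmod (f x)) ` topspace Y)"
proof -
  assume "f \<in> carrier CY"
  then have "compactin euclidean (f ` topspace Y)"
    using compact image_compactin[of Y "topspace Y" euclidean f]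
    by (simp add: continuous_functions_carrier_iff compact_space_def)
  then have "bounded (f ` topspace Y)" by (simp add: compact_imp_bounded)
  then show ?thesis by (auto simp: bounded_iff bdd_above_def)
qed

lemma norm_le_anorm: "\<lbrakk>f \<in> carrier CY; x \<in> topspace Y\<rbrakk> \<Longrightarrow> cmod (f x) \<le> anorm CY f"
  using cSUP_upper[OF _ bdd_above_norm] by (simp add: continuous_functions_simps)

lemma anorm_le: "(\<And>x. x \<in> topspace Y \<Longrightarrow> cmod (f x) \<le> C) \<Longrightarrow> anorm CY f \<le> C"
  using nonempty by (auto simp: continuous_functions_simps intro: cSUP_least)

lemma anorm_nonneg: "f \<in> carrier CY \<Longrightarrow> 0 \<le> anorm CY f"
  using norm_le_anorm[of f "SOME x. x \<in> topspace Y"] nonempty order_trans[OF norm_ge_zero]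
  by (simp add: some_in_eq)

text \<open>On a compact space continuity implies boundedness. The algebra is thus the space of
  bounded continuous functions with the uniform metric, whose completeness is available.\<close>

lemma carrier_eq_mspace: "carrier CY = mspace (cfunspace Y euclidean_metric)"
proof -
  have "compactin Y (topspace Y)" using compact by (simp add: compact_space_def)
  note eq = compactin_mspace_cfunspace[OF this, of "euclidean_metric :: complex metric"]
  show ?thesis
    unfolding eq by (simp add: Set.set_eq_iff continuous_functions_carrier_iff)
qed

lemma adist_eq_mdist:
  assumes "f \<in> carrier CY" "g \<in> carrier CY"
  shows "adist CY f g = mdist (cfunspace Y euclidean_metric) f g"
proof -
  have "f \<in> Met_TC.fspace (topspace Y)" "g \<in> Met_TC.fspace (topspace Y)"
    using assms cfunspace_subset_funspace[of Y "euclidean_metric :: complex metric"]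
    unfolding carrier_eq_mspace by (simp_all add: subset_iff del: mspace_cfunspace)
  then show ?thesis
    using assms nonempty
    by (simp add: adist_def continuous_functions_minus continuous_functions_simps
        mdist_cfunspace_eq_mdist_funspace Met_TC.fdist_def dist_norm)
qed

lemma adist_metric_space: "Metric_space (carrier CY) (adist CY)"
proof
  let ?m = "cfunspace Y (euclidean_metric :: complex metric)"
  have eq: "adist CY f g = (if f \<in> carrier CY \<and> g \<in> carrier CY then mdist ?m f g else 0)" for f g
    using adist_eq_mdist by (simp add: adist_def)
  show "0 \<le> adist CY f g" for f g by (simp add: eq)
  show "adist CY f g = adist CY g f" for f g by (simp add: eq mdist_commute)
  show "(adist CY f g = 0) = (f = g)" if "f \<in> carrier CY" "g \<in> carrier CY" for f g
    using that carrier_eq_mspace by (simp add: eq)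
  show "adist CY f h \<le> adist CY f g + adist CY g h"
    if "f \<in> carrier CY" "g \<in> carrier CY" "h \<in> carrier CY" for f g h
    using that carrier_eq_mspace mdist_triangle[of f ?m g h] by (simp add: eq)
qed

lemma adist_mcomplete: "Metric_space.mcomplete (carrier CY) (adist CY)"
proof (rule mcomplete_cong)
  let ?m = "cfunspace Y (euclidean_metric :: complex metric)"
  show "Metric_space (carrier CY) (mdist ?m)"
    unfolding carrier_eq_mspace by (rule Metric_space_mspace_mdist)
  have "Met_TC.mcomplete TYPE(complex)" by (simp add: complete_UNIV)
  then have "mcomplete_of ?m"
    using Met_TC.mcomplete_cfunspace[of Y] by (simp add: euclidean_metric_def Met_TC.Self_def)
  then show "Metric_space.mcomplete (carrier CY) (mdist ?m)"
    unfolding mcomplete_of_def carrier_eq_mspace .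
qed (auto simp: adist_metric_space adist_eq_mdist)

lemma unital_cstar_algebra: "unital_cstar_algebra CY"
proof (intro unital_cstar_algebra.intro continuous_functions_module continuous_functions_ring
    unital_cstar_algebra_axioms.intro)
  show "anorm CY (f \<oplus>\<^bsub>CY\<^esub> g) \<le> anorm CY f + anorm CY g" if "f \<in> carrier CY" "g \<in> carrier CY" for f g
    using that norm_le_anorm
    by (intro anorm_le) (auto simp: continuous_functions_simps(4) intro!: norm_triangle_le add_mono)
  show mult: "anorm CY (f \<otimes>\<^bsub>CY\<^esub> g) \<le> anorm CY f * anorm CY g" if "f \<in> carrier CY" "g \<in> carrier CY" for f g
    using that norm_le_anorm anorm_nonneg
    by (intro anorm_le) (auto simp: continuous_functions_simps(1) norm_mult intro!: mult_mono)
  show "(anorm CY f = 0) = (f = \<zero>\<^bsub>CY\<^esub>)" if f: "f \<in> carrier CY" for f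
  proof
    assume "anorm CY f = 0"
    then have "f x = 0" if "x \<in> topspace Y" for x
      using norm_le_anorm[OF f that] by simp
    then show "f = \<zero>\<^bsub>CY\<^esub>"
      by (intro continuous_functions_eqI[where Y = Y])
        (use f continuous_functions_closed(7)[OF f f, of 0] in \<open>auto simp: continuous_functions_simps\<close>)
  next
    assume "f = \<zero>\<^bsub>CY\<^esub>"
    then have "anorm CY f \<le> 0" by (intro anorm_le) (simp add: continuous_functions_simps)
    then show "anorm CY f = 0" using anorm_nonneg[OF f] by simp
  qed
  show "anorm CY (c \<odot>\<^bsub>CY\<^esub> f) = cmod c * anorm CY f" if f: "f \<in> carrier CY" for c f
  proof (rule antisym)
    have cf: "c \<odot>\<^bsub>CY\<^esub> f \<in> carrier CY"
      using continuous_functions_closed(4)[OF f f] by (simp add: continuous_functions_simps)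
    show "anorm CY (c \<odot>\<^bsub>CY\<^esub> f) \<le> cmod c * anorm CY f"
      using norm_le_anorm[OF f]
      by (intro anorm_le) (simp add: continuous_functions_simps(5) norm_mult mult_left_mono)
    show "cmod c * anorm CY f \<le> anorm CY (c \<odot>\<^bsub>CY\<^esub> f)"
    proof (cases "c = 0")
      case True
      then show ?thesis using anorm_nonneg[OF cf] by simp
    next
      case False
      have "anorm CY f \<le> anorm CY (c \<odot>\<^bsub>CY\<^esub> f) / cmod c"
      proof (rule anorm_le)
        fix x assume x: "x \<in> topspace Y"
        show "cmod (f x) \<le> anorm CY (c \<odot>\<^bsub>CY\<^esub> f) / cmod c"
          using norm_le_anorm[OF cf x] x False
          by (simp add: continuous_functions_simps(5) norm_mult field_simps)
      qed
      then show ?thesis using False by (simp add: field_simps)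
    qed
  qed
  show "anorm CY (star CY f \<otimes>\<^bsub>CY\<^esub> f) = (anorm CY f)\<^sup>2" if f: "f \<in> carrier CY" for f
  proof (rule antisym)
    have sf: "star CY f \<in> carrier CY"
      using continuous_functions_closed(6)[OF f f] by (simp add: continuous_functions_simps)
    have sff: "star CY f \<otimes>\<^bsub>CY\<^esub> f \<in> carrier CY"
      using continuous_functions_closed(1)[OF sf f] by (simp add: continuous_functions_simps)
    have "anorm CY (star CY f) \<le> anorm CY f"
      using norm_le_anorm[OF f] by (intro anorm_le) (simp add: continuous_functions_simps(6))
    then have "anorm CY (star CY f) * anorm CY f \<le> anorm CY f * anorm CY f"
      using anorm_nonneg[OF f] by (rule mult_right_mono)
    then show "anorm CY (star CY f \<otimes>\<^bsub>CY\<^esub> f) \<le> (anorm CY f)\<^sup>2"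
      using mult[OF sf f] by (simp add: power2_eq_square)
    \<comment> \<open>The product of \<open>f\<close> with its star has the pointwise modulus of
      \<open>f\<close> squared. Taking the root pointwise avoids exchanging a square with a
      supremum.\<close>
    have "anorm CY f \<le> sqrt (anorm CY (star CY f \<otimes>\<^bsub>CY\<^esub> f))"
    proof (rule anorm_le)
      fix x assume x: "x \<in> topspace Y"
      show "cmod (f x) \<le> sqrt (anorm CY (star CY f \<otimes>\<^bsub>CY\<^esub> f))"
        using norm_le_anorm[OF sff x] x
        by (intro real_le_rsqrt) (simp add: continuous_functions_simps(1,6) norm_mult power2_eq_square)
    qed
    then have "(anorm CY f)\<^sup>2 \<le> (sqrt (anorm CY (star CY f \<otimes>\<^bsub>CY\<^esub> f)))\<^sup>2"
      using anorm_nonneg[OF f] by (rule power_mono)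
    then show "(anorm CY f)\<^sup>2 \<le> anorm CY (star CY f \<otimes>\<^bsub>CY\<^esub> f)"
      using anorm_nonneg[OF sff] by simp
  qed
  show "star CY (star CY f) = f" if f: "f \<in> carrier CY" for f
    by (simp only: continuous_functions_simps)
      (rule extensionalityI[where A = "topspace Y"], use f in \<open>simp_all add: continuous_functions_carrier_iff\<close>)
qed (simp_all only: continuous_functions_simps(1-6) anorm_nonneg adist_mcomplete,
    ((rule continuous_functions_closed, assumption, assumption) | (rule restrict_ext, simp add: algebra_simps))+)

end

section \<open>Subshifts of finite type\<close>

locale subshift_matrix =
  fixes l :: nat and A :: "nat mat"
  assumes l_pos: "l \<ge> 1"
    and A_carrier: "A \<in> carrier_mat l l"
    and entries: "\<And>j k. j \<in> {1..l} \<Longrightarrow> k \<in> {1..l} \<Longrightarrow> entry A j k \<in> {0, 1}"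
    and irreducible: "irreducible_mat A"
begin

lemma alphabet_eq: "alphabet A = {1..l}"
  using A_carrier by (simp add: alphabet_def)

lemma finite_alphabet [simp]: "finite (alphabet A)"
  by (simp add: alphabet_def)

text \<open>If row \<open>a\<close> of the matrix had no entry 1, then row \<open>a\<close> of every
  positive power would be zero, against irreducibility. Successors allow every admissible word to be
  continued to a point.\<close>

lemma ex_successor:
  assumes a: "a \<in> alphabet A"
  shows "\<exists>b\<in>alphabet A. entry A a b = 1"
proof (rule ccontr)
  assume no: "\<not> ?thesis"
  have zero: "entry A a b = 0" if "b \<in> alphabet A" for b
    using entries[of a b] no a that by (auto simp: alphabet_eq)
  have power: "entry (A ^\<^sub>m Suc n) a b = 0" if "b \<in> alphabet A" for n b
    using that
  proof (induction n arbitrary: b)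
    case 0
    then show ?case using zero A_carrier by simp
  next
    case (Suc n)
    have ab: "a - 1 < l" "b - 1 < l" using a Suc.prems by (auto simp: alphabet_eq)
    have car: "A ^\<^sub>m Suc n \<in> carrier_mat l l" using A_carrier by (rule pow_carrier_mat)
    have "entry (A ^\<^sub>m Suc (Suc n)) a b = (\<Sum>i<l. (A ^\<^sub>m Suc n) $$ (a - 1, i) * A $$ (i, b - 1))"
      using ab car A_carrier
      by (simp add: entry_def scalar_prod_def lessThan_atLeast0 del: pow_mat.simps(2))
        (simp add: scalar_prod_def)
    also have "\<dots> = 0"
    proof (rule sum.neutral, rule ballI)
      fix i assume i: "i \<in> {..<l}"
      have "Suc i \<in> alphabet A" using i by (simp add: alphabet_eq)
      from Suc.IH[OF this] show "(A ^\<^sub>m Suc n) $$ (a - 1, i) * A $$ (i, b - 1) = 0"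
        by (simp add: entry_def)
    qed
    finally show ?case .
  qed
  obtain n where "n \<ge> 1" "entry (A ^\<^sub>m n) a a > 0"
    using irreducible a by (auto simp: irreducible_mat_def)
  then show False using power[OF a, of "n - 1"] by simp
qed

section \<open>Words, cylinders and the cylinder topology\<close>

lemma subshift_prefix_word:
  assumes "\<omega> \<in> subshift A"
  shows "map \<omega> [0..<k] \<in> words_of_length A k"
  using assms by (auto simp: words_of_length_def subshift_def)

lemma subshift_prefix_admissible:
  assumes "\<omega> \<in> subshift A" "k \<ge> 1"
  shows "map \<omega> [0..<k] \<in> admissible_words A"
  using subshift_prefix_word[OF assms(1), of k] assms(2) by (auto simp: admissible_words_def)

lemma admissible_wordsD:
  assumes "w \<in> admissible_words A"
  shows "w \<noteq> []" "set w \<subseteq> alphabet A" "\<And>i. Suc i < length w \<Longrightarrow> entry A (w ! i) (w ! Suc i) = 1"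
  using assms by (auto simp: admissible_words_def words_of_length_def)

lemma admissible_wordsI:
  "\<lbrakk>w \<noteq> []; set w \<subseteq> alphabet A; \<And>i. Suc i < length w \<Longrightarrow> entry A (w ! i) (w ! Suc i) = 1\<rbrakk>
   \<Longrightarrow> w \<in> admissible_words A"
  by (auto simp: admissible_words_def words_of_length_def Suc_le_eq intro!: bexI[of _ "length w"])

lemma mem_cylinder: "\<omega> \<in> cylinder A w \<longleftrightarrow> \<omega> \<in> subshift A \<and> (\<forall>i<length w. \<omega> i = w ! i)"
proof -
  have "map \<omega> [0..<length w] = w \<longleftrightarrow> (\<forall>i<length w. \<omega> i = w ! i)"
  proof (intro iffI allI impI)
    fix i assume eq: "map \<omega> [0..<length w] = w" and i: "i < length w"
    have "\<omega> i = map \<omega> [0..<length w] ! i" using i by simp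
    then show "\<omega> i = w ! i" by (simp only: eq)
  qed (intro nth_equalityI, simp_all)
  then show ?thesis by (simp add: cylinder_def)
qed

lemma mem_cylinder_prefix: "\<upsilon> \<in> cylinder A (map \<omega> [0..<k]) \<longleftrightarrow> \<upsilon> \<in> subshift A \<and> (\<forall>i<k. \<upsilon> i = \<omega> i)"
  by (simp add: mem_cylinder)

lemma cylinder_Nil [simp]: "cylinder A [] = subshift A"
  by (simp add: cylinder_def)

lemma cylinder_subset: "cylinder A w \<subseteq> subshift A"
  by (auto simp: cylinder_def)

lemma cylinder_prefix_eq: "\<omega> \<in> cylinder A w \<Longrightarrow> map \<omega> [0..<length w] = w"
  by (simp add: cylinder_def)

text \<open>The word is continued forever by a fixed choice of successors, starting from its last
  letter.\<close>

lemma admissible_cylinder_nonempty: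
  assumes w: "w \<in> admissible_words A"
  obtains \<omega> where "\<omega> \<in> cylinder A w"
proof -
  obtain s where s: "\<And>a. a \<in> alphabet A \<Longrightarrow> s a \<in> alphabet A"
      "\<And>a. a \<in> alphabet A \<Longrightarrow> entry A a (s a) = 1"
    using ex_successor by metis
  define k where "k = length w"
  have k: "k \<ge> 1" using admissible_wordsD(1)[OF w] by (simp add: k_def Suc_le_eq)
  \<comment> \<open>The exponent \<open>n - k + 1\<close> equals 1 at position \<open>k\<close>, the
    first one after the word, so that the last letter is not repeated.\<close>
  define \<omega> where "\<omega> n = (if n < k then w ! n else (s ^^ (n - k + 1)) (last w))" for n
  have "last w \<in> alphabet A" using admissible_wordsD(1,2)[OF w] last_in_set by blast
  then have it: "(s ^^ n) (last w) \<in> alphabet A" for n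
    by (induction n) (auto simp: s)
  have mem: "\<omega> n \<in> alphabet A" for n
    using it admissible_wordsD(2)[OF w] by (auto simp: \<omega>_def k_def simp del: funpow.simps)
  moreover have "entry A (\<omega> n) (\<omega> (Suc n)) = 1" for n
  proof -
    consider "Suc n < k" | "Suc n = k" | "n \<ge> k" by linarith
    then show ?thesis
    proof cases
      case 1
      then show ?thesis using admissible_wordsD(3)[OF w] by (simp add: \<omega>_def k_def)
    next
      case 2
      then have "\<omega> n = last w" "\<omega> (Suc n) = s (last w)"
        using k admissible_wordsD(1)[OF w]
        by (simp_all add: \<omega>_def k_def last_conv_nth flip: \<open>Suc n = k\<close>[unfolded k_def])
      then show ?thesis using s(2) it[of 0] by simp
    next
      case 3
      then have "\<omega> (Suc n) = s (\<omega> n)" by (simp add: \<omega>_def Suc_diff_le)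
      then show ?thesis using s(2) mem by simp
    qed
  qed
  ultimately have "\<omega> \<in> subshift A" by (simp add: subshift_def)
  then have "\<omega> \<in> cylinder A w" by (simp add: mem_cylinder \<omega>_def k_def)
  then show ?thesis by (rule that)
qed

lemma letter_admissible: "a \<in> alphabet A \<Longrightarrow> [a] \<in> admissible_words A"
  by (rule admissible_wordsI) auto

lemma subshift_nonempty: "subshift A \<noteq> {}"
proof -
  have "[1] \<in> admissible_words A" using l_pos by (intro letter_admissible) (simp add: alphabet_eq)
  then obtain \<omega> where "\<omega> \<in> cylinder A [1]" by (rule admissible_cylinder_nonempty)
  then show ?thesis using cylinder_subset by auto
qed

lemma subshift_letter: "\<omega> \<in> subshift A \<Longrightarrow> \<omega> n \<in> alphabet A"
  by (simp add: subshift_def)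

lemma append_admissible:
  assumes "w \<in> admissible_words A" "y \<in> successors A w"
  shows "w @ [y] \<in> admissible_words A"
proof (rule admissible_wordsI)
  show "set (w @ [y]) \<subseteq> alphabet A"
    using assms admissible_wordsD(2) by (auto simp: successors_def)
  fix i assume i: "Suc i < length (w @ [y])"
  show "entry A ((w @ [y]) ! i) ((w @ [y]) ! Suc i) = 1"
  proof (cases "Suc i < length w")
    case True
    then show ?thesis using admissible_wordsD(3)[OF assms(1)] by (simp add: nth_append)
  next
    case False
    then have "Suc i = length w" using i by simp
    then have "last w = w ! i" using admissible_wordsD(1)[OF assms(1)] by (simp add: last_conv_nth flip: \<open>Suc i = length w\<close>)
    then show ?thesis using assms(2) \<open>Suc i = length w\<close> by (simp add: nth_append successors_def)
  qed
qed simp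

text \<open>Prefix cylinders form a neighbourhood base: the condition survives unions, and it
  survives intersections by passing to the longer prefix. The bound \<open>k \<ge> 1\<close>
  reflects that admissible words have at least one letter.\<close>

lemma openin_subshift_iff:
  "openin (subshift_topology A) V \<longleftrightarrow>
     V \<subseteq> subshift A \<and> (\<forall>\<omega>\<in>V. \<exists>k\<ge>1. cylinder A (map \<omega> [0..<k]) \<subseteq> V)"
proof
  assume "openin (subshift_topology A) V"
  then have "generate_topology_on (cylinder A ` admissible_words A) V"
    by (simp add: subshift_topology_def openin_topology_generated_by_iff)
  then show "V \<subseteq> subshift A \<and> (\<forall>\<omega>\<in>V. \<exists>k\<ge>1. cylinder A (map \<omega> [0..<k]) \<subseteq> V)"
  proof (induction rule: generate_topology_on.induct)
    case (Int U V)
    have "\<exists>k\<ge>1. cylinder A (map \<omega> [0..<k]) \<subseteq> U \<inter> V" if "\<omega> \<in> U \<inter> V" for \<omega>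
    proof -
      have \<omega>: "\<omega> \<in> U" "\<omega> \<in> V" using \<open>\<omega> \<in> U \<inter> V\<close> by simp_all
      obtain k where k: "k \<ge> 1" "cylinder A (map \<omega> [0..<k]) \<subseteq> U" using Int.IH(1) \<omega>(1) by auto
      obtain m where m: "m \<ge> 1" "cylinder A (map \<omega> [0..<m]) \<subseteq> V" using Int.IH(2) \<omega>(2) by auto
      have "cylinder A (map \<omega> [0..<max k m]) \<subseteq> cylinder A (map \<omega> [0..<k])"
        "cylinder A (map \<omega> [0..<max k m]) \<subseteq> cylinder A (map \<omega> [0..<m])"
        by (auto simp: mem_cylinder_prefix)
      then have "cylinder A (map \<omega> [0..<max k m]) \<subseteq> U \<inter> V" using k m by auto
      then show ?thesis using k by (intro exI[of _ "max k m"]) simp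
    qed
    then show ?case using Int.IH by auto
  next
    case (UN K)
    have "\<exists>k\<ge>1. cylinder A (map \<omega> [0..<k]) \<subseteq> \<Union>K" if \<omega>: "\<omega> \<in> \<Union>K" for \<omega>
    proof -
      obtain U where U: "U \<in> K" "\<omega> \<in> U" using \<omega> by auto
      then obtain k where "k \<ge> 1" "cylinder A (map \<omega> [0..<k]) \<subseteq> U" using UN.IH by meson
      then show ?thesis using U(1) by (intro exI[of _ k]) auto
    qed
    moreover have "\<Union>K \<subseteq> subshift A" using UN.IH by auto
    ultimately show ?case by simp
  next
    case (Basis s)
    then obtain w where w: "w \<in> admissible_words A" "s = cylinder A w" by auto
    have "length w \<ge> 1" using admissible_wordsD(1)[OF w(1)] by (simp add: Suc_le_eq)
    then show ?case
      using w cylinder_subset[of w] cylinder_prefix_eq by (auto intro!: exI[of _ "length w"])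
  qed simp
next
  assume V: "V \<subseteq> subshift A \<and> (\<forall>\<omega>\<in>V. \<exists>k\<ge>1. cylinder A (map \<omega> [0..<k]) \<subseteq> V)"
  have "\<exists>T. openin (subshift_topology A) T \<and> \<omega> \<in> T \<and> T \<subseteq> V" if \<omega>: "\<omega> \<in> V" for \<omega>
  proof -
    obtain k where k: "k \<ge> 1" "cylinder A (map \<omega> [0..<k]) \<subseteq> V" using V \<omega> by meson
    have "\<omega> \<in> subshift A" using V \<omega> by auto
    then have "openin (subshift_topology A) (cylinder A (map \<omega> [0..<k]))"
      unfolding subshift_topology_def openin_topology_generated_by_iff
      using subshift_prefix_admissible k(1) by (intro generate_topology_on.Basis) auto
    moreover have "\<omega> \<in> cylinder A (map \<omega> [0..<k])"
      using \<open>\<omega> \<in> subshift A\<close> by (simp add: mem_cylinder_prefix)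
    ultimately show ?thesis using k(2) by (intro exI[of _ "cylinder A (map \<omega> [0..<k])"]) simp
  qed
  then show "openin (subshift_topology A) V" by (subst openin_subopen) simp
qed

lemma topspace_subshift [simp]: "topspace (subshift_topology A) = subshift A"
proof -
  have "openin (subshift_topology A) (subshift A)"
    unfolding openin_subshift_iff using cylinder_subset by (auto intro!: exI[of _ 1])
  moreover have "topspace (subshift_topology A) \<subseteq> subshift A"
    using openin_subshift_iff openin_topspace by meson
  ultimately show ?thesis using openin_subset by auto
qed

lemma openin_cylinder: "openin (subshift_topology A) (cylinder A w)"
proof -
  \<comment> \<open>The witness is one more than the length of \<open>w\<close>, so that it is
    positive for the empty word too.\<close>
  have "\<exists>k\<ge>1. cylinder A (map \<omega> [0..<k]) \<subseteq> cylinder A w" if "\<omega> \<in> cylinder A w" for \<omega>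
    by (rule exI[of _ "Suc (length w)"])
      (use that in \<open>auto simp: mem_cylinder_prefix mem_cylinder[of _ w] simp del: upt_Suc\<close>)
  then show ?thesis unfolding openin_subshift_iff using cylinder_subset by auto
qed

text \<open>By Tychonoff the sequences over the finite discrete alphabet form a compact space, in
  which the subshift is closed. The identity from the subspace topology to the cylinder topology is
  continuous, so compactness carries over.\<close>

lemma compact_subshift: "compact_space (subshift_topology A)"
proof -
  let ?P = "product_topology (\<lambda>_::nat. discrete_topology (alphabet A)) UNIV"
  have "compact_space (discrete_topology (alphabet A))"
    by (simp add: compact_space_discrete_topology)
  then have P: "compact_space ?P" by (simp add: compact_space_product_topology)
  have tP: "topspace ?P = {\<omega>. \<forall>k. \<omega> k \<in> alphabet A}"
    by (auto simp: PiE_UNIV_domain)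
  have open_coord: "openin ?P {\<omega> \<in> topspace ?P. \<omega> k = a}" for k a
  proof -
    have "continuous_map ?P (discrete_topology (alphabet A)) (\<lambda>\<omega>. \<omega> k)"
      by (rule continuous_map_product_projection) simp
    then have "openin ?P {\<omega> \<in> topspace ?P. \<omega> k \<in> {a} \<inter> alphabet A}"
      by (rule openin_continuous_map_preimage) simp
    moreover have "{\<omega> \<in> topspace ?P. \<omega> k \<in> {a} \<inter> alphabet A} = {\<omega> \<in> topspace ?P. \<omega> k = a}"
      unfolding tP by auto
    ultimately show ?thesis by simp
  qed
  have sub: "subshift A \<subseteq> topspace ?P" unfolding tP by (auto simp: subshift_def)
  have "closedin ?P (subshift A)"
  proof -
    \<comment> \<open>A sequence of letters lies outside the subshift exactly if it has a forbidden
      transition at some position, an open condition on two coordinates.\<close>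
    have eq: "topspace ?P - subshift A =
        (\<Union>(k, a, b)\<in>{(k, a, b). entry A a b \<noteq> 1}. {\<omega> \<in> topspace ?P. \<omega> k = a} \<inter> {\<omega> \<in> topspace ?P. \<omega> (Suc k) = b})"
      unfolding tP by (auto simp: subshift_def)
    have "openin ?P (topspace ?P - subshift A)"
      unfolding eq using open_coord by (intro openin_Union) (auto intro!: openin_Int)
    then show ?thesis using sub by (simp add: closedin_def)
  qed
  then have "compactin ?P (subshift A)" by (rule closedin_compact_space[OF P])
  then have c: "compactin (subtopology ?P (subshift A)) (subshift A)"
    by (simp add: compactin_subtopology)
  have tS: "topspace (subtopology ?P (subshift A)) = subshift A"
    using sub by (simp add: Int_absorb1)
  have "continuous_map (subtopology ?P (subshift A)) (subshift_topology A) (\<lambda>\<omega>. \<omega>)"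
    unfolding continuous_map_def tS topspace_subshift
  proof (intro conjI allI impI)
    fix V assume V: "openin (subshift_topology A) V"
    have "\<exists>T. openin (subtopology ?P (subshift A)) T \<and> \<omega> \<in> T \<and> T \<subseteq> V" if \<omega>: "\<omega> \<in> V" for \<omega>
    proof -
      obtain k where k: "k \<ge> 1" "cylinder A (map \<omega> [0..<k]) \<subseteq> V"
        using V \<omega> unfolding openin_subshift_iff by meson
      have \<omega>S: "\<omega> \<in> subshift A" using V \<omega> unfolding openin_subshift_iff by auto
      let ?T = "\<Inter>i\<in>{..<k}. {\<upsilon> \<in> topspace ?P. \<upsilon> i = \<omega> i}"
      \<comment> \<open>Here \<open>k \<ge> 1\<close> matters: an intersection over no indices would
        be the whole type.\<close>
      have "openin ?P ?T" using k(1) open_coord by (intro openin_INT2) (auto simp: lessThan_empty_iff)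
      then have "openin (subtopology ?P (subshift A)) (?T \<inter> subshift A)"
        by (rule openin_subtopology_Int)
      moreover have "\<omega> \<in> ?T \<inter> subshift A" using \<omega>S sub by auto
      moreover have "?T \<inter> subshift A \<subseteq> cylinder A (map \<omega> [0..<k])"
        by (auto simp: mem_cylinder_prefix)
      ultimately show ?thesis using k(2) by (meson order_trans)
    qed
    then have "openin (subtopology ?P (subshift A)) V" by (subst openin_subopen) simp
    moreover have "{\<omega> \<in> subshift A. \<omega> \<in> V} = V" using V openin_subshift_iff by auto
    ultimately show "openin (subtopology ?P (subshift A)) {\<omega> \<in> subshift A. \<omega> \<in> V}" by simp
  qed simp
  from image_compactin[OF c this] show ?thesis by (simp add: compact_space_def)
qed

sublocale compact_nonempty_space "subshift_topology A"
  by unfold_locales (simp_all add: compact_subshift subshift_nonempty)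

text \<open>The depth \<open>n\<close> is recorded because it tells on which cylinders the function
  is constant. The codomain is arbitrary to cover the real functions \<open>b\<close> and complex
  functions alike.\<close>

definition locally_constant :: "nat \<Rightarrow> ((nat \<Rightarrow> nat) \<Rightarrow> 'b) \<Rightarrow> bool" where
  "locally_constant n f \<longleftrightarrow>
     (\<forall>\<omega>\<in>subshift A. \<forall>\<upsilon>\<in>subshift A. (\<forall>i<n. \<omega> i = \<upsilon> i) \<longrightarrow> f \<omega> = f \<upsilon>)"

lemma locally_constantD:
  "\<lbrakk>locally_constant n f; \<omega> \<in> subshift A; \<upsilon> \<in> subshift A; \<And>i. i < n \<Longrightarrow> \<omega> i = \<upsilon> i\<rbrakk> \<Longrightarrow> f \<omega> = f \<upsilon>"
  unfolding locally_constant_def by meson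

lemma locally_constant_mono: "locally_constant n f \<Longrightarrow> n \<le> m \<Longrightarrow> locally_constant m f"
  unfolding locally_constant_def by (meson order_less_le_trans)

lemma locally_constant_compose:
  assumes "locally_constant n f"
  shows "locally_constant n (\<lambda>\<omega>. g (f \<omega>))"
  unfolding locally_constant_def
proof (intro ballI impI arg_cong[where f = g])
  fix \<omega> \<upsilon> assume "\<omega> \<in> subshift A" "\<upsilon> \<in> subshift A" "\<forall>i<n. \<omega> i = \<upsilon> i"
  then show "f \<omega> = f \<upsilon>" by (intro locally_constantD[OF assms]) simp_all
qed

lemma locally_constant_openin:
  assumes "locally_constant n f"
  shows "openin (subshift_topology A) {\<omega> \<in> subshift A. f \<omega> \<in> S}"
proof -
  have "\<exists>k\<ge>1. cylinder A (map \<omega> [0..<k]) \<subseteq> {\<omega> \<in> subshift A. f \<omega> \<in> S}"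
    if "\<omega> \<in> subshift A" "f \<omega> \<in> S" for \<omega>
  proof (intro exI[of _ "Suc n"] conjI subsetI)
    fix \<upsilon> assume "\<upsilon> \<in> cylinder A (map \<omega> [0..<Suc n])"
    then have "\<upsilon> \<in> subshift A" "\<forall>i<n. \<omega> i = \<upsilon> i"
      by (auto simp: mem_cylinder_prefix simp del: upt_Suc)
    then have "\<upsilon> \<in> subshift A" "f \<omega> = f \<upsilon>"
      by (simp, intro locally_constantD[OF assms that(1)], simp_all)
    then show "\<upsilon> \<in> {\<omega> \<in> subshift A. f \<omega> \<in> S}" using that by simp
  qed simp
  then show ?thesis unfolding openin_subshift_iff by auto
qed

lemma locally_constant_continuous:
  assumes "locally_constant n f"
  shows "continuous_map (subshift_topology A) euclidean f"
  unfolding continuous_map_def using locally_constant_openin[OF assms] by simp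

text \<open>Compactness supplies one depth \<open>n\<close> for the whole space; the approximant
  takes the value of \<open>f\<close> at one chosen point of each cylinder of that depth.\<close>

lemma locally_constant_dense:
  assumes f: "f \<in> carrier CY" and \<epsilon>: "\<epsilon> > 0"
  obtains n g where "g \<in> carrier CY" "locally_constant n g"
    "\<And>\<omega>. \<omega> \<in> subshift A \<Longrightarrow> cmod (f \<omega> - g \<omega>) \<le> \<epsilon>"
proof -
  have cont: "continuous_map (subshift_topology A) euclidean f"
    using f by (simp add: continuous_functions_carrier_iff)
  have "\<exists>k\<ge>1. \<forall>\<upsilon>\<in>cylinder A (map \<omega> [0..<k]). cmod (f \<upsilon> - f \<omega>) < \<epsilon> / 2" if \<omega>: "\<omega> \<in> subshift A" for \<omega>
  proof -
    have "openin (subshift_topology A) {\<upsilon> \<in> topspace (subshift_topology A). f \<upsilon> \<in> ball (f \<omega>) (\<epsilon> / 2)}"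
      by (rule openin_continuous_map_preimage[OF cont]) simp
    then obtain k where "k \<ge> 1" "cylinder A (map \<omega> [0..<k]) \<subseteq> {\<upsilon> \<in> subshift A. f \<upsilon> \<in> ball (f \<omega>) (\<epsilon> / 2)}"
      unfolding openin_subshift_iff using \<omega> \<epsilon> by auto
    then show ?thesis by (intro exI[of _ k]) (auto simp: dist_norm norm_minus_commute)
  qed
  then obtain k where k: "\<And>\<omega> \<upsilon>. \<lbrakk>\<omega> \<in> subshift A; \<upsilon> \<in> cylinder A (map \<omega> [0..<k \<omega>])\<rbrakk> \<Longrightarrow> cmod (f \<upsilon> - f \<omega>) < \<epsilon> / 2"
    by metis
  let ?C = "\<lambda>\<omega>. cylinder A (map \<omega> [0..<k \<omega>])"
  have self: "\<omega> \<in> ?C \<omega>" if "\<omega> \<in> subshift A" for \<omega> using that by (simp add: mem_cylinder_prefix)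
  have cpt: "compactin (subshift_topology A) (subshift A)"
    using compact_subshift by (simp add: compact_space_def)
  have "subshift A \<subseteq> \<Union>(?C ` subshift A)" using self by auto
  then have "\<exists>F. finite F \<and> F \<subseteq> ?C ` subshift A \<and> subshift A \<subseteq> \<Union>F"
    by (intro compactinD[OF cpt]) (auto intro: openin_cylinder)
  then obtain F where F: "finite F" "F \<subseteq> ?C ` subshift A" "subshift A \<subseteq> \<Union>F" by auto
  then obtain S where S: "S \<subseteq> subshift A" "finite S" "F = ?C ` S"
    by (meson finite_subset_image)
  define n where "n = Max (insert 0 (k ` S))"
  have n: "k \<omega> \<le> n" if "\<omega> \<in> S" for \<omega> using that S(2) by (simp add: n_def)
  have close: "cmod (f \<omega> - f \<upsilon>) \<le> \<epsilon>"
    if \<omega>: "\<omega> \<in> subshift A" and \<upsilon>: "\<upsilon> \<in> subshift A" and eq: "\<And>i. i < n \<Longrightarrow> \<omega> i = \<upsilon> i" for \<omega> \<upsilon>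
  proof -
    obtain \<tau> where \<tau>: "\<tau> \<in> S" "\<omega> \<in> ?C \<tau>" using F(3) S(3) \<omega> by auto
    then have "\<upsilon> \<in> ?C \<tau>" using n[OF \<tau>(1)] eq \<upsilon> by (simp add: mem_cylinder_prefix)
    moreover have "\<tau> \<in> subshift A" using S \<tau> by auto
    ultimately have "cmod (f \<omega> - f \<tau>) < \<epsilon> / 2" "cmod (f \<upsilon> - f \<tau>) < \<epsilon> / 2"
      using k \<tau> by simp_all
    then show ?thesis using norm_triangle_ineq4[of "f \<omega> - f \<tau>" "f \<upsilon> - f \<tau>"] by simp
  qed
  \<comment> \<open>The point is chosen from the prefix alone, which makes \<open>g\<close> depend
    on the first \<open>n\<close> letters only.\<close>
  define rep where "rep \<omega> = (SOME \<upsilon>. \<upsilon> \<in> cylinder A (map \<omega> [0..<n]))" for \<omega> :: "nat \<Rightarrow> nat"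
  have rep: "rep \<omega> \<in> cylinder A (map \<omega> [0..<n])" if "\<omega> \<in> subshift A" for \<omega>
    unfolding rep_def by (rule someI[of _ \<omega>]) (use that in \<open>simp add: mem_cylinder_prefix\<close>)
  have rep_eq: "rep \<omega> = rep \<upsilon>" if "\<And>i. i < n \<Longrightarrow> \<omega> i = \<upsilon> i" for \<omega> \<upsilon>
  proof -
    have "map \<omega> [0..<n] = map \<upsilon> [0..<n]" using that by simp
    then show ?thesis unfolding rep_def by (simp only:)
  qed
  define g where "g = (\<lambda>\<omega>\<in>subshift A. f (rep \<omega>))"
  have lc: "locally_constant n g"
    unfolding locally_constant_def
  proof (intro ballI impI)
    fix \<omega> \<upsilon> assume "\<omega> \<in> subshift A" "\<upsilon> \<in> subshift A" "\<forall>i<n. \<omega> i = \<upsilon> i"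
    then show "g \<omega> = g \<upsilon>" using rep_eq[of \<omega> \<upsilon>] by (simp add: g_def)
  qed
  show ?thesis
  proof (rule that)
    show "g \<in> carrier CY"
      using locally_constant_continuous[OF lc] by (simp add: continuous_functions_carrier_iff g_def)
    show "locally_constant n g" by (rule lc)
    fix \<omega> assume \<omega>: "\<omega> \<in> subshift A"
    show "cmod (f \<omega> - g \<omega>) \<le> \<epsilon>"
      unfolding g_def using close[OF \<omega>, of "rep \<omega>"] rep[OF \<omega>] \<omega> by (simp add: mem_cylinder_prefix)
  qed
qed

section \<open>The Borel sigma-algebra and its generator\<close>

lemma countable_admissible: "countable (admissible_words A)"
  by (rule countable_subset[of _ UNIV]) auto

text \<open>There are only countably many cylinders, so every open set is a countable union of
  them.\<close>

lemma sets_subshift_borel: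
  "sets (subshift_borel A) = sigma_sets (subshift A) (cylinder A ` admissible_words A)"
proof -
  let ?O = "{V. openin (subshift_topology A) V}"
  have O: "?O \<subseteq> Pow (subshift A)" using openin_subshift_iff by auto
  have "sets (subshift_borel A) = sigma_sets (subshift A) ?O"
    unfolding subshift_borel_def using O by (rule sets_measure_of)
  also have "\<dots> = sigma_sets (subshift A) (cylinder A ` admissible_words A)"
  proof (rule sigma_sets_eqI)
    fix V assume V: "V \<in> ?O"
    have "V = \<Union>(cylinder A ` {w \<in> admissible_words A. cylinder A w \<subseteq> V})"
    proof (intro equalityI subsetI)
      fix \<omega> assume \<omega>: "\<omega> \<in> V"
      then obtain k where k: "k \<ge> 1" "cylinder A (map \<omega> [0..<k]) \<subseteq> V" and \<omega>S: "\<omega> \<in> subshift A"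
        using V unfolding openin_subshift_iff mem_Collect_eq by (meson subsetD)
      then show "\<omega> \<in> \<Union>(cylinder A ` {w \<in> admissible_words A. cylinder A w \<subseteq> V})"
        using subshift_prefix_admissible[OF \<omega>S k(1)]
        by (intro UN_I[of "map \<omega> [0..<k]"]) (simp_all add: mem_cylinder_prefix)
    qed auto
    moreover have "\<Union>(cylinder A ` {w \<in> admissible_words A. cylinder A w \<subseteq> V})
        \<in> sigma_sets (subshift A) (cylinder A ` admissible_words A)"
      by (intro sigma_sets_UNION countable_image countable_subset[OF _ countable_admissible])
        (auto intro: sigma_sets.Basic)
    ultimately show "V \<in> sigma_sets (subshift A) (cylinder A ` admissible_words A)" by simp
  next
    fix V assume "V \<in> cylinder A ` admissible_words A"
    then show "V \<in> sigma_sets (subshift A) ?O"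
      using openin_cylinder by (auto intro!: sigma_sets.Basic)
  qed
  finally show ?thesis .
qed

text \<open>Two cylinders are nested or disjoint, and the empty set is added for the second case.
  This prepares the induction over generated sets in the proof of totality.\<close>

lemma Int_stable_cylinders: "Int_stable (insert {} (cylinder A ` admissible_words A))"
proof -
  have *: "cylinder A u \<inter> cylinder A v \<in> {{}, cylinder A v}" if "length u \<le> length v" for u v
  proof (cases "cylinder A u \<inter> cylinder A v = {}")
    case False
    then obtain \<omega> where "\<omega> \<in> cylinder A u" "\<omega> \<in> cylinder A v" by auto
    then have "u ! i = v ! i" if "i < length u" for i
      using that \<open>length u \<le> length v\<close> by (simp add: mem_cylinder)
    then have "cylinder A v \<subseteq> cylinder A u"
      using that by (auto simp: mem_cylinder)
    then show ?thesis by auto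
  qed simp
  have "cylinder A u \<inter> cylinder A v \<in> insert {} (cylinder A ` admissible_words A)"
    if "u \<in> admissible_words A" "v \<in> admissible_words A" for u v
    using *[of u v] *[of v u] that by (cases "length u \<le> length v") (auto simp: Int_commute)
  then show ?thesis by (auto simp: Int_stable_def)
qed

end

section \<open>Gibbs measures\<close>

locale gibbs_subshift = subshift_matrix +
  fixes \<phi> :: "(nat \<Rightarrow> nat) \<Rightarrow> real" and \<mu> :: "(nat \<Rightarrow> nat) measure"
  assumes potential: "continuous_map (subshift_topology A) euclideanreal \<phi>"
    and gibbs: "gibbs_measure A \<phi> \<mu>"

sublocale gibbs_subshift \<subseteq> prob_space \<mu>
  using gibbs by (simp add: gibbs_measure_def borel_probability_def)

context gibbs_subshift
begin

abbreviation mass :: "nat list \<Rightarrow> real" where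
  "mass w \<equiv> measure \<mu> (cylinder A w)"

lemma sets_gibbs: "sets \<mu> = sigma_sets (subshift A) (cylinder A ` admissible_words A)"
  using gibbs sets_subshift_borel by (simp add: gibbs_measure_def borel_probability_def)

lemma space_gibbs [simp]: "space \<mu> = subshift A"
proof -
  have "sets \<mu> = sets (subshift_borel A)"
    using gibbs by (simp add: gibbs_measure_def borel_probability_def)
  then have "space \<mu> = space (subshift_borel A)" by (rule sets_eq_imp_space_eq)
  then show ?thesis by (simp add: subshift_borel_def space_measure_of_conv)
qed

lemma mass_subshift [simp]: "measure \<mu> (subshift A) = 1"
  using prob_space by simp

lemma openin_sets: "openin (subshift_topology A) V \<Longrightarrow> V \<in> sets \<mu>"
proof -
  assume V: "openin (subshift_topology A) V"
  have "sets \<mu> = sets (subshift_borel A)"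
    using gibbs by (simp add: gibbs_measure_def borel_probability_def)
  moreover have "{V. openin (subshift_topology A) V} \<subseteq> Pow (subshift A)"
    using openin_subset[of "subshift_topology A"] by auto
  ultimately show ?thesis using V by (simp add: subshift_borel_def sets_measure_of sigma_sets.Basic)
qed

lemma cylinder_sets [measurable, simp]: "cylinder A w \<in> sets \<mu>"
  by (rule openin_sets) (rule openin_cylinder)

lemma continuous_measurable:
  fixes f :: "(nat \<Rightarrow> nat) \<Rightarrow> 'b::topological_space"
  assumes "continuous_map (subshift_topology A) euclidean f"
  shows "f \<in> borel_measurable \<mu>"
proof (rule borel_measurableI)
  fix S :: "'b set" assume "open S"
  then have "openin (subshift_topology A) {x \<in> topspace (subshift_topology A). f x \<in> S}"
    by (intro openin_continuous_map_preimage[OF assms]) simp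
  moreover have "f -` S \<inter> space \<mu> = {x \<in> topspace (subshift_topology A). f x \<in> S}" by auto
  ultimately show "f -` S \<inter> space \<mu> \<in> sets \<mu>" using openin_sets by simp
qed

lemma gibbs_bounds:
  obtains c where "c > 1"
    "\<And>k \<omega>. \<lbrakk>k \<ge> 1; \<omega> \<in> subshift A\<rbrakk> \<Longrightarrow>
      exp (birkhoff_sum \<phi> k \<omega> - real k * pressure A \<phi>) / c \<le> mass (map \<omega> [0..<k])"
    "\<And>k \<omega>. \<lbrakk>k \<ge> 1; \<omega> \<in> subshift A\<rbrakk> \<Longrightarrow>
      mass (map \<omega> [0..<k]) \<le> c * exp (birkhoff_sum \<phi> k \<omega> - real k * pressure A \<phi>)"
proof -
  obtain c where c: "c > 1" "\<And>k \<omega>. \<lbrakk>k \<ge> 1; \<omega> \<in> subshift A\<rbrakk> \<Longrightarrow>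
        1 / c \<le> mass (map \<omega> [0..<k]) / exp (birkhoff_sum \<phi> k \<omega> - real k * pressure A \<phi>) \<and>
        mass (map \<omega> [0..<k]) / exp (birkhoff_sum \<phi> k \<omega> - real k * pressure A \<phi>) \<le> c"
    using gibbs unfolding gibbs_measure_def by meson
  show ?thesis
  proof (rule that[OF c(1)])
    fix k \<omega> assume k: "k \<ge> (1::nat)" "\<omega> \<in> subshift A"
    let ?E = "exp (birkhoff_sum \<phi> k \<omega> - real k * pressure A \<phi>)"
    have "?E > 0" by simp
    then show "?E / c \<le> mass (map \<omega> [0..<k])" "mass (map \<omega> [0..<k]) \<le> c * ?E"
      using c(2)[OF k] c(1) by (simp_all add: field_simps del: exp_gt_zero)
  qed
qed

text \<open>The lower Gibbs bound at any point of the cylinder. It makes the denominators of the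
  Dirac operator nonzero and gives the measure full support.\<close>

lemma mass_pos:
  assumes w: "w \<in> admissible_words A"
  shows "mass w > 0"
proof -
  obtain c where c: "c > 1" "\<And>k \<omega>. \<lbrakk>k \<ge> 1; \<omega> \<in> subshift A\<rbrakk> \<Longrightarrow>
      exp (birkhoff_sum \<phi> k \<omega> - real k * pressure A \<phi>) / c \<le> mass (map \<omega> [0..<k])"
    using gibbs_bounds by metis
  obtain \<omega> where \<omega>: "\<omega> \<in> cylinder A w" using w by (rule admissible_cylinder_nonempty)
  have "length w \<ge> 1" using admissible_wordsD(1)[OF w] by (simp add: Suc_le_eq)
  then have "exp (birkhoff_sum \<phi> (length w) \<omega> - real (length w) * pressure A \<phi>) / c \<le> mass w"
    using c(2)[of "length w" \<omega>] \<omega> cylinder_subset[of w] cylinder_prefix_eq[OF \<omega>] by auto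
  moreover have "0 < exp (birkhoff_sum \<phi> (length w) \<omega> - real (length w) * pressure A \<phi>) / c"
    using c(1) by simp
  ultimately show ?thesis by linarith
qed

lemma left_shift_subshift: "\<omega> \<in> subshift A \<Longrightarrow> (left_shift ^^ m) \<omega> \<in> subshift A"
  by (induction m) (auto simp: left_shift_def subshift_def)

text \<open>Both Gibbs bounds are used at the same point of the smaller cylinder, so that only the
  boundedness of the potential enters.\<close>

lemma child_mass_ratio:
  obtains \<kappa> where "\<kappa> > 0"
    "\<And>w y. \<lbrakk>w \<in> admissible_words A; y \<in> successors A w\<rbrakk> \<Longrightarrow> \<kappa> * mass w \<le> mass (w @ [y])"
proof -
  obtain c where c: "c > 1"
    and lower: "\<And>k \<omega>. \<lbrakk>k \<ge> 1; \<omega> \<in> subshift A\<rbrakk> \<Longrightarrow>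
      exp (birkhoff_sum \<phi> k \<omega> - real k * pressure A \<phi>) / c \<le> mass (map \<omega> [0..<k])"
    and upper: "\<And>k \<omega>. \<lbrakk>k \<ge> 1; \<omega> \<in> subshift A\<rbrakk> \<Longrightarrow>
      mass (map \<omega> [0..<k]) \<le> c * exp (birkhoff_sum \<phi> k \<omega> - real k * pressure A \<phi>)"
    using gibbs_bounds by metis
  have "compactin euclideanreal (\<phi> ` subshift A)"
    using image_compactin[OF _ potential, of "subshift A"] compact_subshift
    by (simp add: compact_space_def)
  then have "bounded (\<phi> ` subshift A)" by (simp add: compact_imp_bounded)
  then obtain B where B: "\<And>\<omega>. \<omega> \<in> subshift A \<Longrightarrow> \<bar>\<phi> \<omega>\<bar> \<le> B"
    by (auto simp: bounded_iff)
  let ?P = "pressure A \<phi>"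
  \<comment> \<open>One more letter adds one value of the potential, at least \<open>- B\<close>,
    and subtracts the pressure once; each of the two Gibbs bounds costs a factor
    \<open>c\<close>.\<close>
  define \<kappa> where "\<kappa> = exp (- B - ?P) / (c * c)"
  have "\<kappa> * mass w \<le> mass (w @ [y])" if w: "w \<in> admissible_words A" and y: "y \<in> successors A w" for w y
  proof -
    let ?k = "length w"
    have k: "?k \<ge> 1" using admissible_wordsD(1)[OF w] by (simp add: Suc_le_eq)
    obtain \<omega> where \<omega>: "\<omega> \<in> cylinder A (w @ [y])"
      using append_admissible[OF w y] by (rule admissible_cylinder_nonempty)
    have \<omega>S: "\<omega> \<in> subshift A" using \<omega> cylinder_subset by auto
    have wy: "map \<omega> [0..<Suc ?k] = w @ [y]" using cylinder_prefix_eq[OF \<omega>] by simp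
    then have wk: "map \<omega> [0..<?k] = w" by simp
    let ?E = "\<lambda>k. exp (birkhoff_sum \<phi> k \<omega> - real k * ?P)"
    have "mass w \<le> c * ?E ?k" using upper[OF k \<omega>S] wk by simp
    then have "\<kappa> * mass w \<le> \<kappa> * (c * ?E ?k)"
      using c by (intro mult_left_mono) (simp_all add: \<kappa>_def)
    also have "\<dots> = exp (- B - ?P) * ?E ?k / c"
      using c by (simp add: \<kappa>_def)
    also have "\<dots> \<le> exp (\<phi> ((left_shift ^^ ?k) \<omega>) - ?P) * ?E ?k / c"
      using B[OF left_shift_subshift[OF \<omega>S], of ?k] c
      by (intro divide_right_mono mult_right_mono) auto
    also have "\<dots> = ?E (Suc ?k) / c"
      by (simp add: birkhoff_sum_def exp_add[symmetric] algebra_simps)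
    also have "\<dots> \<le> mass (w @ [y])"
      using lower[of "Suc ?k" \<omega>] \<omega>S unfolding wy by simp
    finally show ?thesis .
  qed
  moreover have "\<kappa> > 0" using c by (simp add: \<kappa>_def)
  ultimately show ?thesis using that by blast
qed

lemma alpha_eq_card:
  assumes w: "w \<in> admissible_words A"
  shows "alpha A w = card (successors A w)"
proof -
  have last: "last w \<in> alphabet A" using admissible_wordsD(1,2)[OF w] last_in_set by blast
  have "alpha A w = (\<Sum>i\<in>alphabet A. if entry A (last w) i = 1 then 1 else 0)"
    unfolding alpha_def
    by (rule sum.cong) (use entries last in \<open>auto simp: alphabet_eq\<close>)
  also have "\<dots> = card (successors A w)"
    by (simp add: successors_def sum.If_cases Int_def)
  finally show ?thesis .
qed

lemma cylinder_append:
  "cylinder A (w @ [y]) = {\<omega> \<in> cylinder A w. \<omega> (length w) = y}"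
  by (auto simp: mem_cylinder nth_append less_Suc_eq)

text \<open>Along a fixed point, every passage through a branching word of mass at least \<open>\<epsilon>\<close> costs a
  fixed amount of mass, so the heavy branching words cover each point boundedly often; integrating
  this multiplicity bounds their number.\<close>

lemma finite_heavy_branching:
  assumes \<epsilon>: "\<epsilon> > 0"
  shows "finite {w \<in> admissible_words A. alpha A w \<ge> 2 \<and> \<epsilon> \<le> mass w}" (is "finite ?W")
proof -
  obtain \<kappa> where \<kappa>: "\<kappa> > 0"
    and ratio: "\<And>w y. \<lbrakk>w \<in> admissible_words A; y \<in> successors A w\<rbrakk> \<Longrightarrow> \<kappa> * mass w \<le> mass (w @ [y])"
    using child_mass_ratio by metis
  let ?N = "1 / (\<kappa> * \<epsilon>)"
  \<comment> \<open>Induction along the point: the mass of the current prefix together with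
    \<open>\<kappa> * \<epsilon>\<close> for each earlier visit to \<open>F\<close> never exceeds 1,
    the mass of the whole space.\<close>
  have visits: "mass (map \<omega> [0..<K]) + \<kappa> * \<epsilon> * card {k \<in> {..<K}. map \<omega> [0..<k] \<in> F} \<le> 1"
    if \<omega>: "\<omega> \<in> subshift A" and F: "F \<subseteq> ?W" for \<omega> F K
  proof (induction K)
    case (Suc K)
    let ?w = "map \<omega> [0..<K]"
    have prefix: "map \<omega> [0..<Suc K] = ?w @ [\<omega> K]" by simp
    show ?case
    proof (cases "?w \<in> F")
      case False
      then have "{k \<in> {..<Suc K}. map \<omega> [0..<k] \<in> F} = {k \<in> {..<K}. map \<omega> [0..<k] \<in> F}"
        by (auto simp: less_Suc_eq)
      moreover have "mass (?w @ [\<omega> K]) \<le> mass ?w"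
        by (rule finite_measure_mono) (auto simp: cylinder_append)
      ultimately show ?thesis using Suc.IH unfolding prefix by simp
    next
      case True
      then have w: "?w \<in> admissible_words A" "alpha A ?w \<ge> 2" "\<epsilon> \<le> mass ?w" using F by auto
      have "{k \<in> {..<Suc K}. map \<omega> [0..<k] \<in> F} = insert K {k \<in> {..<K}. map \<omega> [0..<k] \<in> F}"
        using True by (auto simp: less_Suc_eq)
      then have card: "card {k \<in> {..<Suc K}. map \<omega> [0..<k] \<in> F} = Suc (card {k \<in> {..<K}. map \<omega> [0..<k] \<in> F})"
        by simp
      \<comment> \<open>A branching word has a second successor \<open>z\<close>. Its cylinder is
        left behind when the point moves on, and its mass pays for the visit.\<close>
      have "card (successors A ?w - {\<omega> K}) \<ge> 1"
        using w alpha_eq_card[OF w(1)] diff_card_le_card_Diff[of "{\<omega> K}" "successors A ?w"] by simp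
      then have "successors A ?w - {\<omega> K} \<noteq> {}" by (metis card.empty not_one_le_zero)
      then obtain z where z: "z \<in> successors A ?w" "z \<noteq> \<omega> K" by blast
      have "mass (?w @ [\<omega> K]) + mass (?w @ [z]) =
          measure \<mu> (cylinder A (?w @ [\<omega> K]) \<union> cylinder A (?w @ [z]))"
        by (rule finite_measure_Union[symmetric], rule cylinder_sets, rule cylinder_sets)
          (use z in \<open>auto simp: cylinder_append\<close>)
      also have "\<dots> \<le> mass ?w"
        by (rule finite_measure_mono) (auto simp: cylinder_append)
      finally have "mass (?w @ [\<omega> K]) + mass (?w @ [z]) \<le> mass ?w" .
      moreover have "\<kappa> * \<epsilon> \<le> mass (?w @ [z])"
        using ratio[OF w(1) z(1)] mult_left_mono[OF w(3), of \<kappa>] \<kappa> by linarith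
      ultimately show ?thesis using Suc.IH unfolding prefix card by (simp add: algebra_simps)
    qed
  qed simp
  have bound: "\<epsilon> * card F \<le> ?N" if F: "finite F" "F \<subseteq> ?W" for F
  proof -
    \<comment> \<open>Every word of \<open>F\<close> is shorter than \<open>?K\<close>, so each one
      whose cylinder contains the point is counted as a visit.\<close>
    let ?K = "Suc (Max (insert 0 (length ` F)))"
    have mult: "(\<Sum>w\<in>F. indicator (cylinder A w) \<omega>) \<le> ?N" if \<omega>: "\<omega> \<in> subshift A" for \<omega>
    proof -
      have "(\<Sum>w\<in>F. indicator (cylinder A w) \<omega> :: real) = card {w \<in> F. \<omega> \<in> cylinder A w}"
        using F(1) by (simp add: indicator_def sum.If_cases Int_def)
      also have "card {w \<in> F. \<omega> \<in> cylinder A w} \<le> card {k \<in> {..<?K}. map \<omega> [0..<k] \<in> F}"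
      proof (rule card_inj_on_le[of length])
        show "inj_on length {w \<in> F. \<omega> \<in> cylinder A w}"
          by (rule inj_onI) (metis (no_types, lifting) cylinder_prefix_eq mem_Collect_eq)
        show "length ` {w \<in> F. \<omega> \<in> cylinder A w} \<subseteq> {k \<in> {..<?K}. map \<omega> [0..<k] \<in> F}"
        proof (rule image_subsetI)
          fix w assume w: "w \<in> {w \<in> F. \<omega> \<in> cylinder A w}"
          then have "length w \<le> Max (insert 0 (length ` F))" using F(1) by simp
          then show "length w \<in> {k \<in> {..<?K}. map \<omega> [0..<k] \<in> F}"
            using w cylinder_prefix_eq[of \<omega> w] by simp
        qed
      qed simp
      also have "real (card {k \<in> {..<?K}. map \<omega> [0..<k] \<in> F}) \<le> ?N"
      proof -
        have "\<kappa> * \<epsilon> * card {k \<in> {..<?K}. map \<omega> [0..<k] \<in> F} \<le> 1"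
          using visits[OF \<omega> F(2), of ?K] measure_nonneg[of \<mu> "cylinder A (map \<omega> [0..<?K])"] by linarith
        then show ?thesis using \<kappa> \<epsilon> by (simp add: field_simps)
      qed
      finally show ?thesis by simp
    qed
    \<comment> \<open>The sum of the masses is the integral of the multiplicity, which
      \<open>mult\<close> bounds pointwise. Hence a finite set of heavy branching words has at most
      \<open>?N / \<epsilon>\<close> elements.\<close>
    have "\<epsilon> * card F = (\<Sum>w\<in>F. \<epsilon>)" by simp
    also have "\<dots> \<le> (\<Sum>w\<in>F. mass w)" using F by (intro sum_mono) auto
    also have "\<dots> = (\<integral>\<omega>. (\<Sum>w\<in>F. indicator (cylinder A w) \<omega>) \<partial>\<mu>)"
      by (subst Bochner_Integration.integral_sum)
        (auto simp: less_top[symmetric] Int_absorb2 cylinder_subset)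
    also have "\<dots> \<le> (\<integral>\<omega>. ?N \<partial>\<mu>)"
      by (rule integral_mono) (use mult in \<open>auto simp: less_top[symmetric]\<close>)
    also have "\<dots> = ?N" by (simp add: prob_space)
    finally show ?thesis .
  qed
  show ?thesis
  proof (rule ccontr)
    assume inf: "infinite ?W"
    obtain n :: nat where n: "?N / \<epsilon> < n" using reals_Archimedean2 by blast
    obtain F where "finite F" "card F = n" "F \<subseteq> ?W" using infinite_arbitrarily_large[OF inf] by blast
    then have "\<epsilon> * n \<le> ?N" using bound by blast
    moreover have "?N < n * \<epsilon>" using n by (simp only: pos_divide_less_eq[OF \<epsilon>])
    ultimately show False by (simp add: mult.commute)
  qed
qed

end

section \<open>Haar bases\<close>

text \<open>A left inverse of a square matrix is also a right inverse. The rows are needed to go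
  back from the functions of a node to the indicators of its children.\<close>

lemma row_orthonormal_of_col_orthonormal:
  fixes Q :: "nat \<Rightarrow> nat \<Rightarrow> real"
  assumes col: "\<And>i j. \<lbrakk>i \<in> {1..n}; j \<in> {1..n}\<rbrakk> \<Longrightarrow> (\<Sum>k=1..n. Q k i * Q k j) = (if i = j then 1 else 0)"
    and ij: "i \<in> {1..n}" "j \<in> {1..n}"
  shows "(\<Sum>k=1..n. Q i k * Q j k) = (if i = j then 1 else 0)"
proof -
  define M where "M = mat n n (\<lambda>(i, j). Q (Suc i) (Suc j))"
  have M: "M \<in> carrier_mat n n" "transpose_mat M \<in> carrier_mat n n" by (simp_all add: M_def)
  have "transpose_mat M * M = 1\<^sub>m n"
  proof (rule eq_matI)
    fix i j assume "i < dim_row (1\<^sub>m n :: real mat)" "j < dim_col (1\<^sub>m n :: real mat)"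
    then have ij: "i < n" "j < n" by simp_all
    have "(transpose_mat M * M) $$ (i, j) = (\<Sum>k<n. Q (Suc k) (Suc i) * Q (Suc k) (Suc j))"
      using ij M by (simp add: scalar_prod_def M_def lessThan_atLeast0)
    also have "\<dots> = (if Suc i = Suc j then 1 else 0)"
      using col[of "Suc i" "Suc j"] ij by (simp add: sum.atLeast1_atMost_eq)
    finally show "(transpose_mat M * M) $$ (i, j) = 1\<^sub>m n $$ (i, j)" using ij by simp
  qed (simp_all add: M_def)
  then have MM: "M * transpose_mat M = 1\<^sub>m n"
    by (rule mat_mult_left_right_inverse[OF M(2,1)])
  obtain i' j' where ij': "i = Suc i'" "i' < n" "j = Suc j'" "j' < n"
    using ij by (cases i; cases j) auto
  have "(M * transpose_mat M) $$ (i', j') = (\<Sum>k<n. Q i (Suc k) * Q j (Suc k))"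
    using ij' M by (simp add: scalar_prod_def M_def lessThan_atLeast0)
  moreover have "(M * transpose_mat M) $$ (i', j') = (if i = j then 1 else 0)"
    using MM ij' by simp
  ultimately show ?thesis by (simp add: sum.atLeast1_atMost_eq)
qed

text \<open>With \<open>r\<close> the difference of the unit vector \<open>w\<close> and the last
  standard basis vector, \<open>|r|^2 = 2 (1 - w n)\<close>, so \<open>Q\<close> is the reflection
  \<open>1 - 2 r r^T / |r|^2\<close>.\<close>

lemma Householder_col_orthonormal:
  fixes w :: "nat \<Rightarrow> real"
  assumes n: "n \<ge> 1" and unit: "(\<Sum>k=1..n. (w k)\<^sup>2) = 1"
  defines "r \<equiv> \<lambda>k. w k - (if k = n then 1 else 0)"
  defines "Q \<equiv> \<lambda>k j. (if k = j then 1 else 0) - r k * r j / (1 - w n)"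
  assumes ij: "i \<in> {1..n}" "j \<in> {1..n}"
  shows "(\<Sum>k=1..n. Q k i * Q k j) = (if i = j then 1 else 0)"
proof -
  let ?D = "1 - w n"
  have "(\<Sum>k=1..n. (r k)\<^sup>2) = (\<Sum>k=1..n. (w k)\<^sup>2 + (if k = n then 1 - 2 * w n else 0))"
    by (rule sum.cong) (auto simp: r_def power2_eq_square algebra_simps)
  also have "\<dots> = 2 * ?D"
    using n unit by (simp add: sum.distrib)
  finally have r2: "(\<Sum>k=1..n. (r k)\<^sup>2) = 2 * ?D" .
  have "(\<Sum>k=1..n. Q k i * Q k j) =
      (\<Sum>k=1..n. (if k = i then if i = j then 1 else 0 else 0)
        - (if k = i then r i * r j / ?D else 0) - (if k = j then r j * r i / ?D else 0)
        + (r k)\<^sup>2 * (r i * r j / ?D\<^sup>2))"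
    by (rule sum.cong) (auto simp: Q_def power2_eq_square algebra_simps)
  also have "\<dots> = (if i = j then 1 else 0) - 2 * (r i * r j / ?D) + 2 * ?D * (r i * r j / ?D\<^sup>2)"
    unfolding sum.distrib sum_subtractf sum_distrib_right[symmetric] r2 using ij by simp
  also have "2 * ?D * (r i * r j / ?D\<^sup>2) = 2 * (r i * r j / ?D)"
  proof -
    \<comment> \<open>Valid for \<open>d = 0\<close> as well, since both quotients are then 0; this
      is the case \<open>w n = 1\<close>, in which \<open>Q\<close> is the identity.\<close>
    have "2 * d * (x / d\<^sup>2) = 2 * (x / d)" for d x :: real
      by (simp add: power2_eq_square)
    then show ?thesis .
  qed
  finally show ?thesis by simp
qed

text \<open>The last entry of \<open>r\<close> is \<open>- (1 - w n)\<close>, so the correction to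
  the last column is \<open>r\<close> itself. If \<open>w n = 1\<close>, unit length forces the
  other entries of \<open>w\<close> to vanish, in agreement with the identity matrix.\<close>

lemma Householder_last_col:
  fixes w :: "nat \<Rightarrow> real"
  assumes n: "n \<ge> 1" and unit: "(\<Sum>k=1..n. (w k)\<^sup>2) = 1"
  defines "r \<equiv> \<lambda>k. w k - (if k = n then 1 else 0)"
  defines "Q \<equiv> \<lambda>k j. (if k = j then 1 else 0) - r k * r j / (1 - w n)"
  assumes k: "k \<in> {1..n}"
  shows "Q k n = w k"
proof (cases "w n = 1")
  case True
  have "(\<Sum>i=1..n. (w i)\<^sup>2) = (w n)\<^sup>2 + (\<Sum>i\<in>{1..n} - {n}. (w i)\<^sup>2)"
    by (rule sum.remove) (use n in auto)
  then have "(\<Sum>i\<in>{1..n} - {n}. (w i)\<^sup>2) = 0"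
    using unit True by simp
  then have "w k = (if k = n then 1 else 0)"
    using k True by (subst (asm) sum_nonneg_eq_0_iff) auto
  then show ?thesis using True by (simp add: Q_def)
next
  case False
  then show ?thesis by (simp add: Q_def r_def field_simps)
qed

locale haar_system = gibbs_subshift +
  fixes \<theta> :: "nat list \<Rightarrow> nat \<Rightarrow> nat" and U :: "nat list \<Rightarrow> real mat"
  assumes haar: "haar_choice A \<mu> \<theta> U"
begin

text \<open>The empty word is added to the words as a root, so that the summands of the Dirac operator
  over the alphabet take the same form as the others. In the place of \<open>U\<close> the root has the
  Householder reflection that sends the last unit vector to the vector of the numbers
  \<open>sqrt (mass [k])\<close>; where the denominator vanishes, the division by zero yields the identity.\<close>

definition nodes :: "nat list set" where
  "nodes = insert [] (admissible_words A)"

definition deg :: "nat list \<Rightarrow> nat" where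
  "deg v = (if v = [] then l else alpha A v)"

definition extensions :: "nat list \<Rightarrow> nat set" where
  "extensions v = (if v = [] then alphabet A else successors A v)"

definition next_letter :: "nat list \<Rightarrow> nat \<Rightarrow> nat" where
  "next_letter v k = (if v = [] then k else inv_into (successors A v) (\<theta> v) k)"

definition ch :: "nat list \<Rightarrow> nat \<Rightarrow> nat list" where
  "ch v k = v @ [next_letter v k]"

definition Q :: "nat list \<Rightarrow> nat \<Rightarrow> nat \<Rightarrow> real" where
  "Q v k j = (if v = []
     then (if k = j then 1 else 0) - (sqrt (mass [k]) - (if k = l then 1 else 0))
       * (sqrt (mass [j]) - (if j = l then 1 else 0)) / (1 - sqrt (mass [l]))
     else inner_at A \<mu> \<theta> v (frame_vec A \<mu> \<theta> v k) (U v *\<^sub>v frame_vec A \<mu> \<theta> v j))"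

text \<open>At a nonempty word the indices below \<open>deg v\<close> give the Haar functions. The
  index \<open>deg v\<close> gives the normalised indicator of the cylinder, which links a node to
  its parent.\<close>

definition b :: "nat list \<Rightarrow> nat \<Rightarrow> (nat \<Rightarrow> nat) \<Rightarrow> real" where
  "b v j \<omega> = (\<Sum>k\<in>{1..deg v}. mass (ch v k) powr (- 1 / 2) * Q v k j * indicator (cylinder A (ch v k)) \<omega>)"

lemma haar_function_eq:
  assumes "v \<noteq> []"
  shows "haar_function A \<mu> \<theta> U v j = (\<lambda>\<omega>. complex_of_real (b v j \<omega>))"
  using assms
  by (simp add: haar_function_def b_def deg_def child_mass_def child_def ch_def next_letter_def Q_def)

section \<open>The tree of words: children partition the cylinder of a node\<close>

lemma nodes_cases: "v \<in> nodes \<Longrightarrow> v = [] \<or> v \<in> admissible_words A"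
  by (simp add: nodes_def)

lemma next_letter_bij: "v \<in> nodes \<Longrightarrow> bij_betw (next_letter v) {1..deg v} (extensions v)"
proof (cases "v = []")
  case True
  then have "next_letter v = (\<lambda>k. k)" by (simp add: next_letter_def fun_eq_iff)
  then show ?thesis using True by (simp add: deg_def extensions_def alphabet_eq bij_betw_def inj_on_def)
next
  case False
  assume "v \<in> nodes"
  then have "v \<in> admissible_words A" using False nodes_cases by auto
  then have "bij_betw (\<theta> v) (successors A v) {1..alpha A v}"
    using haar by (simp add: haar_choice_def)
  from bij_betw_inv_into[OF this] have "bij_betw (inv_into (successors A v) (\<theta> v)) {1..deg v} (extensions v)"
    using False by (simp add: deg_def extensions_def)
  moreover have "next_letter v = inv_into (successors A v) (\<theta> v)"
    using False by (simp add: next_letter_def fun_eq_iff)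
  ultimately show ?thesis by simp
qed

lemma extensions_append: "\<lbrakk>v \<in> nodes; y \<in> extensions v\<rbrakk> \<Longrightarrow> v @ [y] \<in> admissible_words A"
  using append_admissible letter_admissible nodes_cases[of v] by (auto simp: extensions_def split: if_splits)

lemma ch_admissible: "\<lbrakk>v \<in> nodes; k \<in> {1..deg v}\<rbrakk> \<Longrightarrow> ch v k \<in> admissible_words A"
  unfolding ch_def using bij_betwE[OF next_letter_bij] by (intro extensions_append) auto

lemma ch_mass_pos: "\<lbrakk>v \<in> nodes; k \<in> {1..deg v}\<rbrakk> \<Longrightarrow> mass (ch v k) > 0"
  by (rule mass_pos) (rule ch_admissible)

lemma node_mass_pos: "v \<in> nodes \<Longrightarrow> mass v > 0"
  using nodes_cases[of v] mass_pos by auto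

lemma extension_of_point:
  assumes v: "v \<in> nodes" and \<omega>: "\<omega> \<in> cylinder A v"
  shows "\<omega> (length v) \<in> extensions v"
proof (cases "v = []")
  case True
  then show ?thesis using \<omega> by (simp add: extensions_def subshift_letter)
next
  case False
  obtain m where m: "length v = Suc m" using False by (cases v) auto
  have \<omega>S: "\<omega> \<in> subshift A" "\<omega> m = v ! m" using \<omega> m by (auto simp: mem_cylinder)
  have "last v = \<omega> m" using False m \<omega>S by (simp add: last_conv_nth)
  then show ?thesis using \<omega>S(1) False m by (simp add: extensions_def successors_def subshift_def)
qed

lemma ch_cover:
  assumes v: "v \<in> nodes" and \<omega>: "\<omega> \<in> cylinder A v"
  shows "\<exists>k\<in>{1..deg v}. \<omega> \<in> cylinder A (ch v k)"
proof -
  have "\<omega> (length v) \<in> next_letter v ` {1..deg v}"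
    using extension_of_point[OF assms] next_letter_bij[OF v] by (simp add: bij_betw_def)
  then obtain k where "k \<in> {1..deg v}" "\<omega> (length v) = next_letter v k" by auto
  then show ?thesis using \<omega> by (intro bexI[of _ k]) (simp_all add: ch_def cylinder_append)
qed

lemma ch_disjoint:
  assumes "v \<in> nodes" "k \<in> {1..deg v}" "j \<in> {1..deg v}"
    and "\<omega> \<in> cylinder A (ch v k)" "\<omega> \<in> cylinder A (ch v j)"
  shows "k = j"
  using next_letter_bij[OF assms(1)] assms(2-5)
  by (auto simp: ch_def cylinder_append bij_betw_def dest: inj_onD)

lemma ch_subset: "cylinder A (ch v k) \<subseteq> cylinder A v"
  by (auto simp: ch_def cylinder_append)

lemma sum_ch:
  fixes c :: "nat \<Rightarrow> real"
  assumes v: "v \<in> nodes" and k: "k \<in> {1..deg v}" and \<omega>: "\<omega> \<in> cylinder A (ch v k)"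
  shows "(\<Sum>i\<in>{1..deg v}. c i * indicator (cylinder A (ch v i)) \<omega>) = c k"
proof -
  have "(\<Sum>i\<in>{1..deg v}. c i * indicator (cylinder A (ch v i)) \<omega>) = (\<Sum>i\<in>{1..deg v}. if i = k then c i else 0)"
  proof (rule sum.cong[OF refl])
    fix i assume i: "i \<in> {1..deg v}"
    show "c i * indicator (cylinder A (ch v i)) \<omega> = (if i = k then c i else 0)"
    proof (cases "i = k")
      case False
      then have "\<omega> \<notin> cylinder A (ch v i)" using ch_disjoint[OF v i k _ \<omega>] by auto
      then show ?thesis using False by simp
    qed (use \<omega> in simp)
  qed
  then show ?thesis using k by simp
qed

lemma sum_ch_outside:
  fixes c :: "nat \<Rightarrow> real"
  assumes "\<omega> \<notin> cylinder A v"
  shows "(\<Sum>i\<in>{1..deg v}. c i * indicator (cylinder A (ch v i)) \<omega>) = 0"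
  using assms ch_subset by (intro sum.neutral) (auto simp: indicator_def)

lemma powr_mass:
  "mass w > 0 \<Longrightarrow> mass w powr (- 1 / 2) = 1 / sqrt (mass w)"
  "mass w > 0 \<Longrightarrow> mass w powr - (1 / 2) = 1 / sqrt (mass w)"
  using powr_minus_divide[of "mass w" "1 / 2"] by (simp_all add: powr_half_sqrt)

text \<open>A point of the cylinder serves to split off the last letter: its shorter prefix is again
  a node, whose children cover the point. This feeds the induction on the length of a word.\<close>

lemma admissible_as_child:
  assumes w: "w \<in> admissible_words A"
  obtains v k where "v \<in> nodes" "k \<in> {1..deg v}" "w = ch v k"
proof -
  obtain \<omega> where \<omega>: "\<omega> \<in> cylinder A w" using w by (rule admissible_cylinder_nonempty)
  have \<omega>S: "\<omega> \<in> subshift A" using \<omega> cylinder_subset by auto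
  obtain m where m: "length w = Suc m" using admissible_wordsD(1)[OF w] by (cases w) auto
  let ?v = "map \<omega> [0..<m]"
  have v: "?v \<in> nodes"
    using subshift_prefix_admissible[OF \<omega>S, of m] by (cases "m = 0") (auto simp: nodes_def)
  have wv: "w = ?v @ [\<omega> m]" using cylinder_prefix_eq[OF \<omega>] m by simp
  have "\<omega> \<in> cylinder A ?v" using \<omega>S by (simp add: mem_cylinder_prefix)
  from ch_cover[OF v this] obtain k where k: "k \<in> {1..deg ?v}" "\<omega> \<in> cylinder A (ch ?v k)"
    by (elim bexE)
  then have "ch ?v k = w" by (simp add: ch_def cylinder_append wv)
  then show ?thesis using that v k by metis
qed

text \<open>The letter cylinders partition the space. Hence the square roots of their masses form a
  unit vector, as the reflection at the root requires.\<close>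

lemma sum_root_mass: "(\<Sum>k=1..l. mass [k]) = 1"
proof -
  have N: "[] \<in> nodes" "deg [] = l" "\<And>k. ch [] k = [k]"
    by (simp_all add: nodes_def deg_def ch_def next_letter_def)
  have "(\<Sum>k=1..l. mass [k]) = (\<integral>\<omega>. (\<Sum>k=1..l. 1 * indicator (cylinder A [k]) \<omega>) \<partial>\<mu>)"
    by (subst Bochner_Integration.integral_sum)
      (auto simp: less_top[symmetric] Int_absorb2 cylinder_subset)
  also have "\<dots> = (\<integral>\<omega>. 1 \<partial>\<mu>)"
  proof (rule Bochner_Integration.integral_cong[OF refl])
    fix \<omega> assume "\<omega> \<in> space \<mu>"
    then obtain k where "k \<in> {1..deg []}" "\<omega> \<in> cylinder A (ch [] k)"
      using ch_cover[OF N(1), of \<omega>] by auto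
    from sum_ch[OF N(1) this, of "\<lambda>_. 1"] show "(\<Sum>k=1..l. 1 * indicator (cylinder A [k]) \<omega>) = (1::real)"
      by (simp add: N)
  qed
  finally show ?thesis by (simp add: prob_space)
qed

section \<open>The orthogonal matrices of the nodes\<close>

lemma frame_vec_carrier: "frame_vec A \<mu> \<theta> v j \<in> carrier_vec (alpha A v)"
  by (simp add: frame_vec_def)

lemma inner_at_frame_vec:
  assumes v: "v \<in> admissible_words A" and k: "k \<in> {1..alpha A v}"
  shows "inner_at A \<mu> \<theta> v (frame_vec A \<mu> \<theta> v k) z = sqrt (mass (ch v k)) * vec_index z (k - 1)"
proof -
  have vn: "v \<in> nodes" "v \<noteq> []" using v admissible_wordsD(1) by (auto simp: nodes_def)
  have m: "child_mass A \<mu> \<theta> v j = mass (ch v j)" for j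
    using vn by (simp add: child_mass_def child_def ch_def next_letter_def)
  have pos: "mass (ch v k) > 0" using ch_mass_pos[OF vn(1)] k vn by (simp add: deg_def)
  have "inner_at A \<mu> \<theta> v (frame_vec A \<mu> \<theta> v k) z =
      (\<Sum>j\<in>{1..alpha A v}. if j = k then mass (ch v k) * (1 / sqrt (mass (ch v k))) * vec_index z (k - 1) else 0)"
    unfolding inner_at_def
    by (rule sum.cong) (use k in \<open>auto simp: frame_vec_def m powr_mass[OF pos]\<close>)
  also have "\<dots> = mass (ch v k) * (1 / sqrt (mass (ch v k))) * vec_index z (k - 1)"
    using k by simp
  finally show ?thesis using pos by (simp add: real_div_sqrt)
qed

text \<open>At a nonempty word \<open>Q v\<close> is the matrix of \<open>U v\<close> in the
  orthonormal frame, and \<open>U v\<close> preserves the weighted inner product; at the root it is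
  the Householder reflection.\<close>

lemma Q_col_orthonormal:
  assumes v: "v \<in> nodes" and ij: "i \<in> {1..deg v}" "j \<in> {1..deg v}"
  shows "(\<Sum>k=1..deg v. Q v k i * Q v k j) = (if i = j then 1 else 0)"
proof (cases "v = []")
  case True
  then show ?thesis
    using Householder_col_orthonormal[of l "\<lambda>k. sqrt (mass [k])" i j] l_pos sum_root_mass ij
    by (simp add: Q_def deg_def)
next
  case False
  then have va: "v \<in> admissible_words A" using v nodes_cases by auto
  have dv: "deg v = alpha A v" using False by (simp add: deg_def)
  let ?f = "frame_vec A \<mu> \<theta> v" and ?m = "\<lambda>k. mass (ch v k)"
  have UO: "U v \<in> Omega A \<mu> \<theta> v" using haar va by (simp add: haar_choice_def)
  have m: "child_mass A \<mu> \<theta> v k = ?m k" for k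
    using False by (simp add: child_mass_def child_def ch_def next_letter_def)
  have "(\<Sum>k=1..deg v. Q v k i * Q v k j) = inner_at A \<mu> \<theta> v (U v *\<^sub>v ?f i) (U v *\<^sub>v ?f j)"
    unfolding inner_at_def dv
  proof (rule sum.cong[OF refl])
    fix k assume k: "k \<in> {1..alpha A v}"
    have "sqrt (?m k) * sqrt (?m k) = ?m k" by simp
    then show "Q v k i * Q v k j =
        child_mass A \<mu> \<theta> v k * vec_index (U v *\<^sub>v ?f i) (k - 1) * vec_index (U v *\<^sub>v ?f j) (k - 1)"
      using False by (simp add: Q_def inner_at_frame_vec[OF va k] m)
  qed
  also have "\<dots> = inner_at A \<mu> \<theta> v (?f i) (?f j)"
    using UO frame_vec_carrier by (simp add: Omega_def)
  also have "\<dots> = sqrt (?m i) * vec_index (?f j) (i - 1)"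
    using ij dv by (intro inner_at_frame_vec[OF va]) simp
  also have "\<dots> = (if i = j then 1 else 0)"
  proof -
    have "?m j > 0" using ch_mass_pos[OF v ij(2)] .
    moreover have "(i - 1 = j - 1) = (i = j)" "i - 1 < alpha A v" "j - 1 < alpha A v"
      using ij dv by auto
    ultimately show ?thesis
      using ij dv by (simp add: frame_vec_def m powr_mass)
  qed
  finally show ?thesis .
qed

lemma Q_row_orthonormal:
  assumes v: "v \<in> nodes" and ij: "i \<in> {1..deg v}" "j \<in> {1..deg v}"
  shows "(\<Sum>k=1..deg v. Q v i k * Q v j k) = (if i = j then 1 else 0)"
  using row_orthonormal_of_col_orthonormal[of "deg v" "Q v", OF Q_col_orthonormal[OF v] ij] by simp

text \<open>At a nonempty word this is the condition of \<open>Omega\<close> on the image of the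
  last frame vector, read in coordinates; the reflection at the root was chosen to satisfy the same
  formula.\<close>

lemma Q_last_col:
  assumes v: "v \<in> nodes" and k: "k \<in> {1..deg v}"
  shows "Q v k (deg v) = sqrt (mass (ch v k)) / sqrt (mass v)"
proof (cases "v = []")
  case True
  then show ?thesis
    using Householder_last_col[of l "\<lambda>k. sqrt (mass [k])" k] l_pos sum_root_mass k
    by (simp add: Q_def deg_def ch_def next_letter_def)
next
  case False
  then have va: "v \<in> admissible_words A" using v nodes_cases by auto
  have dv: "deg v = alpha A v" using False by (simp add: deg_def)
  have "U v \<in> Omega A \<mu> \<theta> v" using haar va by (simp add: haar_choice_def)
  then have "U v *\<^sub>v frame_vec A \<mu> \<theta> v (alpha A v) =
      mass v powr (- 1 / 2) \<cdot>\<^sub>v Matrix.vec (alpha A v) (\<lambda>_. 1)"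
    by (simp add: Omega_def)
  moreover have "k - 1 < alpha A v" using k dv by auto
  ultimately show ?thesis
    using False k dv node_mass_pos[OF v]
    by (simp add: Q_def inner_at_frame_vec[OF va] powr_mass)
qed

section \<open>The functions attached to a node\<close>

lemma b_on_ch:
  assumes v: "v \<in> nodes" and k: "k \<in> {1..deg v}" and \<omega>: "\<omega> \<in> cylinder A (ch v k)"
  shows "b v j \<omega> = Q v k j / sqrt (mass (ch v k))"
  using sum_ch[OF assms, of "\<lambda>k. mass (ch v k) powr (- 1 / 2) * Q v k j"] powr_mass[OF ch_mass_pos[OF v k]]
  by (simp add: b_def)

lemma b_outside: "\<omega> \<notin> cylinder A v \<Longrightarrow> b v j \<omega> = 0"
  unfolding b_def by (rule sum_ch_outside)

lemma b_measurable [measurable]: "b v j \<in> borel_measurable \<mu>"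
  unfolding b_def by measurable

lemma b_bounded: "\<exists>C. \<forall>\<omega>. \<bar>b v j \<omega>\<bar> \<le> C"
proof (intro exI allI)
  fix \<omega>
  have "\<bar>b v j \<omega>\<bar> \<le> (\<Sum>k\<in>{1..deg v}. \<bar>mass (ch v k) powr (- 1 / 2) * Q v k j * indicator (cylinder A (ch v k)) \<omega>\<bar>)"
    unfolding b_def by (rule sum_abs)
  also have "\<dots> \<le> (\<Sum>k\<in>{1..deg v}. \<bar>mass (ch v k) powr (- 1 / 2) * Q v k j\<bar>)"
    by (rule sum_mono) (simp add: indicator_def)
  finally show "\<bar>b v j \<omega>\<bar> \<le> (\<Sum>k\<in>{1..deg v}. \<bar>mass (ch v k) powr (- 1 / 2) * Q v k j\<bar>)" .
qed

lemma b_L2: "(\<lambda>\<omega>. complex_of_real (b v j \<omega>)) \<in> L2_functions \<mu>"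
proof -
  obtain C where "\<And>\<omega>. \<bar>b v j \<omega>\<bar> \<le> C" using b_bounded by meson
  then show ?thesis by (intro L2_functions_bounded[of _ C]) (simp_all, measurable)
qed

lemma b_locally_constant: "locally_constant (Suc (length v)) (b v j)"
proof -
  have eq: "(\<omega> \<in> cylinder A (ch v k)) = (\<upsilon> \<in> cylinder A (ch v k))"
    if "\<omega> \<in> subshift A" "\<upsilon> \<in> subshift A" "\<forall>i<Suc (length v). \<omega> i = \<upsilon> i" for \<omega> \<upsilon> k
    using that by (simp add: mem_cylinder ch_def)
  show ?thesis
    unfolding locally_constant_def
  proof (intro ballI impI)
    fix \<omega> \<upsilon> assume "\<omega> \<in> subshift A" "\<upsilon> \<in> subshift A" "\<forall>i<Suc (length v). \<omega> i = \<upsilon> i"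
    from eq[OF this] show "b v j \<omega> = b v j \<upsilon>"
      unfolding b_def by (intro sum.cong refl) (simp add: indicator_def)
  qed
qed

lemma b_orthonormal_same:
  assumes v: "v \<in> nodes" and ij: "i \<in> {1..deg v}" "j \<in> {1..deg v}"
  shows "(\<integral>\<omega>. b v i \<omega> * b v j \<omega> \<partial>\<mu>) = (if i = j then 1 else 0)"
proof -
  have eq: "b v i \<omega> * b v j \<omega> =
      (\<Sum>k\<in>{1..deg v}. (Q v k i * Q v k j / mass (ch v k)) * indicator (cylinder A (ch v k)) \<omega>)" for \<omega>
  proof (cases "\<omega> \<in> cylinder A v")
    case True
    from ch_cover[OF v this] obtain k where k: "k \<in> {1..deg v}" "\<omega> \<in> cylinder A (ch v k)"
    by (elim bexE)
    have "sqrt (mass (ch v k)) * sqrt (mass (ch v k)) = mass (ch v k)" by simp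
    then show ?thesis
      unfolding sum_ch[OF v k] by (simp add: b_on_ch[OF v k])
  next
    case False
    then show ?thesis
      using b_outside[OF False, of i] sum_ch_outside[OF False, of "\<lambda>k. Q v k i * Q v k j / mass (ch v k)"]
      by simp
  qed
  have "(\<integral>\<omega>. b v i \<omega> * b v j \<omega> \<partial>\<mu>) = (\<Sum>k\<in>{1..deg v}. (Q v k i * Q v k j / mass (ch v k)) * mass (ch v k))"
    unfolding eq
    by (subst Bochner_Integration.integral_sum)
      (auto simp: less_top[symmetric] Int_absorb2 cylinder_subset intro!: integrable_mult_right)
  also have "\<dots> = (\<Sum>k\<in>{1..deg v}. Q v k i * Q v k j)"
    by (rule sum.cong) (use ch_mass_pos[OF v] in force)+
  also have "\<dots> = (if i = j then 1 else 0)" by (rule Q_col_orthonormal[OF v ij])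
  finally show ?thesis .
qed

text \<open>On child \<open>k\<close> the factor \<open>sqrt (mass (ch v k))\<close> of the last
  column cancels, which leaves a value independent of the child.\<close>

lemma b_last:
  assumes v: "v \<in> nodes"
  shows "b v (deg v) \<omega> = indicator (cylinder A v) \<omega> / sqrt (mass v)"
proof (cases "\<omega> \<in> cylinder A v")
  case True
  from ch_cover[OF v this] obtain k where k: "k \<in> {1..deg v}" "\<omega> \<in> cylinder A (ch v k)"
    by (elim bexE)
  then show ?thesis
    using True ch_mass_pos[OF v k(1)] by (simp add: b_on_ch[OF v k] Q_last_col[OF v k(1)])
next
  case False
  then show ?thesis by (simp add: b_outside)
qed

text \<open>The last function of the node is a nonzero constant on the cylinder and is orthogonal to
  the other functions.\<close>

lemma integral_b:
  assumes v: "v \<in> nodes" and j: "j \<in> {1..<deg v}"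
  shows "(\<integral>\<omega>. b v j \<omega> \<partial>\<mu>) = 0"
proof -
  have "b v j \<omega> * b v (deg v) \<omega> = b v j \<omega> * (1 / sqrt (mass v))" for \<omega>
    unfolding b_last[OF v] by (cases "\<omega> \<in> cylinder A v") (simp_all add: b_outside)
  moreover have "(\<integral>\<omega>. b v j \<omega> * b v (deg v) \<omega> \<partial>\<mu>) = 0"
    using b_orthonormal_same[OF v, of j "deg v"] j by simp
  ultimately have "(\<integral>\<omega>. b v j \<omega> * (1 / sqrt (mass v)) \<partial>\<mu>) = 0" by simp
  then have "(\<integral>\<omega>. b v j \<omega> \<partial>\<mu>) * (1 / sqrt (mass v)) = 0"
    using integral_mult_left_zero[of \<mu> "b v j" "1 / sqrt (mass v)"] by metis
  then show ?thesis using node_mass_pos[OF v] by simp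
qed

text \<open>\<open>g\<close> is constant on the cylinder of \<open>v\<close>, which carries
  \<open>b v j\<close>, a function of mean zero. Orthogonality between levels and the finite
  expansions of locally constant functions rest on this.\<close>

lemma integral_locally_constant_mult_b:
  assumes g: "locally_constant n g" and v: "v \<in> nodes" "n \<le> length v" and j: "j \<in> {1..<deg v}"
  shows "(\<integral>\<omega>. g \<omega> * complex_of_real (b v j \<omega>) \<partial>\<mu>) = 0"
proof -
  have "cylinder A v \<noteq> {}" using node_mass_pos[OF v(1)] by auto
  then obtain \<tau> where \<tau>: "\<tau> \<in> cylinder A v" by auto
  have "(\<integral>\<omega>. g \<omega> * complex_of_real (b v j \<omega>) \<partial>\<mu>) = (\<integral>\<omega>. g \<tau> * complex_of_real (b v j \<omega>) \<partial>\<mu>)"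
  proof (rule Bochner_Integration.integral_cong[OF refl])
    fix \<omega> assume "\<omega> \<in> space \<mu>"
    show "g \<omega> * complex_of_real (b v j \<omega>) = g \<tau> * complex_of_real (b v j \<omega>)"
    proof (cases "\<omega> \<in> cylinder A v")
      case True
      have "g \<omega> = g \<tau>"
        by (rule locally_constantD[OF g]) (use True \<tau> v(2) in \<open>simp_all add: mem_cylinder\<close>)
      then show ?thesis by simp
    next
      case False
      then show ?thesis by (simp add: b_outside)
    qed
  qed
  also have "\<dots> = g \<tau> * complex_of_real (\<integral>\<omega>. b v j \<omega> \<partial>\<mu>)"
    by simp
  finally show ?thesis by (simp add: integral_b[OF v(1) j])
qed

text \<open>The pair \<open>([], l)\<close> stands for the constant function. At the other nodes the
  last function is left out, because the indicator of a cylinder is already spanned by functions of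
  the nodes above it.\<close>

definition haar_index :: "(nat list \<times> nat) set" where
  "haar_index = insert ([], l) {(v, j). v \<in> nodes \<and> j \<in> {1..<deg v}}"

definition e :: "nat list \<times> nat \<Rightarrow> ((nat \<Rightarrow> nat) \<Rightarrow> complex) set" where
  "e i = L2_class \<mu> (\<lambda>\<omega>. complex_of_real (b (fst i) (snd i) \<omega>))"

lemma haar_indexD:
  assumes "(v, j) \<in> haar_index"
  shows "v \<in> nodes" "j \<in> {1..deg v}" "v \<noteq> [] \<Longrightarrow> j \<in> {1..<deg v}"
  using assms l_pos by (auto simp: haar_index_def nodes_def deg_def)

section \<open>Orthonormality and totality of the completed Haar system\<close>

lemma hinner_class_e:
  assumes f: "f \<in> L2_functions \<mu>"
  shows "hinner (L2 \<mu>) (L2_class \<mu> f) (e (v, j)) = (\<integral>\<omega>. f \<omega> * complex_of_real (b v j \<omega>) \<partial>\<mu>)"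
  by (simp add: e_def L2_hinner[OF f b_L2])

lemma e_carrier: "e i \<in> carrier (L2 \<mu>)"
  by (simp add: e_def L2_class_carrier b_L2)

text \<open>Three cases: the same word has orthonormal columns, distinct words of equal length have
  disjoint cylinders, and the function of a shorter word is constant on the cylinder of a longer
  one.\<close>

lemma e_orthonormal_aux:
  assumes i: "(v, j) \<in> haar_index" and i': "(v', j') \<in> haar_index"
    and len: "length v \<le> length v'"
  shows "(\<integral>\<omega>. complex_of_real (b v j \<omega>) * complex_of_real (b v' j' \<omega>) \<partial>\<mu>) = (if (v, j) = (v', j') then 1 else 0)"
proof (cases "v = v'")
  case True
  have "(\<integral>\<omega>. complex_of_real (b v j \<omega>) * complex_of_real (b v' j' \<omega>) \<partial>\<mu>) =
      complex_of_real (\<integral>\<omega>. b v j \<omega> * b v' j' \<omega> \<partial>\<mu>)"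
    by (simp flip: of_real_mult)
  then show ?thesis
    using b_orthonormal_same[of v j j'] haar_indexD[OF i] haar_indexD[OF i'] True by simp
next
  case False
  have "(\<integral>\<omega>. complex_of_real (b v j \<omega>) * complex_of_real (b v' j' \<omega>) \<partial>\<mu>) = 0"
  proof (cases "length v = length v'")
    case True
    have "b v j \<omega> * b v' j' \<omega> = 0" for \<omega>
    proof (cases "\<omega> \<in> cylinder A v")
      case \<omega>: True
      then have "\<omega> \<notin> cylinder A v'"
        using False cylinder_prefix_eq[of \<omega>] True by metis
      then show ?thesis by (simp add: b_outside)
    qed (simp add: b_outside)
    then have "(\<lambda>\<omega>. complex_of_real (b v j \<omega>) * complex_of_real (b v' j' \<omega>)) = (\<lambda>_. 0)"
      by (simp add: fun_eq_iff)
    then show ?thesis by simp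
  next
    case neq: False
    then have "v' \<noteq> []" "Suc (length v) \<le> length v'" using len by auto
    moreover have "locally_constant (Suc (length v)) (\<lambda>\<omega>. complex_of_real (b v j \<omega>))"
      by (rule locally_constant_compose[OF b_locally_constant])
    ultimately show ?thesis
      using haar_indexD[OF i'] by (intro integral_locally_constant_mult_b) auto
  qed
  then show ?thesis using False by simp
qed

lemma e_orthonormal:
  assumes "i \<in> haar_index" "i' \<in> haar_index"
  shows "hinner (L2 \<mu>) (e i) (e i') = (if i = i' then 1 else 0)"
proof -
  obtain v j v' j' where i: "i = (v, j)" "i' = (v', j')" by (cases i, cases i')
  have "hinner (L2 \<mu>) (e i) (e i') = (\<integral>\<omega>. complex_of_real (b v j \<omega>) * complex_of_real (b v' j' \<omega>) \<partial>\<mu>)"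
    using L2_hinner[OF b_L2 b_L2] by (simp add: e_def i)
  then show ?thesis
    using e_orthonormal_aux[of v j v' j'] e_orthonormal_aux[of v' j' v j] assms i
    by (cases "length v \<le> length v'") (simp_all add: mult.commute eq_commute)
qed

text \<open>The functions of a node arise from the normalised indicators of its children by an
  orthogonal matrix. Orthonormality of the rows inverts this relation and recovers the integrals
  over the children.\<close>

lemma integral_cylinder_children:
  assumes h: "h \<in> L2_functions \<mu>" and v: "v \<in> nodes"
    and zero: "\<And>j. j \<in> {1..deg v} \<Longrightarrow> (\<integral>\<omega>. h \<omega> * complex_of_real (b v j \<omega>) \<partial>\<mu>) = 0"
    and k: "k \<in> {1..deg v}"
  shows "(\<integral>\<omega>. h \<omega> * indicator (cylinder A (ch v k)) \<omega> \<partial>\<mu>) = 0"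
proof -
  have hi: "integrable \<mu> h" using h by (rule L2_functions_integrable)
  have int: "integrable \<mu> (\<lambda>\<omega>. h \<omega> * indicator (cylinder A w) \<omega>)" for w
  proof -
    have "integrable \<mu> (\<lambda>\<omega>. indicat_real (cylinder A w) \<omega> *\<^sub>R h \<omega>)"
      by (rule integrable_mult_indicator[OF cylinder_sets hi])
    moreover have "(\<lambda>\<omega>. indicat_real (cylinder A w) \<omega> *\<^sub>R h \<omega>) = (\<lambda>\<omega>. h \<omega> * indicator (cylinder A w) \<omega>)"
      by (auto simp: fun_eq_iff indicator_def)
    ultimately show ?thesis by simp
  qed
  \<comment> \<open>\<open>t k\<close> is the integral of \<open>h\<close> against the normalised
    indicator of child \<open>k\<close>; then \<open>col\<close> says that \<open>t\<close> is
    orthogonal to every column of \<open>Q v\<close>.\<close>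
  define t where "t k = (\<integral>\<omega>. h \<omega> * indicator (cylinder A (ch v k)) \<omega> \<partial>\<mu>) * complex_of_real (mass (ch v k) powr (- 1 / 2))" for k
  have col: "(\<Sum>i\<in>{1..deg v}. t i * complex_of_real (Q v i j)) = 0" if j: "j \<in> {1..deg v}" for j
  proof -
    have "h \<omega> * complex_of_real (b v j \<omega>) = (\<Sum>i\<in>{1..deg v}. (h \<omega> * indicator (cylinder A (ch v i)) \<omega>)
        * (complex_of_real (mass (ch v i) powr (- 1 / 2)) * complex_of_real (Q v i j)))" for \<omega>
      unfolding b_def of_real_sum sum_distrib_left
      by (rule sum.cong) (auto simp: indicator_def)
    then have "0 = (\<integral>\<omega>. (\<Sum>i\<in>{1..deg v}. (h \<omega> * indicator (cylinder A (ch v i)) \<omega>)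
        * (complex_of_real (mass (ch v i) powr (- 1 / 2)) * complex_of_real (Q v i j))) \<partial>\<mu>)"
      using zero[OF j] by simp
    also have "\<dots> = (\<Sum>i\<in>{1..deg v}. t i * complex_of_real (Q v i j))"
      by (subst Bochner_Integration.integral_sum, rule integrable_mult_left, rule int)
        (unfold integral_mult_left_zero t_def, simp only: mult.assoc)
    finally show ?thesis by simp
  qed
  have "0 = (\<Sum>j\<in>{1..deg v}. complex_of_real (Q v k j) * (\<Sum>i\<in>{1..deg v}. t i * complex_of_real (Q v i j)))"
    using col by simp
  also have "\<dots> = (\<Sum>i\<in>{1..deg v}. t i * complex_of_real (\<Sum>j\<in>{1..deg v}. Q v k j * Q v i j))"
    unfolding sum_distrib_left of_real_sum by (subst sum.swap) (simp add: mult_ac)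
  also have "\<dots> = (\<Sum>i\<in>{1..deg v}. if i = k then t k else 0)"
    by (rule sum.cong) (use Q_row_orthonormal[OF v k] in auto)
  also have "\<dots> = t k" using k by simp
  finally show ?thesis using ch_mass_pos[OF v k] by (simp add: t_def)
qed

text \<open>Induction from the root downwards. The last function of the parent is a multiple of its
  indicator and falls under the induction hypothesis, or is the constant at the root; the other
  functions belong to the basis.\<close>

lemma e_total_cylinder:
  assumes h: "h \<in> L2_functions \<mu>"
    and zero: "\<And>v j. (v, j) \<in> haar_index \<Longrightarrow> (\<integral>\<omega>. h \<omega> * complex_of_real (b v j \<omega>) \<partial>\<mu>) = 0"
    and w: "w \<in> nodes"
  shows "(\<integral>\<omega>. h \<omega> * indicator (cylinder A w) \<omega> \<partial>\<mu>) = 0"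
  using w
proof (induction "length w" arbitrary: w rule: less_induct)
  case less
  show ?case
  proof (cases "w = []")
    case True
    have "b [] l \<omega> = indicator (subshift A) \<omega>" for \<omega>
      using b_last[of "[]" \<omega>] by (simp add: nodes_def deg_def)
    then have eq: "(\<lambda>\<omega>. h \<omega> * complex_of_real (b [] l \<omega>)) = (\<lambda>\<omega>. h \<omega> * indicator (cylinder A []) \<omega>)"
      by (simp add: indicator_def fun_eq_iff)
    have "([], l) \<in> haar_index" by (simp add: haar_index_def)
    from zero[OF this] show ?thesis unfolding eq True .
  next
    case False
    then have "w \<in> admissible_words A" using less.prems nodes_cases by auto
    then obtain v k where vk: "v \<in> nodes" "k \<in> {1..deg v}" "w = ch v k" by (rule admissible_as_child)
    have "(\<integral>\<omega>. h \<omega> * complex_of_real (b v j \<omega>) \<partial>\<mu>) = 0" if j: "j \<in> {1..deg v}" for j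
    proof (cases "j = deg v")
      case True
      have "(\<integral>\<omega>. h \<omega> * indicator (cylinder A v) \<omega> \<partial>\<mu>) = 0"
        using less.hyps[of v] vk by (simp add: ch_def)
      moreover have "h \<omega> * complex_of_real (b v j \<omega>) =
          h \<omega> * indicator (cylinder A v) \<omega> * complex_of_real (1 / sqrt (mass v))" for \<omega>
        unfolding True b_last[OF vk(1)] by (simp add: indicator_def)
      ultimately show ?thesis by simp
    next
      case False
      then show ?thesis using j vk by (intro zero) (auto simp: haar_index_def)
    qed
    from integral_cylinder_children[OF h vk(1) this vk(2)] show ?thesis by (simp add: vk(3))
  qed
qed

text \<open>Cylinders generate the measurable sets and are stable under intersection, so the
  vanishing integrals extend from cylinders to all measurable sets, and \<open>h\<close> is zero
  almost everywhere.\<close>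

lemma e_total:
  assumes H: "H \<in> carrier (L2 \<mu>)" and zero: "\<And>i. i \<in> haar_index \<Longrightarrow> hinner (L2 \<mu>) H (e i) = 0"
  shows "H = \<zero>\<^bsub>L2 \<mu>\<^esub>"
proof -
  obtain h where h: "h \<in> L2_functions \<mu>" "H = L2_class \<mu> h" using H by (rule L2_carrierE)
  have hi: "integrable \<mu> h" using h(1) by (rule L2_functions_integrable)
  have z: "(\<integral>\<omega>. h \<omega> * complex_of_real (b v j \<omega>) \<partial>\<mu>) = 0" if "(v, j) \<in> haar_index" for v j
    using zero[OF that] hinner_class_e[OF h(1)] h(2) by simp
  have cyl: "set_lebesgue_integral \<mu> (cylinder A w) h = 0" if "w \<in> nodes" for w
  proof -
    have "set_lebesgue_integral \<mu> (cylinder A w) h = (\<integral>\<omega>. h \<omega> * indicator (cylinder A w) \<omega> \<partial>\<mu>)"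
      unfolding set_lebesgue_integral_def
      by (rule Bochner_Integration.integral_cong) (auto simp: indicator_def)
    then show ?thesis using e_total_cylinder[OF h(1) z that] by simp
  qed
  have si: "set_integrable \<mu> E h" if "E \<in> sets \<mu>" for E
    unfolding set_integrable_def using integrable_mult_indicator[OF that hi] .
  let ?G = "insert {} (cylinder A ` admissible_words A)"
  have sets: "sets \<mu> = sigma_sets (subshift A) ?G"
  proof -
    have "sigma_sets (subshift A) ?G = sigma_sets (subshift A) (cylinder A ` admissible_words A)"
      by (rule sigma_sets_eqI) (auto intro: sigma_sets.Basic sigma_sets.Empty)
    then show ?thesis by (simp add: sets_gibbs)
  qed
  have GP: "?G \<subseteq> Pow (subshift A)" using cylinder_subset by auto
  have "set_lebesgue_integral \<mu> E h = 0" if E: "E \<in> sets \<mu>" for E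
    using Int_stable_cylinders GP E[unfolded sets]
  proof (induction rule: sigma_sets_induct_disjoint)
    case (basic E)
    then show ?case using cyl by (auto simp: nodes_def set_lebesgue_integral_def)
  next
    case empty
    then show ?case by (simp add: set_lebesgue_integral_def)
  next
    case (compl E)
    have ES: "E \<in> sets \<mu>" using compl by (simp add: sets)
    have whole: "set_lebesgue_integral \<mu> (subshift A) h = 0" using cyl[of "[]"] by (simp add: nodes_def)
    have "E \<subseteq> subshift A" using sets.sets_into_space[OF ES] by simp
    then have "E \<union> (subshift A - E) = subshift A" by auto
    moreover have "set_lebesgue_integral \<mu> (E \<union> (subshift A - E)) h =
        set_lebesgue_integral \<mu> E h + set_lebesgue_integral \<mu> (subshift A - E) h"
      using ES sets.compl_sets[OF ES] by (intro set_integral_Un si) auto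
    ultimately show ?case using whole compl.IH by simp
  next
    case (union F)
    have FS: "F i \<in> sets \<mu>" for i using union by (auto simp: sets)
    have "set_lebesgue_integral \<mu> (\<Union>i. F i) h = (\<Sum>i. set_lebesgue_integral \<mu> (F i) h)"
      using union(1) FS by (intro lebesgue_integral_countable_add si) (auto simp: disjoint_family_on_def)
    then show ?case using union by simp
  qed
  then have "AE \<omega> in \<mu>. h \<omega> = 0" by (rule density_zero[OF hi])
  then show ?thesis using h by (simp add: L2_zero L2_class_eq_iff)
qed

lemma hilbert_basis: "hilbert_basis (L2 \<mu>) e haar_index"
proof (rule hilbert_basis.intro[OF L2_hilbert_space], unfold_locales)
  show "countable haar_index" by (rule countable_subset[of _ UNIV]) auto
  show "e i \<in> carrier (L2 \<mu>)" for i by (rule e_carrier)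
  show "hinner (L2 \<mu>) (e i) (e j) = (if i = j then 1 else 0)"
    if "i \<in> haar_index" "j \<in> haar_index" for i j using that by (rule e_orthonormal)
  show "h = \<zero>\<^bsub>L2 \<mu>\<^esub>" if "h \<in> carrier (L2 \<mu>)" "\<And>i. i \<in> haar_index \<Longrightarrow> hinner (L2 \<mu>) h (e i) = 0" for h
    using that by (rule e_total)
qed

end

section \<open>The Dirac operator\<close>

locale dirac_system = haar_system +
  fixes Dom :: "((nat \<Rightarrow> nat) \<Rightarrow> complex) set set"
  assumes domain: "dirac_domain A \<mu> \<theta> U Dom"

sublocale dirac_system \<subseteq> HB: hilbert_basis "L2 \<mu>" e haar_index
  by (rule hilbert_basis)

context dirac_system
begin

abbreviation ivec :: "(nat \<Rightarrow> nat) set \<Rightarrow> ((nat \<Rightarrow> nat) \<Rightarrow> complex) set" where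
  "ivec \<equiv> indicator_vec \<mu>"

section \<open>The completed Haar system lies in the domain\<close>

lemma indicator_L2: "E \<in> sets \<mu> \<Longrightarrow> (indicator E :: _ \<Rightarrow> complex) \<in> L2_functions \<mu>"
  by (rule L2_functions_bounded[of _ 1]) (auto simp: indicator_def)

lemma ivec_carrier: "E \<in> sets \<mu> \<Longrightarrow> ivec E \<in> carrier (L2 \<mu>)"
  by (simp add: indicator_vec_def L2_class_carrier indicator_L2)

lemma Dom_subspace: "linear_subspace (L2 \<mu>) Dom"
  using domain by (simp add: dirac_domain_def)

lemma Dom_carrier: "h \<in> Dom \<Longrightarrow> h \<in> carrier (L2 \<mu>)"
  using Dom_subspace by (auto simp: linear_subspace_def)

lemma haar_basis_in_Dom:
  assumes x: "x \<in> haar_basis A \<mu> \<theta> U" and c: "x \<in> carrier (L2 \<mu>)"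
  shows "x \<in> Dom"
proof -
  have "finsum (L2 \<mu>) (\<lambda>v. 1 \<odot>\<^bsub>L2 \<mu>\<^esub> v) {x} = 1 \<odot>\<^bsub>L2 \<mu>\<^esub> x"
    using HB.M.finsum_insert[of "{}" x "\<lambda>v. 1 \<odot>\<^bsub>L2 \<mu>\<^esub> v"] HB.smult_carrier[OF c, of 1] by simp
  also have "\<dots> = x" using HB.smult_one[OF c] by simp
  finally have "x \<in> linear_span (L2 \<mu>) (haar_basis A \<mu> \<theta> U)"
    unfolding linear_span_def mem_Collect_eq
    using x by (intro exI[of _ "\<lambda>_. 1"] exI[of _ "{x}"]) simp
  then show ?thesis using domain by (auto simp: dirac_domain_def)
qed

lemma root_simps [simp]: "[] \<in> nodes" "deg [] = l" "ch [] k = [k]"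
  by (simp_all add: nodes_def deg_def ch_def next_letter_def)

lemma letter_mass_pos: "k \<in> {1..l} \<Longrightarrow> mass [k] > 0"
  using ch_mass_pos[of "[]" k] by simp

text \<open>Written in letter indicators, the root vectors are seen to lie in the domain, and their
  inner products reduce to those with the indicators that occur in the Dirac operator.\<close>

lemma e_root:
  "e ([], j) = finsum (L2 \<mu>) (\<lambda>k. complex_of_real (Q [] k j / sqrt (mass [k])) \<odot>\<^bsub>L2 \<mu>\<^esub> ivec (cylinder A [k])) {1..l}"
proof -
  have "finsum (L2 \<mu>) (\<lambda>k. complex_of_real (Q [] k j / sqrt (mass [k])) \<odot>\<^bsub>L2 \<mu>\<^esub> ivec (cylinder A [k])) {1..l}
      = finsum (L2 \<mu>) (\<lambda>k. L2_class \<mu> (\<lambda>\<omega>. complex_of_real (Q [] k j / sqrt (mass [k])) * indicator (cylinder A [k]) \<omega>)) {1..l}"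
    unfolding indicator_vec_def by (simp only: L2_smult[OF indicator_L2[OF cylinder_sets]])
  also have "\<dots> = L2_class \<mu> (\<lambda>\<omega>. \<Sum>k\<in>{1..l}. complex_of_real (Q [] k j / sqrt (mass [k])) * indicator (cylinder A [k]) \<omega>)"
    by (rule L2_finsum) (intro L2_functions_smult indicator_L2 cylinder_sets)
  also have "(\<lambda>\<omega>. \<Sum>k\<in>{1..l}. complex_of_real (Q [] k j / sqrt (mass [k])) * indicator (cylinder A [k]) \<omega>) =
      (\<lambda>\<omega>. complex_of_real (b [] j \<omega>))"
    unfolding b_def root_simps of_real_sum
    by (intro ext sum.cong refl) (auto simp: powr_mass[OF letter_mass_pos] indicator_def)
  finally show ?thesis by (simp add: e_def)
qed

lemma e_last_root: "ivec (subshift A) = e ([], l)"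
proof -
  have "complex_of_real (b [] l \<omega>) = indicator (subshift A) \<omega>" for \<omega>
    using b_last[of "[]" \<omega>] by (simp add: indicator_def)
  then show ?thesis by (simp add: e_def indicator_vec_def)
qed

lemma e_eq_haar_vec: "v \<noteq> [] \<Longrightarrow> e (v, j) = haar_vec A \<mu> \<theta> U v j"
  by (simp add: e_def haar_vec_def haar_function_eq)

lemma e_in_Dom:
  assumes i: "i \<in> haar_index"
  shows "e i \<in> Dom"
proof -
  obtain v j where vj: "i = (v, j)" by (cases i)
  show ?thesis
  proof (cases "v = []")
    case False
    then have "v \<in> admissible_words A" "j \<in> {1..alpha A v - 1}"
      using haar_indexD[of v j] i vj nodes_cases[of v] by (auto simp: deg_def)
    then have "e i \<in> haar_basis A \<mu> \<theta> U"
      unfolding haar_basis_def using e_eq_haar_vec[OF False] vj by auto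
    then show ?thesis using e_carrier by (rule haar_basis_in_Dom)
  next
    case True
    have "ivec (cylinder A [k]) \<in> Dom" if k: "k \<in> {1..l}" for k
    proof -
      let ?c = "complex_of_real (mass [k] powr (- 1 / 2))"
      have c: "ivec (cylinder A [k]) \<in> carrier (L2 \<mu>)" by (rule ivec_carrier) simp
      have "?c \<odot>\<^bsub>L2 \<mu>\<^esub> ivec (cylinder A [k]) \<in> haar_basis A \<mu> \<theta> U"
        unfolding haar_basis_def using k by (auto simp: alphabet_eq)
      then have "?c \<odot>\<^bsub>L2 \<mu>\<^esub> ivec (cylinder A [k]) \<in> Dom"
        by (rule haar_basis_in_Dom) (rule HB.smult_carrier[OF c])
      \<comment> \<open>The Haar basis contains the normalised indicators; the factor is undone
        inside the subspace.\<close>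
      then have "(1 / ?c) \<odot>\<^bsub>L2 \<mu>\<^esub> (?c \<odot>\<^bsub>L2 \<mu>\<^esub> ivec (cylinder A [k])) \<in> Dom"
        using Dom_subspace by (simp add: linear_subspace_def)
      moreover have "(1 / ?c) \<odot>\<^bsub>L2 \<mu>\<^esub> (?c \<odot>\<^bsub>L2 \<mu>\<^esub> ivec (cylinder A [k])) = ivec (cylinder A [k])"
      proof -
        have "(1 / ?c) \<odot>\<^bsub>L2 \<mu>\<^esub> (?c \<odot>\<^bsub>L2 \<mu>\<^esub> ivec (cylinder A [k])) =
            (1 / ?c * ?c) \<odot>\<^bsub>L2 \<mu>\<^esub> ivec (cylinder A [k])"
          using HB.smult_assoc1[of "1 / ?c" ?c, OF _ _ c] by simp
        also have "1 / ?c * ?c = 1" using letter_mass_pos[OF k] by simp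
        finally show ?thesis using HB.smult_one[OF c] by simp
      qed
      ultimately show ?thesis by simp
    qed
    then show ?thesis
      unfolding vj True e_root using Dom_subspace
      by (intro HB.subspace_finsum[OF Dom_subspace]) (simp add: linear_subspace_def)
  qed
qed

text \<open>At the root the sum over letters is the projection onto the functions of the first
  letter, and the projection onto the constants is subtracted: hence 1, and 0 for the constant
  function.\<close>

definition lam :: "nat list \<times> nat \<Rightarrow> real" where
  "lam i = (if fst i = [] then if snd i = l then 0 else 1
     else (real (alpha A (fst i)) - 1) / mass (fst i))"

section \<open>The Dirac operator in coordinates\<close>

lemma dirac_term_carrier:
  assumes "y \<in> admissible_words A"
  shows "dirac_term A \<mu> \<theta> U h y \<in> carrier (L2 \<mu>)"
proof -
  have "y \<noteq> []" using admissible_wordsD(1)[OF assms] .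
  then have "haar_vec A \<mu> \<theta> U y k \<in> carrier (L2 \<mu>)" for k
    using e_carrier[of "(y, k)"] by (simp add: e_eq_haar_vec)
  then show ?thesis
    unfolding dirac_term_def by (intro HB.smult_carrier HB.finsum_carrier)
qed

lemma hinner_dirac_term:
  assumes y: "y \<in> admissible_words A" and i: "(v, j) \<in> haar_index" and h: "h \<in> carrier (L2 \<mu>)"
  shows "hinner (L2 \<mu>) (dirac_term A \<mu> \<theta> U h y) (e (v, j)) =
    (if y = v then complex_of_real (lam (v, j)) * hinner (L2 \<mu>) h (e (v, j)) else 0)"
proof -
  have y0: "y \<noteq> []" "y \<in> nodes" using admissible_wordsD(1)[OF y] y by (auto simp: nodes_def)
  have idx: "(y, k) \<in> haar_index" if "k \<in> {1..alpha A y - 1}" for k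
    using that y0 by (auto simp: haar_index_def deg_def)
  let ?c = "complex_of_real ((real (alpha A y) - 1) / mass y)"
  have eq: "dirac_term A \<mu> \<theta> U h y =
      ?c \<odot>\<^bsub>L2 \<mu>\<^esub> finsum (L2 \<mu>) (\<lambda>k. hinner (L2 \<mu>) h (e (y, k)) \<odot>\<^bsub>L2 \<mu>\<^esub> e (y, k)) {1..alpha A y - 1}"
    unfolding dirac_term_def using y0 by (simp add: e_eq_haar_vec)
  have "hinner (L2 \<mu>) (dirac_term A \<mu> \<theta> U h y) (e (v, j)) =
      ?c * (\<Sum>k\<in>{1..alpha A y - 1}. hinner (L2 \<mu>) (hinner (L2 \<mu>) h (e (y, k)) \<odot>\<^bsub>L2 \<mu>\<^esub> e (y, k)) (e (v, j)))"
    unfolding eq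
    by (subst HB.hinner_smult, rule HB.finsum_carrier, rule HB.smult_carrier, rule e_carrier, rule e_carrier,
        subst HB.hinner_finsum, rule HB.smult_carrier, rule e_carrier, rule e_carrier, rule refl)
  also have "\<dots> = ?c * (\<Sum>k\<in>{1..alpha A y - 1}. if (y, k) = (v, j) then hinner (L2 \<mu>) h (e (v, j)) else 0)"
    by (intro arg_cong2[where f = "(*)"] sum.cong refl)
      (use idx i in \<open>auto simp: HB.hinner_smult[OF e_carrier e_carrier] e_orthonormal\<close>)
  also have "\<dots> = (if y = v then complex_of_real (lam (v, j)) * hinner (L2 \<mu>) h (e (v, j)) else 0)"
  proof (cases "y = v")
    case True
    then have "j \<in> {1..alpha A y - 1}" using haar_indexD[OF i] y0 by (auto simp: deg_def)
    then show ?thesis using True y0 by (simp add: lam_def)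
  qed simp
  finally show ?thesis .
qed

text \<open>A basis vector of the word \<open>v\<close> meets only the summand of \<open>v\<close>,
  so the coordinate is the same for all finite partial sums that contain it. The root is no
  admissible word and receives 0.\<close>

lemma hinner_dirac_sum:
  assumes s: "hilbert_has_sum (L2 \<mu>) (dirac_term A \<mu> \<theta> U h) (admissible_words A) s"
    and i: "(v, j) \<in> haar_index" and h: "h \<in> carrier (L2 \<mu>)"
  shows "hinner (L2 \<mu>) s (e (v, j)) =
    (if v = [] then 0 else complex_of_real (lam (v, j)) * hinner (L2 \<mu>) h (e (v, j)))"
proof (rule tendsto_unique[OF finite_subsets_at_top_neq_bot])
  let ?t = "dirac_term A \<mu> \<theta> U h" and ?W = "admissible_words A"
  let ?r = "if v = [] then 0 else complex_of_real (lam (v, j)) * hinner (L2 \<mu>) h (e (v, j))"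
  show "((\<lambda>F. hinner (L2 \<mu>) (finsum (L2 \<mu>) ?t F) (e (v, j))) \<longlongrightarrow> hinner (L2 \<mu>) s (e (v, j)))
      (finite_subsets_at_top ?W)"
    using s unfolding hilbert_has_sum_def by (rule HB.limitin_hinner) (rule e_carrier)
  have "\<forall>\<^sub>F F in finite_subsets_at_top ?W. hinner (L2 \<mu>) (finsum (L2 \<mu>) ?t F) (e (v, j)) = ?r"
    unfolding eventually_finite_subsets_at_top
  proof (intro exI[of _ "{v} \<inter> ?W"] conjI allI impI)
    fix F assume F: "finite F \<and> {v} \<inter> ?W \<subseteq> F \<and> F \<subseteq> ?W"
    have "hinner (L2 \<mu>) (finsum (L2 \<mu>) ?t F) (e (v, j)) = (\<Sum>y\<in>F. hinner (L2 \<mu>) (?t y) (e (v, j)))"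
      using F by (intro HB.hinner_finsum dirac_term_carrier e_carrier) auto
    also have "\<dots> = (\<Sum>y\<in>F. if y = v then complex_of_real (lam (v, j)) * hinner (L2 \<mu>) h (e (v, j)) else 0)"
      using F by (intro sum.cong refl hinner_dirac_term i h) auto
    also have "\<dots> = (if v \<in> F then complex_of_real (lam (v, j)) * hinner (L2 \<mu>) h (e (v, j)) else 0)"
      using F by simp
    also have "\<dots> = ?r"
    proof (cases "v = []")
      case True
      then have "v \<notin> F" using F admissible_wordsD(1) by auto
      then show ?thesis using True by simp
    next
      case False
      then have "v \<in> ?W" using haar_indexD(1)[OF i] nodes_cases by auto
      then show ?thesis using F False by auto
    qed
    finally show "hinner (L2 \<mu>) (finsum (L2 \<mu>) ?t F) (e (v, j)) = ?r" .
  qed auto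
  then show "((\<lambda>F. hinner (L2 \<mu>) (finsum (L2 \<mu>) ?t F) (e (v, j))) \<longlongrightarrow> ?r) (finite_subsets_at_top ?W)"
    by (rule tendsto_eventually)
qed

text \<open>The sum exists by the condition on the domain and is unique because its coordinates are
  known, so the definite description in \<open>dirac\<close> denotes it.\<close>

lemma dirac_sum_the:
  assumes h: "h \<in> Dom"
  shows "hilbert_has_sum (L2 \<mu>) (dirac_term A \<mu> \<theta> U h) (admissible_words A)
    (THE s. hilbert_has_sum (L2 \<mu>) (dirac_term A \<mu> \<theta> U h) (admissible_words A) s)"
proof -
  let ?P = "hilbert_has_sum (L2 \<mu>) (dirac_term A \<mu> \<theta> U h) (admissible_words A)"
  obtain s where s: "?P s" using domain h by (auto simp: dirac_domain_def)
  have "t = s" if t: "?P t" for t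
  proof (rule HB.coord_eqI)
    show "t \<in> carrier (L2 \<mu>)" "s \<in> carrier (L2 \<mu>)"
      using s t by (simp_all add: hilbert_has_sum_def HB.limitin_hilbert)
    fix i assume "i \<in> haar_index"
    then show "HB.coord t i = HB.coord s i"
      using hinner_dirac_sum[OF s _ Dom_carrier[OF h]] hinner_dirac_sum[OF t _ Dom_carrier[OF h]]
      by (cases i) (simp add: HB.coord_def)
  qed
  then show ?thesis using s by (intro theI[of ?P s])
qed

lemma hinner_ivec_letter_e:
  assumes k: "k \<in> {1..l}" and i: "(v, j) \<in> haar_index"
  shows "hinner (L2 \<mu>) (ivec (cylinder A [k])) (e (v, j)) =
    (if v = [] then complex_of_real (Q [] k j * sqrt (mass [k])) else 0)"
proof -
  have eq: "hinner (L2 \<mu>) (ivec (cylinder A [k])) (e (v, j)) =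
      (\<integral>\<omega>. indicator (cylinder A [k]) \<omega> * complex_of_real (b v j \<omega>) \<partial>\<mu>)"
    unfolding indicator_vec_def by (rule hinner_class_e) (rule indicator_L2[OF cylinder_sets])
  show ?thesis
  proof (cases "v = []")
    case True
    have "(\<lambda>\<omega>. indicator (cylinder A [k]) \<omega> * complex_of_real (b v j \<omega>)) =
        (\<lambda>\<omega>. complex_of_real (Q [] k j / sqrt (mass [k]) * indicator (cylinder A [k]) \<omega>))"
      using b_on_ch[of "[]" k _ j] k True by (auto simp: fun_eq_iff indicator_def)
    then have "hinner (L2 \<mu>) (ivec (cylinder A [k])) (e (v, j)) =
        complex_of_real (\<integral>\<omega>. Q [] k j / sqrt (mass [k]) * indicator (cylinder A [k]) \<omega> \<partial>\<mu>)"
      unfolding eq by (simp only: integral_complex_of_real)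
    also have "(\<integral>\<omega>. Q [] k j / sqrt (mass [k]) * indicator (cylinder A [k]) \<omega> \<partial>\<mu>) =
        Q [] k j / sqrt (mass [k]) * mass [k]"
      by (simp add: Int_absorb2 cylinder_subset)
    also have "\<dots> = Q [] k j * sqrt (mass [k])"
      using letter_mass_pos[OF k] by (simp add: real_div_sqrt field_simps)
    finally show ?thesis using True by simp
  next
    case False
    have "locally_constant 1 (indicator (cylinder A [k]) :: _ \<Rightarrow> complex)"
      unfolding locally_constant_def by (auto simp: mem_cylinder indicator_def)
    moreover have "1 \<le> length v" using False by (cases v) auto
    ultimately show ?thesis
      unfolding eq using integral_locally_constant_mult_b haar_indexD[OF i] False by simp
  qed
qed

lemma hinner_e_root:
  assumes h: "h \<in> carrier (L2 \<mu>)"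
  shows "hinner (L2 \<mu>) h (e ([], j)) =
    (\<Sum>k\<in>{1..l}. complex_of_real (Q [] k j / sqrt (mass [k])) * hinner (L2 \<mu>) h (ivec (cylinder A [k])))"
  unfolding e_root
  by (subst HB.hinner_finsum_right, rule HB.smult_carrier, rule ivec_carrier, rule cylinder_sets, rule h,
      intro sum.cong refl, subst HB.hinner_smult_right, rule h, rule ivec_carrier, rule cylinder_sets, simp)

lemma dirac_coord:
  assumes h: "h \<in> Dom"
  shows "dirac A \<mu> \<theta> U h \<in> carrier (L2 \<mu>)"
    and "i \<in> haar_index \<Longrightarrow> HB.coord (dirac A \<mu> \<theta> U h) i = complex_of_real (lam i) * HB.coord h i"
proof -
  let ?g = "\<lambda>x. (complex_of_real (1 / mass [x]) * hinner (L2 \<mu>) h (ivec (cylinder A [x])))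
      \<odot>\<^bsub>L2 \<mu>\<^esub> ivec (cylinder A [x])"
  let ?c = "hinner (L2 \<mu>) h (e ([], l)) \<odot>\<^bsub>L2 \<mu>\<^esub> e ([], l)"
  define s where "s = (THE s. hilbert_has_sum (L2 \<mu>) (dirac_term A \<mu> \<theta> U h) (admissible_words A) s)"
  have s: "hilbert_has_sum (L2 \<mu>) (dirac_term A \<mu> \<theta> U h) (admissible_words A) s"
    unfolding s_def by (rule dirac_sum_the[OF h])
  have hc: "h \<in> carrier (L2 \<mu>)" by (rule Dom_carrier[OF h])
  have D: "dirac A \<mu> \<theta> U h = finsum (L2 \<mu>) ?g {1..l} \<ominus>\<^bsub>L2 \<mu>\<^esub> ?c \<oplus>\<^bsub>L2 \<mu>\<^esub> s"
    unfolding dirac_def s_def e_last_root alphabet_eq ..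
  have gc: "?g x \<in> carrier (L2 \<mu>)" for x by (intro HB.smult_carrier ivec_carrier cylinder_sets)
  have fc: "finsum (L2 \<mu>) ?g {1..l} \<in> carrier (L2 \<mu>)" by (rule HB.finsum_carrier) (rule gc)
  have cc: "?c \<in> carrier (L2 \<mu>)" by (rule HB.smult_carrier) (rule e_carrier)
  have sc: "s \<in> carrier (L2 \<mu>)" using s by (simp add: hilbert_has_sum_def HB.limitin_hilbert)
  have dc: "finsum (L2 \<mu>) ?g {1..l} \<ominus>\<^bsub>L2 \<mu>\<^esub> ?c \<in> carrier (L2 \<mu>)" by (rule HB.minus_carrier[OF fc cc])
  show "dirac A \<mu> \<theta> U h \<in> carrier (L2 \<mu>)" unfolding D by (rule HB.M.a_closed[OF dc sc])
  assume i: "i \<in> haar_index"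
  obtain v j where vj: "i = (v, j)" by (cases i)
  have ivj: "(v, j) \<in> haar_index" using i vj by simp
  \<comment> \<open>The sum over letters acts as the identity on root coordinates:
    \<open>1 / mass [k]\<close> and \<open>sqrt (mass [k])\<close> combine into the coefficients of
    \<open>e_root\<close>. Basis vectors of nonempty words are orthogonal to all letter
    indicators.\<close>
  have f: "hinner (L2 \<mu>) (finsum (L2 \<mu>) ?g {1..l}) (e (v, j)) = (if v = [] then hinner (L2 \<mu>) h (e (v, j)) else 0)"
  proof -
    have "hinner (L2 \<mu>) (finsum (L2 \<mu>) ?g {1..l}) (e (v, j)) = (\<Sum>k\<in>{1..l}. hinner (L2 \<mu>) (?g k) (e (v, j)))"
      by (rule HB.hinner_finsum[OF gc e_carrier])
    also have "\<dots> = (\<Sum>k\<in>{1..l}. complex_of_real (1 / mass [k]) * hinner (L2 \<mu>) h (ivec (cylinder A [k]))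
        * (if v = [] then complex_of_real (Q [] k j * sqrt (mass [k])) else 0))"
      by (rule sum.cong[OF refl])
        (simp only: HB.hinner_smult[OF ivec_carrier[OF cylinder_sets] e_carrier] hinner_ivec_letter_e[OF _ ivj])
    also have "\<dots> = (if v = [] then hinner (L2 \<mu>) h (e (v, j)) else 0)"
    proof (cases "v = []")
      case True
      have "complex_of_real (1 / mass [k]) * hinner (L2 \<mu>) h (ivec (cylinder A [k]))
          * complex_of_real (Q [] k j * sqrt (mass [k])) =
          complex_of_real (Q [] k j / sqrt (mass [k])) * hinner (L2 \<mu>) h (ivec (cylinder A [k]))"
        if k: "k \<in> {1..l}" for k
      proof -
        have "1 / mass [k] * (Q [] k j * sqrt (mass [k])) = Q [] k j / sqrt (mass [k])"
          using letter_mass_pos[OF k] by (simp add: field_simps)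
        then have eq: "complex_of_real (1 / mass [k]) * complex_of_real (Q [] k j * sqrt (mass [k])) =
            complex_of_real (Q [] k j / sqrt (mass [k]))"
          by (simp only: flip: of_real_mult)
        have "x * z * y = w * z" if "x * y = w" for x y z w :: complex
          using that by auto
        from this[OF eq] show ?thesis .
      qed
      then show ?thesis using True hinner_e_root[OF hc, of j] by simp
    qed simp
    finally show ?thesis .
  qed
  have c: "hinner (L2 \<mu>) ?c (e (v, j)) = (if (v, j) = ([], l) then hinner (L2 \<mu>) h (e (v, j)) else 0)"
  proof -
    have "([], l) \<in> haar_index" by (simp add: haar_index_def)
    then show ?thesis
      using HB.hinner_smult[OF e_carrier e_carrier] e_orthonormal[OF _ ivj] by auto
  qed
  have "hinner (L2 \<mu>) (dirac A \<mu> \<theta> U h) (e (v, j)) =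
      hinner (L2 \<mu>) (finsum (L2 \<mu>) ?g {1..l}) (e (v, j)) - hinner (L2 \<mu>) ?c (e (v, j))
      + hinner (L2 \<mu>) s (e (v, j))"
    unfolding D by (simp only: HB.hinner_add[OF dc sc e_carrier] HB.hinner_diff[OF fc cc e_carrier])
  then show "HB.coord (dirac A \<mu> \<theta> U h) i = complex_of_real (lam i) * HB.coord h i"
    unfolding HB.coord_def vj f c hinner_dirac_sum[OF s ivj hc] by (auto simp: lam_def)
qed

lemma diagonal: "diagonal_operator (L2 \<mu>) e haar_index lam Dom (dirac A \<mu> \<theta> U)"
proof (rule diagonal_operator.intro[OF hilbert_basis], unfold_locales)
  show "linear_subspace (L2 \<mu>) Dom" by (rule Dom_subspace)
qed (simp_all add: e_in_Dom dirac_coord)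

section \<open>Finiteness of the spectrum below a bound and locally constant vectors\<close>

lemma finite_short_index: "finite {i \<in> haar_index. length (fst i) < n}"
proof (rule finite_subset)
  show "{i \<in> haar_index. length (fst i) < n} \<subseteq>
      (SIGMA v:{v. set v \<subseteq> alphabet A \<and> length v \<le> n}. {1..deg v})"
  proof
    fix i assume "i \<in> {i \<in> haar_index. length (fst i) < n}"
    then show "i \<in> (SIGMA v:{v. set v \<subseteq> alphabet A \<and> length v \<le> n}. {1..deg v})"
      using haar_indexD(1,2)[of "fst i" "snd i"] nodes_cases[of "fst i"] admissible_wordsD(2)[of "fst i"]
      by (cases i) auto
  qed
  show "finite (SIGMA v:{v. set v \<subseteq> alphabet A \<and> length v \<le> n}. {1..deg v})"
    by (rule finite_SigmaI) (auto intro: finite_lists_length_le)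
qed

text \<open>A nonempty word occurs in the index set only if it branches, and then its eigenvalue is
  at least \<open>1 / mass v\<close>. A bound on the eigenvalue therefore makes the word
  heavy.\<close>

lemma finite_small_eigenvalues: "finite {i \<in> haar_index. \<bar>lam i\<bar> \<le> C}"
proof (rule finite_subset)
  \<comment> \<open>The maximum with 1 keeps the mass threshold \<open>1 / C'\<close>
    positive.\<close>
  define C' where "C' = max C 1"
  have C': "C' > 0" "C \<le> C'" by (simp_all add: C'_def)
  let ?W = "{w \<in> admissible_words A. alpha A w \<ge> 2 \<and> 1 / C' \<le> mass w}"
  show "{i \<in> haar_index. \<bar>lam i\<bar> \<le> C} \<subseteq> (SIGMA v:insert [] ?W. {1..deg v})"
  proof
    fix i assume i: "i \<in> {i \<in> haar_index. \<bar>lam i\<bar> \<le> C}"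
    obtain v j where vj: "i = (v, j)" by (cases i)
    have idx: "(v, j) \<in> haar_index" and lam: "\<bar>lam (v, j)\<bar> \<le> C" using i vj by auto
    have "v \<in> insert [] ?W"
    proof (cases "v = []")
      case False
      then have va: "v \<in> admissible_words A" using haar_indexD(1)[OF idx] nodes_cases by auto
      have "j \<in> {1..<alpha A v}" using haar_indexD(3)[OF idx False] False by (simp add: deg_def)
      then have al: "alpha A v \<ge> 2" by auto
      have "1 / mass v \<le> (real (alpha A v) - 1) / mass v"
        using al mass_pos[OF va] by (intro divide_right_mono) auto
      also have "\<dots> = lam (v, j)" using False by (simp add: lam_def)
      also have "\<dots> \<le> C'" using lam C'(2) by linarith
      finally have "1 / C' \<le> mass v" using C'(1) mass_pos[OF va] by (simp add: field_simps)
      then show ?thesis using va al by simp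
    qed simp
    then show "i \<in> (SIGMA v:insert [] ?W. {1..deg v})" using haar_indexD(2)[OF idx] vj by simp
  qed
  have "finite ?W" by (rule finite_heavy_branching) (use C' in simp)
  then show "finite (SIGMA v:insert [] ?W. {1..deg v})" by (intro finite_SigmaI) auto
qed

text \<open>Coordinates at words of length at least \<open>n\<close> vanish, so the class is a
  finite combination of basis vectors. The condition \<open>n \<ge> 1\<close> keeps the root out of
  this argument, since the constant function has nonzero mean.\<close>

lemma locally_constant_in_Dom:
  assumes g: "g \<in> L2_functions \<mu>" and lc: "locally_constant n g" and n: "n \<ge> 1"
  shows "L2_class \<mu> g \<in> Dom"
proof -
  let ?F = "{i \<in> haar_index. length (fst i) < n}"
  have gc: "L2_class \<mu> g \<in> carrier (L2 \<mu>)" by (rule L2_class_carrier[OF g])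
  have cc: "HB.comb (HB.coord (L2_class \<mu> g)) ?F \<in> carrier (L2 \<mu>)" by (rule HB.comb_carrier) auto
  have "L2_class \<mu> g = HB.comb (HB.coord (L2_class \<mu> g)) ?F"
  proof (rule HB.coord_eqI[OF gc cc])
    fix i assume i: "i \<in> haar_index"
    obtain v j where vj: "i = (v, j)" by (cases i)
    have "HB.coord (L2_class \<mu> g) i = 0" if "i \<notin> ?F"
    proof -
      have len: "n \<le> length v" using that i vj by simp
      then have "v \<noteq> []" using n by auto
      then show ?thesis
        unfolding HB.coord_def vj hinner_class_e[OF g]
        using i vj len by (intro integral_locally_constant_mult_b[OF lc]) (auto dest: haar_indexD)
    qed
    then show "HB.coord (L2_class \<mu> g) i = HB.coord (HB.comb (HB.coord (L2_class \<mu> g)) ?F) i"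
      using HB.coord_comb[OF finite_short_index _ i, of n "HB.coord (L2_class \<mu> g)"] by (cases "i \<in> ?F") auto
  qed
  moreover have "HB.comb (HB.coord (L2_class \<mu> g)) ?F \<in> Dom"
    using e_in_Dom by (intro HB.subspace_comb Dom_subspace) auto
  ultimately show ?thesis by simp
qed

section \<open>The representation of continuous functions and its commutators\<close>

lemma CY_measurable: "a \<in> carrier CY \<Longrightarrow> a \<in> borel_measurable \<mu>"
  by (simp add: continuous_functions_carrier_iff continuous_measurable)

lemma CY_bounded: "a \<in> carrier CY \<Longrightarrow> \<omega> \<in> space \<mu> \<Longrightarrow> cmod (a \<omega>) \<le> anorm CY a"
  using norm_le_anorm by simp

lemma rep_class:
  assumes "f \<in> L2_functions \<mu>" "a \<in> carrier CY"
  shows "multiplication_rep \<mu> a (L2_class \<mu> f) = L2_class \<mu> (\<lambda>\<omega>. a \<omega> * f \<omega>)"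
  by (rule multiplication_rep_class[OF assms(1) CY_measurable[OF assms(2)] CY_bounded[OF assms(2)]])

lemma mult_L2:
  assumes "f \<in> L2_functions \<mu>" "a \<in> carrier CY"
  shows "(\<lambda>\<omega>. a \<omega> * f \<omega>) \<in> L2_functions \<mu>"
  by (rule L2_functions_mult[OF assms(1) CY_measurable[OF assms(2)] CY_bounded[OF assms(2)]])

lemma rep_e_in_Dom:
  assumes a: "a \<in> carrier CY" and lc: "locally_constant n a"
  shows "multiplication_rep \<mu> a (e i) \<in> Dom"
proof -
  obtain v j where vj: "i = (v, j)" by (cases i)
  \<comment> \<open>\<open>b v j\<close> depends on one letter beyond the word
    \<open>v\<close>.\<close>
  let ?N = "max n (Suc (length v))"
  have la: "locally_constant ?N a" by (rule locally_constant_mono[OF lc]) simp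
  have lb: "locally_constant ?N (b v j)" by (rule locally_constant_mono[OF b_locally_constant]) simp
  have "locally_constant ?N (\<lambda>\<omega>. a \<omega> * complex_of_real (b v j \<omega>))"
    unfolding locally_constant_def
  proof (intro ballI impI)
    fix \<omega> \<upsilon> assume "\<omega> \<in> subshift A" "\<upsilon> \<in> subshift A" "\<forall>i<?N. \<omega> i = \<upsilon> i"
    then have "a \<omega> = a \<upsilon>" "b v j \<omega> = b v j \<upsilon>"
      using locally_constantD[OF la, of \<omega> \<upsilon>] locally_constantD[OF lb, of \<omega> \<upsilon>] by blast+
    then show "a \<omega> * complex_of_real (b v j \<omega>) = a \<upsilon> * complex_of_real (b v j \<upsilon>)" by simp
  qed
  then have "L2_class \<mu> (\<lambda>\<omega>. a \<omega> * complex_of_real (b v j \<omega>)) \<in> Dom"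
    by (intro locally_constant_in_Dom mult_L2[OF b_L2 a]) auto
  then show ?thesis by (simp add: vj e_def rep_class[OF b_L2 a])
qed

text \<open>On the cylinder of a word of length at least \<open>n\<close> the conjugate of
  \<open>a\<close> is constant, so the basis vectors of that word are eigenvectors of the adjoint.
  The finitely many indices of shorter words form the exceptional set.\<close>

lemma commutator_locally_constant:
  assumes a: "a \<in> carrier CY" and lc: "locally_constant n a"
  shows "commutator_extends_bounded (L2 \<mu>) Dom (dirac A \<mu> \<theta> U) (multiplication_rep \<mu> a)"
proof -
  interpret DO: diagonal_operator "L2 \<mu>" e haar_index lam Dom "dirac A \<mu> \<theta> U" by (rule diagonal)
  define a' where "a' = star CY a"
  have a': "a' \<in> carrier CY" "\<And>\<omega>. \<omega> \<in> space \<mu> \<Longrightarrow> a' \<omega> = cnj (a \<omega>)"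
    using continuous_functions_closed(6)[OF a a] by (simp_all add: a'_def continuous_functions_simps)
  have lc': "locally_constant n a'"
    unfolding locally_constant_def
  proof (intro ballI impI)
    fix \<omega> \<upsilon> assume "\<omega> \<in> subshift A" "\<upsilon> \<in> subshift A" "\<forall>i<n. \<omega> i = \<upsilon> i"
    then show "a' \<omega> = a' \<upsilon>" using locally_constantD[OF lc, of \<omega> \<upsilon>] a'(2) by simp
  qed
  define m where "m i = a' (SOME \<tau>. \<tau> \<in> cylinder A (fst i))" for i :: "nat list \<times> nat"
  let ?F = "{i \<in> haar_index. length (fst i) < n}"
  show ?thesis
  proof (rule DO.bounded_commutator[where T' = "multiplication_rep \<mu> a'" and F = ?F and m = m])
    show "multiplication_rep \<mu> a \<in> bounded_operators (L2 \<mu>)"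
      by (rule multiplication_rep_bounded_operator[OF CY_measurable[OF a] CY_bounded[OF a]])
    show "multiplication_rep \<mu> a' h \<in> carrier (L2 \<mu>)" if "h \<in> carrier (L2 \<mu>)" for h
      by (rule multiplication_rep_closed[OF that CY_measurable[OF a'(1)] CY_bounded[OF a'(1)]])
    show "hinner (L2 \<mu>) (multiplication_rep \<mu> a g) h = hinner (L2 \<mu>) g (multiplication_rep \<mu> a' h)"
      if "g \<in> carrier (L2 \<mu>)" "h \<in> carrier (L2 \<mu>)" for g h
      by (rule multiplication_rep_adjoint[OF CY_measurable[OF a] CY_bounded[OF a] CY_measurable[OF a'(1)] a'(2) that])
    show "multiplication_rep \<mu> a (e i) \<in> Dom" for i by (rule rep_e_in_Dom[OF a lc])
    show "multiplication_rep \<mu> a' (e i) \<in> Dom" for i by (rule rep_e_in_Dom[OF a'(1) lc'])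
    show "finite ?F" by (rule finite_short_index)
    show "?F \<subseteq> haar_index" by auto
    fix i assume i: "i \<in> haar_index - ?F"
    obtain v j where vj: "i = (v, j)" by (cases i)
    have v: "v \<in> nodes" "n \<le> length v" using i vj haar_indexD(1)[of v j] by auto
    have "cylinder A v \<noteq> {}" using node_mass_pos[OF v(1)] by auto
    then have \<tau>: "(SOME \<tau>. \<tau> \<in> cylinder A v) \<in> cylinder A v" by (simp add: some_in_eq)
    have "a' \<omega> * complex_of_real (b v j \<omega>) = m i * complex_of_real (b v j \<omega>)" for \<omega>
    proof (cases "\<omega> \<in> cylinder A v")
      case True
      have "a' \<omega> = m i"
        unfolding m_def vj fst_conv
        by (rule locally_constantD[OF lc']) (use True \<tau> v(2) in \<open>simp_all add: mem_cylinder\<close>)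
      then show ?thesis by simp
    qed (simp add: b_outside)
    then have "(\<lambda>\<omega>. a' \<omega> * complex_of_real (b v j \<omega>)) = (\<lambda>\<omega>. m i * complex_of_real (b v j \<omega>))"
      by (rule ext)
    then show "multiplication_rep \<mu> a' (e i) = m i \<odot>\<^bsub>L2 \<mu>\<^esub> e i"
      unfolding vj e_def fst_conv snd_conv rep_class[OF b_L2 a'(1)] L2_smult[OF b_L2] by (simp only:)
  qed
qed

lemma commutator_dense:
  "Metric_space.mtopology (carrier CY) (adist CY) closure_of
     {a \<in> carrier CY. commutator_extends_bounded (L2 \<mu>) Dom (dirac A \<mu> \<theta> U) (multiplication_rep \<mu> a)}
   = carrier CY" (is "_ closure_of ?S = _")
proof -
  interpret AM: Metric_space "carrier CY" "adist CY" by (rule adist_metric_space)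
  have "\<exists>g\<in>?S. g \<in> AM.mball f r" if f: "f \<in> carrier CY" and r: "r > 0" for f r
  proof -
    obtain n g where g: "g \<in> carrier CY" "locally_constant n g"
        "\<And>\<omega>. \<omega> \<in> subshift A \<Longrightarrow> cmod (f \<omega> - g \<omega>) \<le> r / 2"
      using locally_constant_dense[OF f, of "r / 2"] half_gt_zero[OF r] by metis
    have "adist CY f g = anorm CY (\<lambda>\<omega>\<in>topspace (subshift_topology A). f \<omega> - g \<omega>)"
      using f g(1) by (simp add: adist_def continuous_functions_minus)
    also have "\<dots> \<le> r / 2"
      by (rule anorm_le) (use g(3) in simp)
    finally have "adist CY f g \<le> r / 2" .
    then have "g \<in> AM.mball f r" using f g r by simp
    moreover have "g \<in> ?S" using commutator_locally_constant[OF g(1,2)] g(1) by simp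
    ultimately show ?thesis by (rule bexI)
  qed
  then show ?thesis by (auto simp: AM.metric_closure_of)
qed

lemma faithful: "faithful_star_representation CY (L2 \<mu>) (multiplication_rep \<mu>)"
  unfolding faithful_star_representation_def
proof (intro conjI ballI allI impI)
  fix a assume a: "a \<in> carrier CY"
  show "multiplication_rep \<mu> a \<in> bounded_operators (L2 \<mu>)"
    by (rule multiplication_rep_bounded_operator[OF CY_measurable[OF a] CY_bounded[OF a]])
next
  fix a b h assume a: "a \<in> carrier CY" and b: "b \<in> carrier CY" and h: "h \<in> carrier (L2 \<mu>)"
  obtain f where f: "f \<in> L2_functions \<mu>" "h = L2_class \<mu> f" using h by (rule L2_carrierE)
  have ab: "a \<oplus>\<^bsub>CY\<^esub> b \<in> carrier CY" "a \<otimes>\<^bsub>CY\<^esub> b \<in> carrier CY"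
    using continuous_functions_closed[OF a b] by (simp_all add: continuous_functions_simps)
  have "L2_class \<mu> (\<lambda>x. (a \<oplus>\<^bsub>CY\<^esub> b) x * f x) = L2_class \<mu> (\<lambda>x. a x * f x + b x * f x)"
    by (rule L2_class_cong[OF mult_L2[OF f(1) ab(1)] L2_functions_add[OF mult_L2[OF f(1) a] mult_L2[OF f(1) b]]])
      (simp add: continuous_functions_simps(4) distrib_right)
  then show "multiplication_rep \<mu> (a \<oplus>\<^bsub>CY\<^esub> b) h = multiplication_rep \<mu> a h \<oplus>\<^bsub>L2 \<mu>\<^esub> multiplication_rep \<mu> b h"
    using a b f ab by (simp add: rep_class mult_L2 L2_add)
  have "L2_class \<mu> (\<lambda>x. (a \<otimes>\<^bsub>CY\<^esub> b) x * f x) = L2_class \<mu> (\<lambda>x. a x * (b x * f x))"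
    by (rule L2_class_cong[OF mult_L2[OF f(1) ab(2)] mult_L2[OF mult_L2[OF f(1) b] a]])
      (simp add: continuous_functions_simps(1) mult.assoc)
  then show "multiplication_rep \<mu> (a \<otimes>\<^bsub>CY\<^esub> b) h = multiplication_rep \<mu> a (multiplication_rep \<mu> b h)"
    using a b f ab by (simp add: rep_class mult_L2)
next
  fix c a h assume a: "a \<in> carrier CY" and h: "h \<in> carrier (L2 \<mu>)"
  obtain f where f: "f \<in> L2_functions \<mu>" "h = L2_class \<mu> f" using h by (rule L2_carrierE)
  have ca: "c \<odot>\<^bsub>CY\<^esub> a \<in> carrier CY"
    using continuous_functions_closed(4)[OF a a] by (simp add: continuous_functions_simps)
  have "L2_class \<mu> (\<lambda>x. (c \<odot>\<^bsub>CY\<^esub> a) x * f x) = L2_class \<mu> (\<lambda>x. c * (a x * f x))"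
    by (rule L2_class_cong[OF mult_L2[OF f(1) ca] L2_functions_smult[OF mult_L2[OF f(1) a]]])
      (simp add: continuous_functions_simps(5) mult.assoc)
  then show "multiplication_rep \<mu> (c \<odot>\<^bsub>CY\<^esub> a) h = c \<odot>\<^bsub>L2 \<mu>\<^esub> multiplication_rep \<mu> a h"
    using a f ca by (simp add: rep_class mult_L2 L2_smult)
next
  fix h assume h: "h \<in> carrier (L2 \<mu>)"
  obtain f where f: "f \<in> L2_functions \<mu>" "h = L2_class \<mu> f" using h by (rule L2_carrierE)
  have one: "\<one>\<^bsub>CY\<^esub> \<in> carrier CY"
    by (simp add: continuous_functions_simps continuous_functions_carrier_iff continuous_map_restrict_topspace)
  have "L2_class \<mu> (\<lambda>x. \<one>\<^bsub>CY\<^esub> x * f x) = L2_class \<mu> f"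
    by (rule L2_class_cong[OF mult_L2[OF f(1) one] f(1)]) (simp add: continuous_functions_simps(2))
  then show "multiplication_rep \<mu> \<one>\<^bsub>CY\<^esub> h = h"
    using f one by (simp add: rep_class)
next
  fix a g h assume a: "a \<in> carrier CY" and gh: "g \<in> carrier (L2 \<mu>)" "h \<in> carrier (L2 \<mu>)"
  have sa: "star CY a \<in> carrier CY"
    using continuous_functions_closed(6)[OF a a] by (simp add: continuous_functions_simps)
  have star: "star CY a x = cnj (a x)" if "x \<in> space \<mu>" for x
    using that by (simp add: continuous_functions_simps(6))
  show "hinner (L2 \<mu>) (multiplication_rep \<mu> a g) h = hinner (L2 \<mu>) g (multiplication_rep \<mu> (star CY a) h)"
    by (rule multiplication_rep_adjoint[OF CY_measurable[OF a] CY_bounded[OF a] CY_measurable[OF sa] star gh])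
next
  fix a b assume a: "a \<in> carrier CY" and b: "b \<in> carrier CY"
    and eq: "\<forall>h\<in>carrier (L2 \<mu>). multiplication_rep \<mu> a h = multiplication_rep \<mu> b h"
  have one: "(\<lambda>_. 1) \<in> L2_functions \<mu>" by (rule L2_functions_bounded[of _ 1]) auto
  have L: "a \<in> L2_functions \<mu>" "b \<in> L2_functions \<mu>"
    using mult_L2[OF one a] mult_L2[OF one b] by simp_all
  have "L2_class \<mu> a = L2_class \<mu> b"
    using eq[rule_format, OF L2_class_carrier[OF one]] by (simp add: rep_class[OF one a] rep_class[OF one b])
  then have AE: "AE \<omega> in \<mu>. a \<omega> = b \<omega>" using L by (simp add: L2_class_eq_iff)
  show "a = b"
  proof (rule continuous_functions_eqI[OF a b])
    fix \<omega> assume "\<omega> \<in> topspace (subshift_topology A)"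
    then have \<omega>: "\<omega> \<in> subshift A" by simp
    show "a \<omega> = b \<omega>"
    proof (rule ccontr)
      assume ne: "a \<omega> \<noteq> b \<omega>"
      \<comment> \<open>The functions differ on an open set, which contains a cylinder around
        \<open>\<omega>\<close>. Its positive mass contradicts equality almost everywhere.\<close>
      let ?V = "{\<upsilon> \<in> topspace (subshift_topology A). a \<upsilon> - b \<upsilon> \<in> - {0}}"
      have "continuous_map (subshift_topology A) euclidean (\<lambda>\<upsilon>. a \<upsilon> - b \<upsilon>)"
        using a b by (intro continuous_map_diff) (simp_all add: continuous_functions_carrier_iff)
      then have V: "openin (subshift_topology A) ?V"
        by (rule openin_continuous_map_preimage) (simp add: open_Compl)
      have "\<omega> \<in> ?V" using \<omega> ne by simp
      then obtain k where k: "k \<ge> 1" "cylinder A (map \<omega> [0..<k]) \<subseteq> ?V"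
        using V unfolding openin_subshift_iff by meson
      have "AE \<upsilon> in \<mu>. \<upsilon> \<notin> cylinder A (map \<omega> [0..<k])"
        using AE by eventually_elim (use k(2) in auto)
      then have "mass (map \<omega> [0..<k]) = 0"
        using prob_eq_0[OF cylinder_sets] by simp
      then show False using mass_pos[OF subshift_prefix_admissible[OF \<omega> k(1)]] by simp
    qed
  qed
qed

lemma spectral_triple: "spectral_triple CY (L2 \<mu>) (multiplication_rep \<mu>) Dom (dirac A \<mu> \<theta> U)"
proof -
  interpret DO: diagonal_operator "L2 \<mu>" e haar_index lam Dom "dirac A \<mu> \<theta> U" by (rule diagonal)
  \<comment> \<open>In infinite dimension the index set is infinite, whereas only finitely many
    indices have eigenvalues below a given bound.\<close>
  have "\<not> bounded_on (L2 \<mu>) Dom (dirac A \<mu> \<theta> U)" if "\<not> finite_dimensional (L2 \<mu>)"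
    using that HB.finite_dimensional_if_finite DO.not_bounded[OF finite_small_eigenvalues] by auto
  then show ?thesis
    unfolding spectral_triple_def
    using unital_cstar_algebra L2_hilbert_space HB.separable faithful DO.essentially_self_adjoint
      DO.compact_resolvent[OF finite_small_eigenvalues] commutator_dense by simp
qed

end

theorem theorem4p1:
  fixes l :: nat
    and A :: "nat mat"
    and \<phi> :: "(nat \<Rightarrow> nat) \<Rightarrow> real"
    and \<mu> :: "(nat \<Rightarrow> nat) measure"
    and \<theta> :: "nat list \<Rightarrow> nat \<Rightarrow> nat"
    and U :: "nat list \<Rightarrow> real mat"
    and Dom :: "((nat \<Rightarrow> nat) \<Rightarrow> complex) set set"
  assumes "l \<ge> 1"
    and "A \<in> carrier_mat l l"
    and "\<And>j k. j \<in> {1..l} \<Longrightarrow> k \<in> {1..l} \<Longrightarrow> entry A j k \<in> {0, 1}"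
    and "irreducible_mat A"
    and "aperiodic_mat A"
    and "continuous_map (subshift_topology A) euclideanreal \<phi>"
    and "hoelder_continuous A \<phi>"
    and "gibbs_measure A \<phi> \<mu>"
    and "haar_choice A \<mu> \<theta> U"
    and "dirac_domain A \<mu> \<theta> U Dom"
  shows "spectral_triple (continuous_functions (subshift_topology A)) (L2 \<mu>)
           (multiplication_rep \<mu>) Dom (dirac A \<mu> \<theta> U)"
proof -
  interpret dirac_system l A \<phi> \<mu> \<theta> U Dom
    by (intro dirac_system.intro haar_system.intro gibbs_subshift.intro subshift_matrix.intro
        dirac_system_axioms.intro haar_system_axioms.intro gibbs_subshift_axioms.intro assms)
  show ?thesis by (rule spectral_triple)
qed

end
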